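(* Suppose that $M$ is a finite-dimensional complex left central Leibniz algebra of rank $1$ with radical $R$, and let $B$ be defined by $R\subseteq B\subseteq M$ and $B/R=B(M/R)$, the solvable radical of the Lie algebra $M/R$. Then there is at least one maximal Lie subalgebra $L\in\mathcal{L}^*$ of $M$ with the following properties: (a) $L$ is a maximal isotropic subspace of $M$; (b) $L/R$ is nilpotent; (c) $L\subseteq B$.
   Context: A left Leibniz algebra is a (nonassociative) $\mathbb{C}$-algebra $M$ with product $[\ ]$ satisfying $[a[bc]]=[[ab]c]+[b[ac]]$ for all $a,b,c\in M$. It is left central if in addition $[a[bb]]=0$ for all $a,b\in M$. All algebras are finite-dimensional over $\mathbb{C}$. The Leibniz kernel $C(M)$ is the span of all $[aa]$, $a\in M$, and the rank of $M$ is $\dim C(M)$. Define $\psi:M\times M\to C(M)$ by $\psi(a,b)=[ab]+[ba]$. The radical of $M$ is $R=\{x\in M\mid\psi(x,a)=0\text{ for all }a\in M\}$; it is a $2$-sided ideal containing $C(M)$, so $M/R$ is a Lie algebra. A subspace $U$ is (totally) isotropic if $\psi(a,b)=0$ for all $a,b\in U$; a maximal isotropic subspace is a totally isotropic subspace maximal under inclusion. A Lie subalgebra of $M$ is a subalgebra which is a Lie algebra under $[\ ]$; $\mathcal{L}$ is the set of Lie subalgebras of $M$ ordered by inclusion, and $\mathcal{L}^*$ the set of its maximal elements. Every $L\in\mathcal{L}^*$ contains $R$. *)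

theory Defs
  imports Complex_Main "HOL-Library.Set_Algebras"
begin

text \<open>
  Algebras with an explicit carrier. They are needed because a quotient is an algebra of cosets,
  which is not a type of its own. The record carries no axioms; the notions below are only
  meant for records whose operations form a complex Lie algebra on the carrier.
\<close>

record 'v lie_rec =
  lcarrier :: "'v set"
  ladd :: "'v \<Rightarrow> 'v \<Rightarrow> 'v"
  lzero :: 'v
  lscale :: "complex \<Rightarrow> 'v \<Rightarrow> 'v"
  lbr :: "'v \<Rightarrow> 'v \<Rightarrow> 'v"

definition lie_subspace :: "'v lie_rec \<Rightarrow> 'v set \<Rightarrow> bool" where
  "lie_subspace A S \<longleftrightarrow> S \<subseteq> lcarrier A \<and> lzero A \<in> S \<and>
     (\<forall>x\<in>S. \<forall>y\<in>S. ladd A x y \<in> S) \<and> (\<forall>c. \<forall>x\<in>S. lscale A c x \<in> S)"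

definition lie_product :: "'v lie_rec \<Rightarrow> 'v set \<Rightarrow> 'v set \<Rightarrow> 'v set" where
  "lie_product A S T = lie_subspace A hull {lbr A x y |x y. x \<in> S \<and> y \<in> T}"

primrec lower_central :: "'v lie_rec \<Rightarrow> nat \<Rightarrow> 'v set" where
  "lower_central A 0 = lcarrier A"
| "lower_central A (Suc n) = lie_product A (lcarrier A) (lower_central A n)"

primrec derived_series :: "'v lie_rec \<Rightarrow> nat \<Rightarrow> 'v set" where
  "derived_series A 0 = lcarrier A"
| "derived_series A (Suc n) = lie_product A (derived_series A n) (derived_series A n)"

definition lie_nilpotent :: "'v lie_rec \<Rightarrow> bool" where
  "lie_nilpotent A \<longleftrightarrow> (\<exists>n. lower_central A n = {lzero A})"

definition lie_solvable :: "'v lie_rec \<Rightarrow> bool" where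
  "lie_solvable A \<longleftrightarrow> (\<exists>n. derived_series A n = {lzero A})"

definition lie_ideal :: "'v lie_rec \<Rightarrow> 'v set \<Rightarrow> bool" where
  "lie_ideal A I \<longleftrightarrow> lie_subspace A I \<and>
     (\<forall>x\<in>lcarrier A. \<forall>y\<in>I. lbr A x y \<in> I \<and> lbr A y x \<in> I)"

definition solvable_radical :: "'v lie_rec \<Rightarrow> 'v set" where
  "solvable_radical A = (GREATEST I. lie_ideal A I \<and> lie_solvable (A\<lparr>lcarrier := I\<rparr>))"


locale complex_algebra = vector_space scale
  for scale :: "complex \<Rightarrow> 'a::ab_group_add \<Rightarrow> 'a" +
  fixes br :: "'a \<Rightarrow> 'a \<Rightarrow> 'a"
  assumes finite_dim: "\<exists>S. finite S \<and> span S = UNIV"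
    and linear_right: "Vector_Spaces.linear scale scale (\<lambda>b. br a b)"
    and linear_left: "Vector_Spaces.linear scale scale (\<lambda>a. br a b)"
begin

definition leibniz_kernel :: "'a set" where
  "leibniz_kernel = span {br a a |a. True}"

definition rank :: nat where
  "rank = dim leibniz_kernel"

definition psi :: "'a \<Rightarrow> 'a \<Rightarrow> 'a" where
  "psi a b = br a b + br b a"

definition radical :: "'a set" where
  "radical = {x. \<forall>a. psi x a = 0}"

definition isotropic :: "'a set \<Rightarrow> bool" where
  "isotropic U \<longleftrightarrow> subspace U \<and> (\<forall>a\<in>U. \<forall>b\<in>U. psi a b = 0)"

definition maximal_isotropic :: "'a set \<Rightarrow> bool" where
  "maximal_isotropic U \<longleftrightarrow> isotropic U \<and> (\<forall>V. isotropic V \<and> U \<subseteq> V \<longrightarrow> V = U)"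

definition lie_subalgebra :: "'a set \<Rightarrow> bool" where
  "lie_subalgebra L \<longleftrightarrow> subspace L \<and> (\<forall>a\<in>L. \<forall>b\<in>L. br a b \<in> L) \<and>
     (\<forall>a\<in>L. br a a = 0) \<and>
     (\<forall>a\<in>L. \<forall>b\<in>L. \<forall>c\<in>L. br a (br b c) + br b (br c a) + br c (br a b) = 0)"

definition maximal_lie_subalgebras :: "'a set set" where
  "maximal_lie_subalgebras =
     {L. lie_subalgebra L \<and> (\<forall>K. lie_subalgebra K \<and> L \<subseteq> K \<longrightarrow> K = L)}"

text \<open>
  The quotient \<open>U / I\<close> of a subalgebra \<open>U\<close> by a two-sided ideal \<open>I \<subseteq> U\<close>: its elements are the
  cosets \<open>x +o I\<close> with \<open>x \<in> U\<close>. The sum of cosets is the elementwise sum of sets. The unions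
  run over all representatives and are single cosets since \<open>I\<close> is an ideal; the elementwise image
  alone would be wrong, for instance \<open>{0}\<close> instead of \<open>I\<close> for the scalar \<open>0\<close>.
\<close>

definition quotient :: "'a set \<Rightarrow> 'a set \<Rightarrow> 'a set lie_rec" where
  "quotient U I =
     \<lparr>lcarrier = (\<lambda>x. x +o I) ` U,
      ladd = (\<lambda>X Y. X + Y),
      lzero = I,
      lscale = (\<lambda>c X. \<Union>x\<in>X. scale c x +o I),
      lbr = (\<lambda>X Y. \<Union>x\<in>X. \<Union>y\<in>Y. br x y +o I)\<rparr>"

end

locale left_leibniz_algebra = complex_algebra +
  assumes leibniz: "br a (br b c) = br (br a b) c + br b (br a c)"

locale left_central_leibniz_algebra = left_leibniz_algebra +
  assumes left_central: "br a (br b b) = 0"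

end

theory Submission
  imports Defs "HOL-Computational_Algebra.Fundamental_Theorem_Algebra"
begin

text \<open>
  Write \<open>psi a b = phi a b *s z\<close> with \<open>z\<close> spanning the Leibniz kernel. Then \<open>phi\<close> is an invariant
  symmetric form on \<open>M\<close> whose kernel is the radical \<open>R\<close>. The crucial point is that \<open>B\<close> contains its
  orthogonal space \<open>perp B\<close>. By Lie's theorem a maximal one among the isotropic spaces between
  \<open>perp B\<close> and \<open>B\<close> that are stable under \<open>B\<close> is then a maximal isotropic subspace \<open>L\<close> of \<open>M\<close>, and
  \<open>[L, L] \<subseteq> perp B\<close>, \<open>[L, perp B] \<subseteq> R\<close> make \<open>L / R\<close> nilpotent.

  If \<open>perp B\<close> were not contained in \<open>B\<close>, it would not be solvable modulo \<open>R\<close>. A minimal subalgebra that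
  is not solvable modulo \<open>R\<close> is spanned, modulo the Leibniz kernel, by an \<open>sl\<^sub>2\<close>-triple
  \<open>e\<close>, \<open>f\<close>, \<open>h\<close>, and the Leibniz identity gives \<open>[h, h] = 0\<close>, so \<open>phi h h = 0\<close>. On a minimal ideal
  that contains the triple, the Killing form is proportional to \<open>phi\<close> by Schur's lemma, yet it is
  positive on \<open>h\<close> because the weights of \<open>h\<close> are real.
\<close>

section \<open>Linear algebra modulo a subspace\<close>

text \<open>Levi's theorem, Weyl's theorem and Cartan's criterion are bypassed: the only nonsolvable
  algebra whose structure is determined is a minimal one, \<open>Y\<close>. Its proper subalgebras
  are solvable, which makes Lie's theorem applicable to them and forbids a proper supplement of its
  largest solvable ideal \<open>S\<close>. Lifting the triple from \<open>Y / S\<close> through one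
  irreducible layer of \<open>S\<close> would create such a supplement, so \<open>S\<close> has no
  layer above the Leibniz kernel. Descending to the kernel is essential: relations modulo
  \<open>S\<close> alone do not determine \<open>[h, h]\<close>, which always lies in the kernel,
  while errors in the kernel multiply to zero from both sides. Maximality of \<open>L\<close> is at
  first only among \<open>B\<close>-stable isotropic spaces. What Lie's theorem leaves in
  \<open>perp L / L\<close> are anisotropic vectors of weight zero; two orthogonal ones combine,
  with a complex square root, to an isotropic one, so at most one direction remains, and no
  isotropic space can use it. Subquotients \<open>U / W\<close> are not formed as types: two
  subspaces and congruence modulo \<open>W\<close> replace them until the final translation to
  cosets.\<close>

abbreviation (input) sumset :: "'a::plus set \<Rightarrow> 'a set \<Rightarrow> 'a set" where
  "sumset A B \<equiv> {a + b |a b. a \<in> A \<and> b \<in> B}"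

locale complex_fd_space = vector_space scale
  for scale :: "complex \<Rightarrow> 'a::ab_group_add \<Rightarrow> 'a" (infixr "*s" 75) +
  assumes finite_span: "\<exists>S. finite S \<and> span S = UNIV"
begin

lemmas vs_simps = scale_left_distrib scale_right_distrib scale_left_diff_distrib
  scale_right_diff_distrib algebra_simps

lemma dim_strict:
  assumes "subspace U" "subspace V" "U \<subset> V"
  shows "dim U < dim V"
proof -
  obtain S where S: "finite S" "span S = UNIV" using finite_span by blast
  obtain B where B: "B \<subseteq> S" "independent B" "S \<subseteq> span B"
    using maximal_independent_subset[of S] by blast
  have "span B = UNIV" using S(2) B(3) span_mono[OF B(3)] by (auto simp: span_span)
  then interpret finite_dimensional_vector_space scale B
    using B S finite_subset by unfold_locales auto
  show ?thesis using assms dim_psubset[of U V] span_eq_iff by metis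
qed

lemma dim_bounded: "subspace U \<Longrightarrow> dim U \<le> dim UNIV"
  using dim_strict[of U UNIV] by (cases "U = UNIV") (auto simp: psubset_eq)

text \<open>A member of largest dimension is maximal, since proper inclusion raises the dimension.
  Together with its dual it supplies the hyperplanes, maximal subalgebras and minimal ideals chosen
  below.\<close>

lemma maximal_subspace_exists:
  assumes "Q U0" and sub: "\<And>U. Q U \<Longrightarrow> subspace U"
  shows "\<exists>U. Q U \<and> (\<forall>V. Q V \<and> U \<subseteq> V \<longrightarrow> V = U)"
proof -
  obtain U where U: "Q U" "\<And>V. Q V \<Longrightarrow> dim V \<le> dim U"
    using ex_has_greatest_nat[of Q U0 dim "Suc (dim UNIV)"] assms dim_bounded
    by (metis less_Suc_eq_le)
  show ?thesis using U dim_strict leD psubsetI sub by metis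
qed

lemma minimal_subspace_exists:
  assumes "Q U0" and sub: "\<And>U. Q U \<Longrightarrow> subspace U"
  shows "\<exists>U. Q U \<and> (\<forall>V. Q V \<and> V \<subseteq> U \<longrightarrow> V = U)"
proof -
  obtain U where U: "Q U" "\<And>V. Q V \<Longrightarrow> dim U \<le> dim V"
    using ex_has_least_nat[of Q U0 dim] assms(1) by blast
  show ?thesis using U dim_strict leD psubsetI sub by metis
qed

lemma ascending_chain_stabilizes:
  assumes sub: "\<And>n. subspace (X n)" and inc: "\<And>n. X n \<subseteq> X (Suc n)"
  obtains n where "X (Suc n) = X n"
proof -
  have "\<exists>n. X (Suc n) = X n"
  proof (rule ccontr)
    assume "\<not> ?thesis"
    then have lt: "dim (X n) < dim (X (Suc n))" for n
      using dim_strict[OF sub sub] inc by blast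
    have "n \<le> dim (X n)" for n
      by (induction n) (use lt in \<open>auto intro: order.strict_trans1 Suc_leI\<close>)
    then show False using dim_bounded[OF sub] by (meson Suc_n_not_le_n le_trans)
  qed
  then show thesis using that by blast
qed

lemma descending_chain_stabilizes:
  assumes sub: "\<And>n. subspace (X n)" and dec: "\<And>n. X (Suc n) \<subseteq> X n"
  obtains n where "X (Suc n) = X n"
proof -
  have "\<exists>n. X (Suc n) = X n"
  proof (rule ccontr)
    assume "\<not> ?thesis"
    then have lt: "dim (X (Suc n)) < dim (X n)" for n
      using dim_strict[OF sub sub] dec by blast
    have "dim (X n) + n \<le> dim (X 0)" for n
    proof (induction n)
      case (Suc n) then show ?case using lt[of n] by linarith
    qed simp
    from this[of "Suc (dim (X 0))"] show False by simp
  qed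
  then show thesis using that by blast
qed

section \<open>Linear maps on subquotients\<close>

definition lin :: "('a \<Rightarrow> 'a) \<Rightarrow> bool" where
  "lin T \<longleftrightarrow> (\<forall>x y. T (x + y) = T x + T y) \<and> (\<forall>c x. T (c *s x) = c *s T x)"

lemma
  assumes "lin T"
  shows lin_add: "T (x + y) = T x + T y" and lin_scale: "T (c *s x) = c *s T x"
    and lin_0: "T 0 = 0" and lin_minus: "T (- x) = - T x" and lin_diff: "T (x - y) = T x - T y"
proof -
  show a: "T (x + y) = T x + T y" and s: "T (c *s x) = c *s T x" for x y c
    using assms by (auto simp: lin_def)
  show z: "T 0 = 0" using s[of 0 0] by simp
  show m: "T (- x) = - T x" for x using a[of x "- x"] z by (simp add: eq_neg_iff_add_eq_0 add.commute)
  show "T (x - y) = T x - T y" using a[of x "- y"] m[of y] by simp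
qed

lemma lin_sum: "lin T \<Longrightarrow> T (sum f A) = (\<Sum>a\<in>A. T (f a))"
  by (induction A rule: infinite_finite_induct) (auto simp: lin_0 lin_add)

lemma lin_funpow: "lin T \<Longrightarrow> lin (T ^^ n)"
  by (induction n) (auto simp: lin_def)

lemma lin_subspace_image: "lin T \<Longrightarrow> subspace U \<Longrightarrow> subspace (T ` U)"
  by (intro subspaceI) (auto simp: lin_add[symmetric] lin_scale[symmetric] subspace_add subspace_scale
      intro: image_eqI[where x = 0] simp: lin_0 subspace_0)

lemma lin_subspace_vimage: "lin T \<Longrightarrow> subspace U \<Longrightarrow> subspace {x. T x \<in> U}"
  by (intro subspaceI) (auto simp: lin_add lin_scale lin_0 subspace_add subspace_scale subspace_0)

lemma lin_span_image:
  assumes "lin T" "subspace V" "\<And>x. x \<in> B \<Longrightarrow> T x \<in> V" "y \<in> span B"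
  shows "T y \<in> V"
  using assms(4) lin_subspace_vimage[OF assms(1,2)] span_minimal[of B "{x. T x \<in> V}"] assms(3)
  by blast

lemma funpow_invariant:
  assumes "\<And>x. x \<in> U \<Longrightarrow> T x \<in> U" shows "x \<in> U \<Longrightarrow> (T ^^ n) x \<in> U"
  by (induction n) (auto intro: assms)

lemma span_insert_mem:
  assumes "subspace W" "x \<in> span (insert v W)" obtains c w where "x = w + c *s v" "w \<in> W"
proof -
  from assms obtain c where "x - c *s v \<in> W"
    using span_breakdown_eq[of x v W] span_eq_iff[of W] by metis
  then show thesis using that[of "x - c *s v" c] by simp
qed

text \<open>Lie's theorem takes the derived algebra of \<open>P\<close> as \<open>D\<close>: every
  subspace between the two is a subalgebra, so the hyperplane \<open>P'\<close> is one.\<close>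

lemma maximal_proper_subspace:
  assumes "subspace D" "subspace P" "D \<subset> P"
  obtains P' x where "subspace P'" "D \<subseteq> P'" "P' \<subset> P" "x \<in> P" "x \<notin> P'" "P = span (insert x P')"
proof -
  obtain P' where P': "subspace P' \<and> D \<subseteq> P' \<and> P' \<subset> P"
    and max: "\<And>V. (subspace V \<and> D \<subseteq> V \<and> V \<subset> P) \<and> P' \<subseteq> V \<Longrightarrow> V = P'"
    using maximal_subspace_exists[of "\<lambda>V. subspace V \<and> D \<subseteq> V \<and> V \<subset> P" D] assms by blast
  then obtain x where x: "x \<in> P" "x \<notin> P'" by blast
  have "span (insert x P') \<subseteq> P" using x P' assms by (intro span_minimal) auto
  moreover have "\<not> span (insert x P') \<subset> P"
  proof
    assume "span (insert x P') \<subset> P"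
    then have "span (insert x P') = P'" using P' by (intro max) (auto intro: span_base)
    then show False using x span_base[of x "insert x P'"] by auto
  qed
  ultimately show thesis using that P' x by blast
qed

text \<open>The images of \<open>T^n\<close>, enlarged by \<open>W\<close>, descend and hence
  stabilize, so \<open>T^n x\<close> agrees modulo \<open>W\<close> with some
  \<open>T^(n+1) y\<close>; injectivity on \<open>U / W\<close> cancels \<open>T^n\<close>.\<close>

lemma inj_imp_surj_mod:
  assumes T: "lin T" and W: "subspace W" and U: "subspace U" "W \<subseteq> U"
    and TU: "\<And>x. x \<in> U \<Longrightarrow> T x \<in> U" and TW: "\<And>x. x \<in> W \<Longrightarrow> T x \<in> W"
    and inj: "\<And>x. x \<in> U \<Longrightarrow> T x \<in> W \<Longrightarrow> x \<in> W"
    and x: "x \<in> U"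
  obtains y where "y \<in> U" "x - T y \<in> W"
proof -
  define X where "X n = sumset ((T ^^ n) ` U) W" for n
  have dec: "X (Suc n) \<subseteq> X n" for n
    unfolding X_def using TU by (auto simp del: funpow.simps simp: funpow_Suc_right)
  have sX: "subspace (X n)" for n
    unfolding X_def by (intro subspace_sums lin_subspace_image lin_funpow T W U)
  obtain n where n: "X (Suc n) = X n" by (rule descending_chain_stabilizes[of X, OF sX dec])
  have "(T ^^ n) x + 0 \<in> X n" unfolding X_def using x W subspace_0 by blast
  then have "(T ^^ n) x \<in> X (Suc n)" using n by simp
  then obtain y w where y: "y \<in> U" "w \<in> W" "(T ^^ n) x = (T ^^ n) (T y) + w"
    unfolding X_def by (auto simp: funpow_swap1)
  then have "(T ^^ n) (x - T y) \<in> W" by (simp add: lin_diff[OF lin_funpow[OF T]])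
  moreover have "(T ^^ m) z \<in> W \<Longrightarrow> z \<in> U \<Longrightarrow> z \<in> W" for m z
    by (induction m arbitrary: z)
       (use inj TU in \<open>auto simp del: funpow.simps simp: funpow_Suc_right\<close>)
  ultimately have "x - T y \<in> W" using x y TU U by (meson subspace_diff)
  then show thesis using that y by blast
qed

text \<open>Dually, the kernels of the powers of \<open>T\<close> on \<open>U / W\<close> ascend and
  stabilize. Writing \<open>x\<close> as a value of \<open>T^n\<close> modulo \<open>W\<close> then
  moves it into \<open>W\<close>.\<close>

lemma surj_imp_inj_mod:
  assumes T: "lin T" and W: "subspace W" and U: "subspace U" "W \<subseteq> U"
    and TU: "\<And>x. x \<in> U \<Longrightarrow> T x \<in> U" and TW: "\<And>x. x \<in> W \<Longrightarrow> T x \<in> W"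
    and surj: "\<And>x. x \<in> U \<Longrightarrow> \<exists>y\<in>U. x - T y \<in> W"
    and x: "x \<in> U" "T x \<in> W"
  shows "x \<in> W"
proof -
  define X where "X n = {x \<in> U. (T ^^ n) x \<in> W}" for n
  have sX: "subspace (X n)" for n
  proof -
    have "X n = U \<inter> {x. (T ^^ n) x \<in> W}" by (auto simp: X_def)
    then show ?thesis using lin_subspace_vimage[OF lin_funpow[OF T] W] U by (simp add: subspace_inter)
  qed
  have inc: "X n \<subseteq> X (Suc n)" for n by (auto simp: X_def TW)
  obtain n where n: "X (Suc n) = X n" by (rule ascending_chain_stabilizes[of X, OF sX inc])
  have TnW: "w \<in> W \<Longrightarrow> (T ^^ m) w \<in> W" for m w using TW by (rule funpow_invariant)
  have "\<exists>y\<in>U. x - (T ^^ m) y \<in> W" if "x \<in> U" for m x using that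
  proof (induction m arbitrary: x)
    case 0 then show ?case using W by (intro bexI[of _ x]) (auto simp: subspace_0)
  next
    case (Suc m)
    from surj[OF Suc.prems] obtain y where y: "y \<in> U" "x - T y \<in> W" by blast
    from Suc.IH[OF y(1)] obtain z where z: "z \<in> U" "y - (T ^^ m) z \<in> W" by blast
    have "(x - T y) + T (y - (T ^^ m) z) \<in> W" using y z W TW by (simp add: subspace_add)
    then show ?case using z by (auto simp: lin_diff[OF T])
  qed
  then obtain y where y: "y \<in> U" "x - (T ^^ n) y \<in> W" using x by blast
  have "T (x - (T ^^ n) y) \<in> W" using TW y by blast
  then have "T ((T ^^ n) y) \<in> W" using x W by (metis lin_diff[OF T] subspace_diff diff_diff_eq2 add_diff_cancel_left')
  then have "y \<in> X (Suc n)" using y(1) by (simp add: X_def)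
  then have "(T ^^ n) y \<in> W" using n by (auto simp: X_def)
  then show ?thesis using y W by (metis diff_add_cancel subspace_add)
qed

section \<open>Eigenvalues on subquotients\<close>

definition poly_act :: "('a \<Rightarrow> 'a) \<Rightarrow> complex poly \<Rightarrow> 'a \<Rightarrow> 'a" where
  "poly_act T p v = fold_coeffs (\<lambda>a y. a *s v + T y) p 0"

lemma poly_act_0 [simp]: "poly_act T 0 v = 0" by (simp add: poly_act_def)

lemma poly_act_pCons: "lin T \<Longrightarrow> poly_act T (pCons a p) v = a *s v + T (poly_act T p v)"
  by (cases "p = 0 \<and> a = 0") (auto simp: poly_act_def lin_0)

lemma poly_act_add: "lin T \<Longrightarrow> poly_act T (p + q) v = poly_act T p v + poly_act T q v"
  by (induction p q rule: poly_induct2) (auto simp: poly_act_pCons lin_add vs_simps)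

lemma poly_act_smult: "lin T \<Longrightarrow> poly_act T (smult c p) v = c *s poly_act T p v"
  by (induction p) (auto simp: poly_act_pCons lin_scale vs_simps)

lemma poly_act_invariant:
  assumes "lin T" "subspace U" "\<And>x. x \<in> U \<Longrightarrow> T x \<in> U" "v \<in> U"
  shows "poly_act T p v \<in> U"
  by (induction p) (auto simp: poly_act_pCons assms subspace_0 subspace_add subspace_scale)

text \<open>A polynomial \<open>q\<close> of least degree with \<open>q(T) v\<close> in
  \<open>W\<close> has a complex root \<open>c\<close>. If \<open>q = (X - c) r\<close>, minimality
  keeps \<open>r(T) v\<close> outside \<open>W\<close>, and this is the eigenvector.\<close>

lemma eigenvector_mod:
  assumes T: "lin T" and W: "subspace W" and U: "subspace U" "W \<subset> U"
    and TU: "\<And>x. x \<in> U \<Longrightarrow> T x \<in> U" and TW: "\<And>x. x \<in> W \<Longrightarrow> T x \<in> W"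
  obtains v c where "v \<in> U" "v \<notin> W" "T v - c *s v \<in> W"
proof -
  obtain v where v: "v \<in> U" "v \<notin> W" using U by blast
  \<comment> \<open>Modulo \<open>W\<close> this is the span of
    \<open>v, T v, ..., T^(n-1) v\<close>, described by polynomials without coefficients from degree
    \<open>n\<close> on. Its stabilization yields a monic relation.\<close>
  define X where "X n = {x. \<exists>p. (\<forall>i\<ge>n. coeff p i = 0) \<and> x - poly_act T p v \<in> W}" for n :: nat
  have sX: "subspace (X n)" for n
  proof (rule subspaceI)
    show "0 \<in> X n" unfolding X_def using W subspace_0 by (intro CollectI exI[of _ 0]) auto
  next
    fix x y assume "x \<in> X n" "y \<in> X n"
    then obtain p q where "\<forall>i\<ge>n. coeff p i = 0" "\<forall>i\<ge>n. coeff q i = 0"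
       "x - poly_act T p v \<in> W" "y - poly_act T q v \<in> W" by (auto simp: X_def)
    then show "x + y \<in> X n" unfolding X_def
      by (intro CollectI exI[of _ "p + q"])
         (auto simp: poly_act_add T add_diff_add intro!: subspace_add[OF W])
  next
    fix c x assume "x \<in> X n"
    then obtain p where "\<forall>i\<ge>n. coeff p i = 0" "x - poly_act T p v \<in> W" by (auto simp: X_def)
    then show "c *s x \<in> X n" unfolding X_def
      by (intro CollectI exI[of _ "smult c p"])
         (auto simp: poly_act_smult T scale_right_diff_distrib[symmetric] intro!: subspace_scale[OF W])
  qed
  have inc: "X n \<subseteq> X (Suc n)" for n unfolding X_def using Suc_leD by blast
  obtain n where n: "X (Suc n) = X n" by (rule ascending_chain_stabilizes[of X, OF sX inc])
  have "poly_act T (monom 1 n) v \<in> X (Suc n)"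
    unfolding X_def using W subspace_0 by (intro CollectI exI[of _ "monom 1 n"]) simp
  then have "poly_act T (monom 1 n) v \<in> X n" by (simp only: n)
  then obtain p where p: "\<forall>i\<ge>n. coeff p i = 0" "poly_act T (monom 1 n) v - poly_act T p v \<in> W"
    unfolding X_def by blast
  define q where "q = monom 1 n + smult (- 1) p"
  have "coeff q n = 1" using p by (simp add: q_def)
  then have "q \<noteq> 0" by auto
  moreover have "poly_act T q v \<in> W" using p by (simp add: q_def poly_act_add poly_act_smult T del: smult_minus_left)
  ultimately have ex: "\<exists>m q. q \<noteq> 0 \<and> degree q = m \<and> poly_act T q v \<in> W" by blast
  define m where "m = (LEAST m. \<exists>q. q \<noteq> 0 \<and> degree q = m \<and> poly_act T q v \<in> W)"
  obtain q where q: "q \<noteq> 0" "degree q = m" "poly_act T q v \<in> W"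
    using LeastI_ex[OF ex] unfolding m_def by blast
  have min: "poly_act T r v \<notin> W" if "r \<noteq> 0" "degree r < m" for r
    using not_less_Least[of "degree r"] that unfolding m_def by blast
  have "m \<noteq> 0"
  proof
    assume "m = 0"
    then obtain a where "q = [:a:]" using q(2) degree_eq_zeroE by blast
    then have "a \<noteq> 0" "a *s v \<in> W" using q T by (auto simp: poly_act_pCons lin_0)
    then have "inverse a *s (a *s v) \<in> W" using W subspace_scale by blast
    then show False using v \<open>a \<noteq> 0\<close> by simp
  qed
  then have "\<not> constant (poly q)" using q constant_degree by metis
  then obtain c where "poly q c = 0" using fundamental_theorem_of_algebra by blast
  then obtain r where r: "q = [:- c, 1:] * r" using poly_eq_0_iff_dvd[of q c] by (auto elim: dvdE)
  have r0: "r \<noteq> 0" using r q by auto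
  then have "degree r < m" using q(2) unfolding r by (subst (asm) degree_mult_eq) auto
  then have nw: "poly_act T r v \<notin> W" using min r0 by blast
  have "poly_act T q v = T (poly_act T r v) - c *s poly_act T r v"
    by (simp add: r poly_act_add poly_act_smult poly_act_pCons T del: smult_minus_left)
  then have "T (poly_act T r v) - c *s poly_act T r v \<in> W" using q by simp
  then show thesis using that nw poly_act_invariant[OF T U(1) TU v(1)] by blast
qed

text \<open>Eigenvectors for distinct eigenvalues are independent modulo \<open>W\<close>. In the
  form stated, this stops the chains of raised or lowered weight vectors of
  \<open>sl\<^sub>2\<close>-modules.\<close>

lemma finitely_many_eigenvalues_mod:
  fixes c :: "nat \<Rightarrow> complex"
  assumes T: "lin T" and W: "subspace W" and TW: "\<And>x. x \<in> W \<Longrightarrow> T x \<in> W"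
    and c: "inj c" and ev: "\<And>j. T (v j) - c j *s v j \<in> W"
  shows "\<exists>j. v j \<in> W"
proof (rule ccontr)
  assume no: "\<not> ?thesis"
  define X where "X n = span (W \<union> v ` {..<n})" for n
  \<comment> \<open>\<open>Q n\<close> is the product of the maps \<open>T - c i\<close> with
    \<open>i < n\<close>. Modulo \<open>W\<close> it kills every \<open>v j\<close> with
    \<open>j < n\<close> but multiplies \<open>v n\<close> by a nonzero scalar.\<close>
  define Q where "Q = rec_nat id (\<lambda>n f x. T (f x) - c n *s f x)"
  have Q0: "Q 0 x = x" and QS: "Q (Suc n) x = T (Q n x) - c n *s Q n x" for n x
    by (auto simp: Q_def)
  have linQ: "lin (Q n)" for n
    by (induction n) (auto simp: lin_def Q0 QS lin_add[OF T] lin_scale[OF T] vs_simps)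
  have QW: "w \<in> W \<Longrightarrow> Q n w \<in> W" for n w
    by (induction n) (auto simp: Q0 QS TW W intro!: subspace_diff subspace_scale)
  have Qv: "Q n (v j) - (\<Prod>i<n. c j - c i) *s v j \<in> W" for n j
  proof (induction n)
    case 0 then show ?case using W by (simp add: Q0 subspace_0)
  next
    case (Suc n)
    define a where "a = (\<Prod>i<n. c j - c i)"
    define w where "w = Q n (v j) - a *s v j"
    have w: "w \<in> W" using Suc by (simp add: w_def a_def)
    have eq: "Q n (v j) = w + a *s v j" by (simp add: w_def)
    have "Q (Suc n) (v j) - (a * (c j - c n)) *s v j
       = (T w - c n *s w) + a *s (T (v j) - c j *s v j)"
      by (simp add: QS eq lin_add[OF T] lin_scale[OF T] vs_simps)
    also have "\<dots> \<in> W" using w TW W by (intro subspace_add subspace_diff subspace_scale[OF W ev] subspace_scale) auto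
    finally show ?case by (simp add: a_def)
  qed
  have sX: "subspace (X n)" and inc: "X n \<subseteq> X (Suc n)" for n
    unfolding X_def by (auto intro!: span_mono)
  obtain n where n: "X (Suc n) = X n" by (rule ascending_chain_stabilizes[of X, OF sX inc])
  have "v n \<in> X n" using n unfolding X_def by (metis UnI2 imageI lessI lessThan_iff span_base)
  then have "Q n (v n) \<in> W" unfolding X_def
  proof (rule lin_span_image[OF linQ W, rotated])
    fix x assume "x \<in> W \<union> v ` {..<n}"
    then show "Q n x \<in> W"
    proof
      assume "x \<in> v ` {..<n}"
      then obtain j where j: "j < n" "x = v j" by auto
      then have "(\<Prod>i<n. c j - c i) = 0" by (intro prod_zero) auto
      then show ?thesis using Qv[of n j] j(2) by (metis scale_zero_left diff_zero)
    qed (rule QW)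
  qed
  then have "(\<Prod>i<n. c n - c i) *s v n \<in> W" using Qv[of n n] W
    by (metis diff_diff_eq2 add_diff_cancel_left' subspace_diff)
  moreover have "(\<Prod>i<n. c n - c i) \<noteq> 0" using c by (auto simp: inj_def)
  ultimately have "v n \<in> W" using W subspace_scale[of W _ "inverse (\<Prod>i<n. c n - c i)"] by fastforce
  then show False using no by blast
qed

text \<open>The \<open>span\<close> makes this an equivalence relation compatible with the vector
  space operations for every set \<open>W\<close>, so the rules for calculational chains carry no
  premise about \<open>W\<close>.\<close>

definition eqm :: "'a \<Rightarrow> 'a set \<Rightarrow> 'a \<Rightarrow> bool" ("(_/ \<approx>[_] _)" [51, 0, 51] 50) where
  "x \<approx>[W] y \<longleftrightarrow> x - y \<in> span W"

lemma eqm_iff: "subspace W \<Longrightarrow> x \<approx>[W] y \<longleftrightarrow> x - y \<in> W"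
  by (metis eqm_def span_eq_iff)

lemma eqm_0: "subspace W \<Longrightarrow> x \<approx>[W] 0 \<longleftrightarrow> x \<in> W"
  by (simp add: eqm_iff)

lemma eqm_refl [simp]: "x \<approx>[W] x" by (simp add: eqm_def span_zero)

lemma eqm_sym: "x \<approx>[W] y \<Longrightarrow> y \<approx>[W] x"
  unfolding eqm_def using span_neg by fastforce

lemma eqm_trans [trans]: "x \<approx>[W] y \<Longrightarrow> y \<approx>[W] z \<Longrightarrow> x \<approx>[W] z"
  unfolding eqm_def using span_add by fastforce

lemma eq_eqm_trans [trans]: "x = y \<Longrightarrow> y \<approx>[W] z \<Longrightarrow> x \<approx>[W] z"
  by simp

lemma eqm_eq_trans [trans]: "x \<approx>[W] y \<Longrightarrow> y = z \<Longrightarrow> x \<approx>[W] z"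
  by simp

lemma eqm_add: "x \<approx>[W] y \<Longrightarrow> x' \<approx>[W] y' \<Longrightarrow> x + x' \<approx>[W] y + y'"
  unfolding eqm_def by (simp add: add_diff_add span_add)

lemma eqm_diff: "x \<approx>[W] y \<Longrightarrow> x' \<approx>[W] y' \<Longrightarrow> x - x' \<approx>[W] y - y'"
  unfolding eqm_def using span_diff[of "x - y" W "x' - y'"] by (simp add: algebra_simps)

lemma eqm_scale: "x \<approx>[W] y \<Longrightarrow> c *s x \<approx>[W] c *s y"
  unfolding eqm_def using span_scale by (fastforce simp: scale_right_diff_distrib[symmetric])

lemma eqm_minus: "x \<approx>[W] y \<Longrightarrow> - x \<approx>[W] - y"
  using eqm_diff[of 0 W 0 x y] by simp

lemma eqm_lin:
  assumes "lin T" "\<And>x. x \<in> W \<Longrightarrow> T x \<in> W" "x \<approx>[W] y" shows "T x \<approx>[W] T y"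
  using assms(3) lin_span_image[OF assms(1) subspace_span, of W W "x - y"] assms(2)
  unfolding eqm_def by (auto simp: lin_diff[OF assms(1)] intro: span_base)

lemma eqm_mono: "x \<approx>[W] y \<Longrightarrow> W \<subseteq> W' \<Longrightarrow> x \<approx>[W'] y"
  unfolding eqm_def using span_mono by blast

lemma eqm_mem: "subspace W \<Longrightarrow> x \<approx>[W] y \<Longrightarrow> x \<in> W \<longleftrightarrow> y \<in> W"
  using eqm_0[of W] eqm_sym eqm_trans by blast

lemma eqm_mem': "subspace U \<Longrightarrow> W \<subseteq> U \<Longrightarrow> x \<approx>[W] y \<Longrightarrow> x \<in> U \<longleftrightarrow> y \<in> U"
  using eqm_mem eqm_mono by blast

section \<open>Functionals, dual bases and traces on a quotient\<close>

definition functional :: "('a \<Rightarrow> complex) \<Rightarrow> bool" where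
  "functional g \<longleftrightarrow> (\<forall>x y. g (x + y) = g x + g y) \<and> (\<forall>c x. g (c *s x) = c * g x)"

lemma
  assumes "functional g"
  shows functional_add: "g (x + y) = g x + g y" and functional_scale: "g (c *s x) = c * g x"
    and functional_0: "g 0 = 0" and functional_diff: "g (x - y) = g x - g y"
proof -
  show a: "g (x + y) = g x + g y" and s: "g (c *s x) = c * g x" for x y c
    using assms by (auto simp: functional_def)
  show "g 0 = 0" using s[of 0 0] by simp
  show "g (x - y) = g x - g y" using a[of "x - y" y] by simp
qed

lemma functional_sum: "functional g \<Longrightarrow> g (sum f A) = (\<Sum>a\<in>A. g (f a))"
  by (induction A rule: infinite_finite_induct) (auto simp: functional_0 functional_add)

lemma functional_exists:
  assumes "subspace W" "v \<notin> W"
  obtains g where "functional g" "\<And>w. w \<in> W \<Longrightarrow> g w = 0" "g v = 1"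
proof -
  interpret C: vector_space "(*) :: complex \<Rightarrow> complex \<Rightarrow> complex"
    by unfold_locales (auto simp: algebra_simps)
  interpret P: vector_space_pair scale "(*) :: complex \<Rightarrow> complex \<Rightarrow> complex" by unfold_locales
  obtain B where B: "B \<subseteq> W" "independent B" "W \<subseteq> span B" using maximal_independent_subset by blast
  have "span B \<subseteq> W" using B assms by (intro span_minimal)
  then have "v \<notin> span B" using assms by blast
  then have "independent (insert v B)" using B independent_insertI by blast
  then obtain g where g: "Vector_Spaces.linear scale (*) g"
      "\<forall>x\<in>insert v B. g x = (if x = v then 1 else 0)"
    using P.linear_independent_extend[of "insert v B" "\<lambda>x. if x = v then 1 else 0"] by blast
  then interpret g: Vector_Spaces.linear scale "(*)" g by simp
  have f: "functional g" unfolding functional_def using g.add g.scale by auto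
  have "g w = 0" if "w \<in> W" for w
  proof -
    have "w \<in> span B" using that B by blast
    moreover have "g b = 0" if "b \<in> B" for b using that g B assms by auto
    ultimately show ?thesis by (rule g.eq_0_on_span[rotated])
  qed
  then show thesis using that f g by simp
qed

text \<open>A basis \<open>v 0, \<dots>, v (n - 1)\<close> of a complement of \<open>W\<close>, together with its coordinate functions.\<close>

definition dual_system :: "'a set \<Rightarrow> nat \<Rightarrow> (nat \<Rightarrow> 'a) \<Rightarrow> (nat \<Rightarrow> 'a \<Rightarrow> complex) \<Rightarrow> bool" where
  "dual_system W n v c \<longleftrightarrow>
     (\<forall>i<n. functional (c i) \<and> (\<forall>w\<in>W. c i w = 0) \<and>
        (\<forall>j<n. c i (v j) = (if i = j then 1 else 0))) \<and>
     (\<forall>x. x - (\<Sum>i<n. c i x *s v i) \<in> W)"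

lemma dual_system_extend:
  assumes W: "subspace W" and v: "v \<notin> W" and D: "dual_system (span (insert v W)) n vs c"
  obtains c' where "dual_system W (Suc n) (case_nat v vs) c'" "\<And>i. c' (Suc i) = c i"
proof -
  obtain g where g: "functional g" "\<And>w. w \<in> W \<Longrightarrow> g w = 0" "g v = 1"
    using functional_exists[OF W v] by blast
  \<comment> \<open>Subtracting the coordinates along \<open>vs\<close> makes the functional vanish
    on \<open>vs\<close>; on \<open>W\<close> and \<open>v\<close> it still agrees with
    \<open>g\<close>, because each \<open>c i\<close> vanishes there.\<close>
  define g' where "g' x = g x - (\<Sum>i<n. c i x * g (vs i))" for x
  have c: "functional (c i)" "w \<in> span (insert v W) \<Longrightarrow> c i w = 0"
    "j < n \<Longrightarrow> c i (vs j) = (if i = j then 1 else 0)" if "i < n" for i j w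
    using D that by (auto simp: dual_system_def)
  have f: "functional g'" unfolding functional_def g'_def using c(1) g(1)
    by (auto simp: functional_def algebra_simps sum.distrib sum_distrib_left)
  have g'W: "g' w = 0" if "w \<in> W" for w unfolding g'_def using c(2) g that by (simp add: span_base)
  have g'v: "g' v = 1" unfolding g'_def using c(2) g by (simp add: span_base)
  have g'vs: "g' (vs j) = 0" if "j < n" for j 
  proof -
    have "(\<Sum>i<n. c i (vs j) * g (vs i)) = (\<Sum>i<n. if i = j then g (vs j) else 0)"
      by (intro sum.cong refl) (use c(3) that in auto)
    then show ?thesis using that by (simp add: g'_def)
  qed
  have "x - (\<Sum>i<Suc n. case_nat g' c i x *s case_nat v vs i) \<in> W" for x
  proof -
    have "x - (\<Sum>i<n. c i x *s vs i) \<in> span (insert v W)" using D by (simp add: dual_system_def)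
    then obtain a w where aw: "x - (\<Sum>i<n. c i x *s vs i) = w + a *s v" "w \<in> W"
      by (rule span_insert_mem[OF W])
    have "g' (x - (\<Sum>i<n. c i x *s vs i)) = a"
      unfolding aw using f aw(2) g'W g'v by (simp add: functional_add functional_scale)
    then have "g' x = a" using f g'vs by (simp add: functional_diff functional_sum functional_scale)
    then have "x - (\<Sum>i<Suc n. case_nat g' c i x *s case_nat v vs i)
        = (x - (\<Sum>i<n. c i x *s vs i)) - a *s v"
      by (simp add: sum.lessThan_Suc_shift algebra_simps del: sum.lessThan_Suc)
    then show ?thesis using aw by simp
  qed
  moreover have "functional (case_nat g' c i) \<and> (\<forall>w\<in>W. case_nat g' c i w = 0) \<and>
      (\<forall>j<Suc n. case_nat g' c i (case_nat v vs j) = (if i = j then 1 else 0))" if "i < Suc n" for i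
  proof (cases i)
    case 0
    then show ?thesis using f g'W g'v g'vs by (auto split: nat.split)
  next
    case (Suc k)
    have k: "k < n" using Suc that by simp
    have "c k v = 0" "\<forall>w\<in>W. c k w = 0" using c(2)[OF k] by (simp_all add: span_base)
    then show ?thesis using Suc c(1)[OF k] c(3)[OF k] by (simp split: nat.split)
  qed
  ultimately have "dual_system W (Suc n) (case_nat v vs) (case_nat g' c)"
    unfolding dual_system_def by blast
  then show thesis using that by simp
qed

lemma dual_system_UNIV: "dual_system UNIV 0 v c"
  by (simp add: dual_system_def)

text \<open>This is tr(ST) = tr(TS) on the quotient by \<open>W\<close>. The two sides may use
  different dual systems, so it also gives the independence of the trace from the basis.\<close>

lemma dual_system_trace_commute:
  assumes D: "dual_system W n v c" and D': "dual_system W m v' c'"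
    and S: "lin S" "\<And>w. w \<in> W \<Longrightarrow> S w \<in> W" and T: "lin T" "\<And>w. w \<in> W \<Longrightarrow> T w \<in> W"
  shows "(\<Sum>i<n. c i (S (T (v i)))) = (\<Sum>j<m. c' j (T (S (v' j))))"
proof -
  have exp: "d (S x) = (\<Sum>i<k. e i x * d (S (u i)))"
    if "dual_system W k u e" "functional d" "\<And>w. w \<in> W \<Longrightarrow> d w = 0"
       "lin S" "\<And>w. w \<in> W \<Longrightarrow> S w \<in> W" for d S k u e x
  proof -
    have "d (S (x - (\<Sum>i<k. e i x *s u i))) = 0" using that by (simp add: dual_system_def)
    then show ?thesis using that
      by (simp add: lin_diff lin_sum lin_scale functional_diff functional_sum functional_scale)
  qed
  have c: "functional (c i)" "w \<in> W \<Longrightarrow> c i w = 0" if "i < n" for i w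
    using D that by (auto simp: dual_system_def)
  have c': "functional (c' i)" "w \<in> W \<Longrightarrow> c' i w = 0" if "i < m" for i w
    using D' that by (auto simp: dual_system_def)
  have "(\<Sum>i<n. c i (S (T (v i)))) = (\<Sum>i<n. \<Sum>j<m. c' j (T (v i)) * c i (S (v' j)))"
    by (intro sum.cong refl exp[OF D' _ _ S]) (auto simp: c)
  also have "\<dots> = (\<Sum>j<m. \<Sum>i<n. c i (S (v' j)) * c' j (T (v i)))"
    by (subst sum.swap) (simp add: mult.commute)
  also have "\<dots> = (\<Sum>j<m. c' j (T (S (v' j))))"
    by (intro sum.cong refl exp[OF D _ _ T, symmetric]) (auto simp: c')
  finally show ?thesis .
qed

lemma span_insert_eigenvector_invariant:
  assumes T: "lin T" and W: "subspace W" and TW: "\<And>w. w \<in> W \<Longrightarrow> T w \<in> W"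
    and v: "T v \<approx>[W] k *s v" and w: "w \<in> span (insert v W)"
  shows "T w \<in> span (insert v W)"
proof (rule lin_span_image[OF T subspace_span _ w])
  fix x assume "x \<in> insert v W"
  moreover have "(T v - k *s v) + k *s v \<in> span (insert v W)"
    using v W by (intro span_add span_scale) (auto intro: span_base simp: eqm_iff)
  ultimately show "T x \<in> span (insert v W)" using TW by (auto intro: span_base)
qed

text \<open>For non-real \<open>a\<close>, the map \<open>T - a\<close> is injective modulo
  \<open>W\<close>, hence surjective modulo \<open>W\<close> and so modulo the larger
  \<open>W'\<close>, hence injective modulo \<open>W'\<close>.\<close>

lemma real_eigenvalues_mono:
  assumes T: "lin T" and W: "subspace W" "subspace W'" "W \<subseteq> W'"
    and TW: "\<And>w. w \<in> W \<Longrightarrow> T w \<in> W" and TW': "\<And>w. w \<in> W' \<Longrightarrow> T w \<in> W'"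
    and ev: "\<And>a x. a \<notin> \<real> \<Longrightarrow> T x \<approx>[W] a *s x \<Longrightarrow> x \<in> W"
    and a: "a \<notin> \<real>" and x: "T x \<approx>[W'] a *s x"
  shows "x \<in> W'"
proof -
  define S where "S y = T y - a *s y" for y
  have S: "lin S" by (auto simp: S_def lin_def lin_add[OF T] lin_scale[OF T] vs_simps)
  have SW: "S w \<in> W" if "w \<in> W" for w using that W TW by (auto simp: S_def intro: subspace_diff subspace_scale)
  have SW': "S w \<in> W'" if "w \<in> W'" for w using that W TW' by (auto simp: S_def intro: subspace_diff subspace_scale)
  have surj: "\<exists>y\<in>UNIV. x - S y \<in> W'" for x
  proof -
    have inj: "x \<in> W" if "S x \<in> W" for x
      by (rule ev[OF a]) (use that in \<open>simp add: S_def eqm_iff[OF W(1)]\<close>)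
    obtain y where "x - S y \<in> W"
    proof (rule inj_imp_surj_mod[OF S W(1) subspace_UNIV subset_UNIV UNIV_I])
      show "S w \<in> W" if "w \<in> W" for w using that by (rule SW)
      show "z \<in> W" if "S z \<in> W" for z using that by (rule inj)
    qed auto
    then show ?thesis using W(3) by blast
  qed
  have "S x \<in> W'" using x W by (simp add: S_def eqm_iff)
  then show ?thesis
  proof (rule surj_imp_inj_mod[OF S W(2) subspace_UNIV subset_UNIV UNIV_I, rotated 3])
    show "S w \<in> W'" if "w \<in> W'" for w using that by (rule SW')
    show "\<exists>y\<in>UNIV. z - S y \<in> W'" for z by (rule surj)
  qed auto
qed

text \<open>Since \<open>T (T v)\<close> is \<open>k\<^sup>2\<close> times \<open>v\<close> modulo
  \<open>W\<close>, the new coordinate contributes \<open>k * k\<close> to the trace of the square,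
  while the old coordinates are kept.\<close>

lemma dual_system_trace_extend:
  assumes T: "lin T" and W: "subspace W" and TW: "\<And>w. w \<in> W \<Longrightarrow> T w \<in> W"
    and v: "v \<notin> W" "T v \<approx>[W] k *s v" and D: "dual_system (span (insert v W)) n vs c"
  shows "\<exists>m v' c'. dual_system W m v' c' \<and>
    (\<Sum>i<m. c' i (T (T (v' i)))) = k * k + (\<Sum>i<n. c i (T (T (vs i))))"
proof -
  obtain c' where c': "dual_system W (Suc n) (case_nat v vs) c'" "\<And>i. c' (Suc i) = c i"
    using dual_system_extend[OF W v(1) D] by metis
  have c0: "functional (c' 0)" "c' 0 v = 1" "w \<in> W \<Longrightarrow> c' 0 w = 0" for w
  proof -
    have "functional (c' 0) \<and> (\<forall>w\<in>W. c' 0 w = 0) \<and> c' 0 (case_nat v vs 0) = 1"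
      using c'(1) unfolding dual_system_def by (metis zero_less_Suc)
    then show "functional (c' 0)" "c' 0 v = 1" "w \<in> W \<Longrightarrow> c' 0 w = 0" by auto
  qed
  have Tv: "T v - k *s v \<in> W" using v(2) by (simp add: eqm_iff[OF W])
  have "T (T v) - (k * k) *s v = T (T v - k *s v) + k *s (T v - k *s v)"
    by (simp add: lin_diff[OF T] lin_scale[OF T] vs_simps)
  also have "\<dots> \<in> W" using Tv TW by (intro subspace_add subspace_scale W) auto
  finally have "c' 0 (T (T v) - (k * k) *s v) = 0" by (rule c0(3))
  then have "c' 0 (T (T v)) = k * k" using c0 by (simp add: functional_diff functional_scale)
  then have "(\<Sum>i<Suc n. c' i (T (T (case_nat v vs i)))) = k * k + (\<Sum>i<n. c i (T (T (vs i))))"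
    using c'(2) by (simp add: sum.lessThan_Suc_shift del: sum.lessThan_Suc)
  then show ?thesis using c'(1) by blast
qed

text \<open>Triangularization: splitting off one eigenvector at a time writes the trace of the
  square of \<open>T\<close> as a sum of squares of eigenvalues, all real. Real spectrum passes to
  the smaller quotient by \<open>real_eigenvalues_mono\<close>.\<close>

lemma dual_system_trace_square:
  assumes T: "lin T"
  shows "subspace W \<Longrightarrow> (\<And>w. w \<in> W \<Longrightarrow> T w \<in> W) \<Longrightarrow>
      (\<And>a x. a \<notin> \<real> \<Longrightarrow> T x \<approx>[W] a *s x \<Longrightarrow> x \<in> W) \<Longrightarrow>
    \<exists>n v c s. dual_system W n v c \<and> 0 \<le> s \<and> (\<Sum>i<n. c i (T (T (v i)))) = complex_of_real s"
proof (induction "dim UNIV - dim W" arbitrary: W rule: less_induct)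
  case less
  note W = less.prems(1) and TW = less.prems(2) and ev = less.prems(3)
  show ?case
  proof (cases "W = UNIV")
    case True
    then show ?thesis using dual_system_UNIV by (intro exI[of _ 0]) auto
  next
    case False
    then obtain v k where v: "v \<notin> W" "T v - k *s v \<in> W"
      using eigenvector_mod[OF T W subspace_UNIV] TW by auto
    have Tv: "T v \<approx>[W] k *s v" using v by (simp add: eqm_iff[OF W])
    define W' where "W' = span (insert v W)"
    have sW': "subspace W'" and WW': "W \<subset> W'" using v by (auto simp: W'_def intro: span_base)
    then have lt: "dim UNIV - dim W' < dim UNIV - dim W"
      using dim_strict[OF W sW' WW'] dim_bounded[OF sW'] by linarith
    have TW': "T w \<in> W'" if "w \<in> W'" for w
      using span_insert_eigenvector_invariant[OF T W _ Tv] TW that unfolding W'_def by blast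
    have ev': "x \<in> W'" if a: "a \<notin> \<real>" and x: "T x \<approx>[W'] a *s x" for a x
      by (rule real_eigenvalues_mono[OF T W sW' _ _ _ _ a x]) (use WW' TW TW' ev in blast)+
    have "\<exists>n v c s. dual_system W' n v c \<and> 0 \<le> s \<and> (\<Sum>i<n. c i (T (T (v i)))) = complex_of_real s"
      using less.hyps[OF lt sW'] TW' ev' by presburger
    then obtain n vs c s where D: "dual_system W' n vs c" "0 \<le> s"
        "(\<Sum>i<n. c i (T (T (vs i)))) = complex_of_real s"
      by (elim exE conjE)
    have "k \<in> \<real>" using ev Tv v(1) by blast
    then obtain r where r: "k = complex_of_real r" by (auto elim: Reals_cases)
    obtain m v' c' where "dual_system W m v' c'"
        "(\<Sum>i<m. c' i (T (T (v' i)))) = k * k + (\<Sum>i<n. c i (T (T (vs i))))"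
      using dual_system_trace_extend[OF T W TW v(1) Tv D(1)[unfolded W'_def]] by blast
    moreover have "k * k + (\<Sum>i<n. c i (T (T (vs i)))) = complex_of_real (r * r + s)"
      using D r by simp
    moreover have "0 \<le> r * r + s" using D by simp
    ultimately show ?thesis by metis
  qed
qed

text \<open>The zero map has real spectrum on every quotient, so the preceding construction applies
  to it; only its dual system is kept.\<close>

lemma dual_system_exists:
  assumes "subspace W" shows "\<exists>n v c. dual_system W n v c"
proof -
  have "x \<in> W" if a: "a \<notin> \<real>" and "0 \<approx>[W] a *s x" for a x
  proof -
    have "a \<noteq> 0" using a by auto
    moreover have "a *s x \<in> W" using eqm_sym[OF that(2)] assms by (simp add: eqm_0)
    then have "inverse a *s (a *s x) \<in> W" by (rule subspace_scale[OF assms])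
    ultimately show ?thesis by simp
  qed
  then show ?thesis using dual_system_trace_square[of "\<lambda>x. 0" W] assms
    by (auto simp: lin_def subspace_0)
qed

end

section \<open>Subquotients of modules over \<open>sl\<^sub>2\<close>\<close>

text \<open>The relations are required only on \<open>V\<close> and modulo \<open>W\<close>. One
  instance is a layer \<open>S / A\<close> on which lifts of a triple satisfy them only modulo
  \<open>A\<close>; the other is the whole algebra modulo its radical.\<close>

locale sl2_subquotient = complex_fd_space +
  fixes V W :: "'a set" and E F H :: "'a \<Rightarrow> 'a"
  assumes linE: "lin E" and linF: "lin F" and linH: "lin H"
    and subV: "subspace V" and subW: "subspace W" and WV: "W \<subseteq> V"
    and EV: "x \<in> V \<Longrightarrow> E x \<in> V" and FV: "x \<in> V \<Longrightarrow> F x \<in> V" and HV: "x \<in> V \<Longrightarrow> H x \<in> V"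
    and EW: "x \<in> W \<Longrightarrow> E x \<in> W" and FW: "x \<in> W \<Longrightarrow> F x \<in> W" and HW: "x \<in> W \<Longrightarrow> H x \<in> W"
    and HE: "x \<in> V \<Longrightarrow> H (E x) \<approx>[W] E (H x) + 2 *s E x"
    and HF: "x \<in> V \<Longrightarrow> H (F x) \<approx>[W] F (H x) - 2 *s F x"
    and EF: "x \<in> V \<Longrightarrow> E (F x) \<approx>[W] F (E x) + H x"
begin

text \<open>The symmetry of \<open>sl\<^sub>2\<close> that exchanges raising and lowering
  operators.\<close>

lemma swap: "sl2_subquotient scale V W F E (\<lambda>x. - H x)"
proof unfold_locales
  show "lin (\<lambda>x. - H x)" using linH by (auto simp: lin_def)
  show "- H (F x) \<approx>[W] F (- H x) + 2 *s F x" if "x \<in> V" for x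
    using eqm_minus[OF HF[OF that]] by (simp add: lin_minus[OF linF])
  show "- H (E x) \<approx>[W] E (- H x) - 2 *s E x" if "x \<in> V" for x
    using eqm_minus[OF HE[OF that]] by (simp add: lin_minus[OF linE])
  show "F (E x) \<approx>[W] E (F x) + - H x" if "x \<in> V" for x
    using eqm_diff[OF eqm_sym[OF EF[OF that]] eqm_refl[of "H x"]] by simp
  show "- H x \<in> V" if "x \<in> V" for x using subspace_neg[OF subV HV[OF that]] .
  show "- H x \<in> W" if "x \<in> W" for x using subspace_neg[OF subW HW[OF that]] .
qed (fact linE linF subV subW WV EV FV EW FW)+

lemma eqE: "x \<approx>[W] y \<Longrightarrow> E x \<approx>[W] E y" by (rule eqm_lin[OF linE]) (rule EW)

lemma eqF: "x \<approx>[W] y \<Longrightarrow> F x \<approx>[W] F y" by (rule eqm_lin[OF linF]) (rule FW)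

lemma eqH: "x \<approx>[W] y \<Longrightarrow> H x \<approx>[W] H y" by (rule eqm_lin[OF linH]) (rule HW)

lemma E_weight: "x \<in> V \<Longrightarrow> H x \<approx>[W] c *s x \<Longrightarrow> H (E x) \<approx>[W] (c + 2) *s E x"
  using eqm_trans[OF HE eqm_add[OF eqE eqm_refl]] by (fastforce simp: lin_scale[OF linE] vs_simps)

lemma F_weight: "x \<in> V \<Longrightarrow> H x \<approx>[W] c *s x \<Longrightarrow> H (F x) \<approx>[W] (c - 2) *s F x"
  using eqm_trans[OF HF eqm_diff[OF eqF eqm_refl]] by (fastforce simp: lin_scale[OF linF] vs_simps)

text \<open>
  The vectors \<open>F\<^sup>i x\<close> satisfy \<open>E (F\<^sup>i\<^sup>+\<^sup>1 x) = (i + 1) (c - i) F\<^sup>i x\<close>, so they would all be nonzero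
  if \<open>c\<close> were not a natural number.
\<close>

lemma weight_is_nat:
  assumes x: "x \<in> V" "x \<notin> W" and c: "H x \<approx>[W] c *s x" and FE: "F (E x) \<in> W"
  shows "\<exists>m :: nat. c = of_nat m"
proof (rule ccontr)
  assume no: "\<not> ?thesis"
  define y where "y i = (F ^^ i) x" for i
  have yS: "y (Suc i) = F (y i)" for i by (simp add: y_def)
  have yV: "y i \<in> V" for i unfolding y_def using x FV by (auto intro: funpow_invariant)
  have Hy: "H (y i) \<approx>[W] (c - 2 * of_nat i) *s y i" for i
  proof (induction i)
    case 0 then show ?case using c by (simp add: y_def)
  next
    case (Suc i)
    then show ?case using F_weight[OF yV Suc] by (simp add: yS algebra_simps)
  qed
  have Ey: "E (y (Suc i)) \<approx>[W] (of_nat (Suc i) * (c - of_nat i)) *s y i" for i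
  proof (induction i)
    case 0
    have "E (F x) \<approx>[W] F (E x) + H x" using EF x by blast
    also have "\<dots> \<approx>[W] 0 + c *s x" using FE subW c by (intro eqm_add) (simp_all add: eqm_0)
    finally show ?case by (simp add: y_def)
  next
    case (Suc i)
    have "E (F (y (Suc i))) \<approx>[W] F (E (y (Suc i))) + H (y (Suc i))" using EF yV by blast
    also have "\<dots> \<approx>[W] F ((of_nat (Suc i) * (c - of_nat i)) *s y i) + (c - 2 * of_nat (Suc i)) *s y (Suc i)"
      by (intro eqm_add eqF Suc Hy)
    also have "\<dots> = (of_nat (Suc i) * (c - of_nat i) + (c - 2 * of_nat (Suc i))) *s y (Suc i)"
      by (simp add: lin_scale[OF linF] yS scale_left_distrib)
    also have "of_nat (Suc i) * (c - of_nat i) + (c - 2 * of_nat (Suc i))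
        = of_nat (Suc (Suc i)) * (c - of_nat (Suc i))" by (simp add: algebra_simps)
    finally show ?case by (simp add: yS)
  qed
  have "y i \<notin> W" for i
  proof (induction i)
    case 0 then show ?case using x by (simp add: y_def)
  next
    case (Suc i)
    define a where "a = of_nat (Suc i) * (c - of_nat i)"
    have "a \<noteq> 0" using no by (auto simp: a_def simp del: of_nat_Suc)
    show ?case
    proof
      assume "y (Suc i) \<in> W"
      then have "a *s y i \<in> W" using EW eqm_mem[OF subW Ey[of i]] by (simp add: a_def)
      then have "inverse a *s (a *s y i) \<in> W" by (rule subspace_scale[OF subW])
      then show False using \<open>a \<noteq> 0\<close> Suc by simp
    qed
  qed
  moreover have "inj (\<lambda>i :: nat. c - 2 * of_nat i)" by (auto simp: inj_def)
  ultimately show False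
    using finitely_many_eigenvalues_mod[OF linH subW HW, of "\<lambda>i. c - 2 * of_nat i" y] Hy
    by (auto simp: eqm_iff[OF subW])
qed

text \<open>The vectors \<open>E^i x\<close> have distinct weights \<open>c + 2 i\<close>, so they
  end in \<open>W\<close>. The last one outside \<open>W\<close> is a highest weight vector, whose
  weight is natural; subtracting \<open>2 j\<close> recovers \<open>c\<close>.\<close>

lemma weight_is_real:
  assumes x: "x \<in> V" "x \<notin> W" and c: "H x \<approx>[W] c *s x"
  shows "c \<in> \<real>"
proof -
  define y where "y i = (E ^^ i) x" for i
  have yS: "y (Suc i) = E (y i)" for i by (simp add: y_def)
  have yV: "y i \<in> V" for i unfolding y_def using x EV by (auto intro: funpow_invariant)
  have Hy: "H (y i) \<approx>[W] (c + 2 * of_nat i) *s y i" for i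
  proof (induction i)
    case 0 then show ?case using c by (simp add: y_def)
  next
    case (Suc i)
    then show ?case using E_weight[OF yV Suc] by (simp add: yS algebra_simps)
  qed
  have "inj (\<lambda>i :: nat. c + 2 * of_nat i)" by (auto simp: inj_def)
  then have ex: "\<exists>i. y i \<in> W"
    using finitely_many_eigenvalues_mod[OF linH subW HW, of "\<lambda>i. c + 2 * of_nat i" y] Hy
    by (auto simp: eqm_iff[OF subW])
  define i where "i = (LEAST i. y i \<in> W)"
  have i: "y i \<in> W" "\<And>j. j < i \<Longrightarrow> y j \<notin> W"
    unfolding i_def using LeastI_ex[OF ex] not_less_Least by blast+
  then obtain j where j: "i = Suc j" using x by (cases i) (auto simp: y_def)
  then obtain m :: nat where "c + 2 * of_nat j = of_nat m"
    using weight_is_nat[OF yV i(2) Hy, of j] i(1) FW by (auto simp: yS)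
  then have "c = of_nat m - 2 * of_nat j" by (simp add: algebra_simps)
  then show ?thesis by simp
qed

text \<open>The vector \<open>E x\<close> has weight \<open>0\<close>, so \<open>E (F (E x))\<close>
  lies in \<open>W\<close>. Now \<open>weight_is_nat\<close> is used twice, first for
  \<open>F (E x)\<close> and then for \<open>x\<close>: both have weight \<open>-2\<close>, which is
  not natural.\<close>

lemma E_E_inj:
  assumes x: "x \<in> V" and Hx: "H x \<approx>[W] (- 2) *s x" and EE: "E (E x) \<in> W"
  shows "x \<in> W"
proof -
  have neg: "(- 2 :: complex) \<noteq> of_nat m" for m
  proof
    assume "- 2 = (of_nat m :: complex)"
    then have "(of_nat (m + 2) :: complex) = 0" by simp
    then show False by (simp only: of_nat_eq_0_iff)
  qed
  have Hz: "H (E x) \<approx>[W] 0 *s E x" using E_weight[OF x Hx] by simp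
  have HFz: "H (F (E x)) \<approx>[W] (- 2) *s F (E x)" using F_weight[OF EV[OF x] Hz] by simp
  have "E (F (E x)) \<approx>[W] F (E (E x)) + H (E x)" using EF EV x by blast
  also have "\<dots> \<approx>[W] 0 + 0" using Hz FW[OF EE] subW by (intro eqm_add) (simp_all add: eqm_0)
  finally have "E (F (E x)) \<in> W" using subW by (simp add: eqm_0)
  then have "F (E x) \<in> W" using weight_is_nat[OF FV[OF EV[OF x]] _ HFz] FW neg by blast
  then show ?thesis using weight_is_nat[OF x _ Hx] neg by blast
qed

text \<open>On the space of weight \<open>2\<close> the map \<open>E E F F\<close> is injective by
  \<open>E_E_inj\<close> and its mirror image, hence surjective in finite dimension;
  \<open>F (F y)\<close> is then the preimage under \<open>E E\<close>.\<close>

lemma E_E_surj: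
  assumes u: "u \<in> V" and Hu: "H u \<approx>[W] 2 *s u"
  obtains y where "y \<in> V" "H y \<approx>[W] (- 2) *s y" "E (E y) \<approx>[W] u"
proof -
  define U where "U = {u \<in> V. H u \<approx>[W] 2 *s u}"
  interpret swap: sl2_subquotient scale V W F E "\<lambda>x. - H x" by (rule swap)
  have FF: "H (F (F x)) \<approx>[W] (- 2) *s F (F x)" if "x \<in> U" for x
    using F_weight[OF FV F_weight, of x 2] that FV by (auto simp: U_def)
  have EEFF: "H (E (E (F (F x)))) \<approx>[W] 2 *s E (E (F (F x)))" if "x \<in> U" for x
    using E_weight[OF EV E_weight[OF _ FF[OF that]]] that FV by (auto simp: U_def)
  have linT: "lin (\<lambda>x. E (E (F (F x))))"
    by (simp add: lin_def lin_add[OF linE] lin_add[OF linF] lin_scale[OF linE] lin_scale[OF linF])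
  have sU: "subspace U"
  proof -
    have "lin (\<lambda>x. H x - 2 *s x)" by (auto simp: lin_def lin_add[OF linH] lin_scale[OF linH] vs_simps)
    moreover have "U = V \<inter> {x. H x - 2 *s x \<in> W}" by (auto simp: U_def eqm_iff[OF subW])
    ultimately show ?thesis using lin_subspace_vimage subW subV subspace_inter by metis
  qed
  have WU: "W \<subseteq> U" using WV HW subW by (auto simp: U_def eqm_iff subspace_diff subspace_scale)
  obtain y where y: "y \<in> U" "u - E (E (F (F y))) \<in> W"
  proof (rule inj_imp_surj_mod[OF linT subW sU WU])
    show "E (E (F (F x))) \<in> U" if "x \<in> U" for x
      using that EEFF EV FV by (auto simp: U_def)
    show "x \<in> W" if x: "x \<in> U" "E (E (F (F x))) \<in> W" for x
    proof -
      have "F (F x) \<in> W" using E_E_inj[OF _ FF] x FV by (auto simp: U_def)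
      then show ?thesis using swap.E_E_inj[of x] x eqm_minus[of "H x" W "2 *s x"] by (auto simp: U_def)
    qed
    show "u \<in> U" using u Hu by (simp add: U_def)
  qed (auto intro: EW FW)
  show thesis
    using that[OF FV[OF FV] FF[OF y(1)] eqm_sym] y by (simp add: U_def eqm_iff[OF subW])
qed

end

section \<open>Irreducible subquotients: diagonalizability of \<open>H\<close>\<close>

locale sl2_irreducible = sl2_subquotient +
  assumes proper: "W \<noteq> V"
    and irreducible: "subspace U \<Longrightarrow> W \<subseteq> U \<Longrightarrow> U \<subseteq> V \<Longrightarrow> (\<And>x. x \<in> U \<Longrightarrow> E x \<in> U) \<Longrightarrow>
      (\<And>x. x \<in> U \<Longrightarrow> F x \<in> U) \<Longrightarrow> (\<And>x. x \<in> U \<Longrightarrow> H x \<in> U) \<Longrightarrow> U = W \<or> U = V"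
begin

text \<open>The operators \<open>E\<close> and \<open>F\<close> shift eigenvalues of
  \<open>H\<close> by \<open>2\<close> and \<open>-2\<close>, so the eigenvectors span a submodule.
  It is nonzero modulo \<open>W\<close>, and irreducibility does the rest.\<close>

lemma spanned_by_eigenvectors: "V = span (W \<union> {x \<in> V. \<exists>d. H x \<approx>[W] d *s x})" (is "V = ?U")
proof -
  have inv: "T x \<in> ?U" if T: "lin T" "\<And>w. w \<in> W \<Longrightarrow> T w \<in> W"
    "\<And>x d. x \<in> V \<Longrightarrow> H x \<approx>[W] d *s x \<Longrightarrow> T x \<in> V \<and> (\<exists>d'. H (T x) \<approx>[W] d' *s T x)" and x: "x \<in> ?U" for T x
    using x by (rule lin_span_image[OF T(1) subspace_span, rotated])
      (use T in \<open>auto intro!: span_base\<close>)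
  have UV: "?U \<subseteq> V" using WV subV by (intro span_minimal) auto
  obtain v c where v: "v \<in> V" "v \<notin> W" "H v - c *s v \<in> W"
    using eigenvector_mod[OF linH subW subV _ HV HW] proper WV by blast
  then have "v \<in> ?U" by (auto intro!: span_base simp: eqm_iff[OF subW])
  then have "?U \<noteq> W" using v by auto
  moreover have "?U = W \<or> ?U = V"
  proof (rule irreducible[OF subspace_span _ UV])
    show "W \<subseteq> ?U" by (auto intro: span_base)
    show "E x \<in> ?U" if "x \<in> ?U" for x
      by (rule inv[OF linE _ _ that]) (use EW EV E_weight in blast)+
    show "F x \<in> ?U" if "x \<in> ?U" for x
      by (rule inv[OF linF _ _ that]) (use FW FV F_weight in blast)+
    have HH: "H (H x) \<approx>[W] d *s H x" if "H x \<approx>[W] d *s x" for x d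
      using eqH[OF that] by (simp add: lin_scale[OF linH])
    show "H x \<in> ?U" if "x \<in> ?U" for x
      by (rule inv[OF linH _ _ that]) (use HW HV HH in blast)+
  qed
  ultimately show ?thesis by blast
qed

text \<open>This serves to correct lifts of a triple: an error in the image of \<open>H - c\<close>
  can be absorbed, and what remains is an error of weight exactly \<open>c\<close>.\<close>

lemma eigenspace_decomposition:
  assumes "s \<in> V"
  obtains s' x where "s' \<in> V" "x \<in> V" "H s' \<approx>[W] c *s s'" "s \<approx>[W] s' + (H x - c *s x)"
proof -
  define X where "X = {s. \<exists>s'\<in>V. \<exists>x\<in>V. H s' \<approx>[W] c *s s' \<and> s \<approx>[W] s' + (H x - c *s x)}"
  have "subspace X"
  proof (rule subspaceI)
    show "0 \<in> X" unfolding X_def using subspace_0[OF subV]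
      by (intro CollectI bexI[of _ 0]) (auto simp: lin_0[OF linH])
  next
    fix s t assume "s \<in> X" "t \<in> X"
    then obtain s' x t' y where *: "s' \<in> V" "x \<in> V" "H s' \<approx>[W] c *s s'" "s \<approx>[W] s' + (H x - c *s x)"
      "t' \<in> V" "y \<in> V" "H t' \<approx>[W] c *s t'" "t \<approx>[W] t' + (H y - c *s y)" by (auto simp: X_def)
    show "s + t \<in> X" unfolding X_def
      using * eqm_add[OF *(3,7)] eqm_add[OF *(4,8)] subV
      by (intro CollectI bexI[of _ "s' + t'"] bexI[of _ "x + y"])
         (auto simp: subspace_add lin_add[OF linH] scale_right_distrib add_ac add_diff_add)
  next
    fix d s assume "s \<in> X"
    then obtain s' x where *: "s' \<in> V" "x \<in> V" "H s' \<approx>[W] c *s s'" "s \<approx>[W] s' + (H x - c *s x)"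
      by (auto simp: X_def)
    show "d *s s \<in> X" unfolding X_def
      using * eqm_scale[OF *(3), of d] eqm_scale[OF *(4), of d] subV
      by (intro CollectI bexI[of _ "d *s s'"] bexI[of _ "d *s x"])
         (auto simp: subspace_scale lin_scale[OF linH] scale_right_distrib scale_right_diff_distrib mult.commute)
  qed
  moreover have "x \<in> X" if "x \<in> V" "H x \<approx>[W] d *s x" for x d
  proof (cases "d = c")
    case True
    then show ?thesis unfolding X_def using that subspace_0[OF subV] lin_0[OF linH]
      by (intro CollectI bexI[of _ x] bexI[of _ 0]) auto
  next
    case False
    \<comment> \<open>On the eigenspace of \<open>d\<close> the map \<open>H - c\<close> is
      multiplication by the nonzero scalar \<open>d - c\<close>.\<close>
    have "inverse (d - c) *s (d *s x - c *s x) \<approx>[W] inverse (d - c) *s (H x - c *s x)"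
      by (intro eqm_scale eqm_diff eqm_sym[OF that(2)] eqm_refl)
    moreover have "inverse (d - c) *s (d *s x - c *s x) = x"
      using False by (simp add: scale_left_diff_distrib[symmetric])
    ultimately show ?thesis unfolding X_def using that subspace_0[OF subV] lin_0[OF linH] subV
      by (intro CollectI bexI[of _ 0] bexI[of _ "inverse (d - c) *s x"])
         (auto simp: subspace_scale lin_scale[OF linH] scale_right_diff_distrib mult.commute)
  qed
  moreover have "x \<in> X" if "x \<in> W" for x unfolding X_def using that subspace_0[OF subV] lin_0[OF linH]
    by (intro CollectI bexI[of _ 0]) (auto simp: eqm_0[OF subW])
  ultimately have "span (W \<union> {x \<in> V. \<exists>d. H x \<approx>[W] d *s x}) \<subseteq> X" by (intro span_minimal) auto
  then have "s \<in> X" using assms spanned_by_eigenvectors by blast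
  then show thesis using that by (auto simp: X_def)
qed

text \<open>A diagonalizable map is surjective on its own image, hence injective there, and
  \<open>H r\<close> is an element of this image killed by \<open>H\<close>.\<close>

lemma H_square_kernel:
  assumes r: "r \<in> V" "H (H r) \<in> W" shows "H r \<in> W"
proof -
  define U where "U = sumset (H ` V) W"
  have sU: "subspace U" unfolding U_def by (intro subspace_sums lin_subspace_image linH subV subW)
  have inU: "x \<in> V \<Longrightarrow> H x \<in> U" and WU: "W \<subseteq> U" for x
    unfolding U_def using subspace_0[OF subW] subspace_0[OF subV] lin_0[OF linH]
    by (force intro: exI[of _ "0 :: 'a"])+
  have UV: "U \<subseteq> V" unfolding U_def using HV WV subV by (auto intro!: subspace_add)
  show ?thesis
  proof (rule surj_imp_inj_mod[OF linH subW sU WU])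
    show "\<exists>y\<in>U. x - H y \<in> W" if xU: "x \<in> U" for x
    proof -
      obtain a w where a: "a \<in> V" "w \<in> W" "x = H a + w" using xU by (auto simp: U_def)
      obtain s' y where *: "s' \<in> V" "y \<in> V" "H s' \<approx>[W] 0 *s s'" "a \<approx>[W] s' + (H y - 0 *s y)"
        using eigenspace_decomposition[OF a(1)] by blast
      have "x \<approx>[W] H a + 0" unfolding a(3) by (intro eqm_add eqm_refl) (simp add: eqm_0 subW a)
      also have "H a + 0 \<approx>[W] H s' + H (H y)" using eqH[OF *(4)] by (simp add: lin_add[OF linH])
      also have "\<dots> \<approx>[W] 0 + H (H y)" using *(3) by (intro eqm_add eqm_refl) simp
      finally show ?thesis using inU[OF *(2)] by (auto simp: eqm_iff[OF subW])
    qed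
  qed (use r inU HV UV HW in auto)
qed

end

section \<open>Left Leibniz algebras and the theorems of Lie, Engel and Fitting\<close>

sublocale complex_algebra \<subseteq> complex_fd_space scale
  by unfold_locales (rule finite_dim)

lemma (in complex_fd_space) subspace_scale_iff: "subspace W \<Longrightarrow> c \<noteq> 0 \<Longrightarrow> scale c x \<in> W \<longleftrightarrow> x \<in> W"
  using subspace_scale[of W x c] subspace_scale[of W "scale c x" "inverse c"] by auto

context complex_algebra begin

lemma lin_br: "lin (br a)"
  using linear_right[of a] unfolding Vector_Spaces.linear_iff lin_def by blast

lemma lin_br_left: "lin (\<lambda>a. br a b)"
  using linear_left[of b] unfolding Vector_Spaces.linear_iff lin_def by blast

lemmas br_simps = lin_add[OF lin_br] lin_scale[OF lin_br] lin_0[OF lin_br] lin_minus[OF lin_br]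
  lin_diff[OF lin_br] lin_add[OF lin_br_left] lin_scale[OF lin_br_left] lin_0[OF lin_br_left]
  lin_minus[OF lin_br_left] lin_diff[OF lin_br_left]

lemma psi_add_left: "psi (a + b) c = psi a c + psi b c"
  and psi_add_right: "psi c (a + b) = psi c a + psi c b"
  and psi_scale_left: "psi (scale k a) c = scale k (psi a c)"
  and psi_scale_right: "psi c (scale k a) = scale k (psi c a)"
  and psi_diff_left: "psi (a - b) c = psi a c - psi b c"
  and psi_diff_right: "psi c (a - b) = psi c a - psi c b"
  and psi_zero_left: "psi 0 c = 0"
  and psi_zero_right: "psi c 0 = 0"
  by (simp_all add: psi_def br_simps scale_right_distrib algebra_simps)

lemmas psi_simps = psi_add_left psi_add_right psi_scale_left psi_scale_right psi_diff_left
  psi_diff_right psi_zero_left psi_zero_right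

lemma psi_commute: "psi a b = psi b a"
  by (simp add: psi_def add.commute)

lemma br_flip: "br a b = psi a b - br b a"
  by (simp add: psi_def)

lemma psi_in_kernel: "psi a b \<in> leibniz_kernel"
proof -
  have "psi a b = br (a + b) (a + b) - br a a - br b b" by (simp add: psi_def br_simps)
  moreover have "br x x \<in> leibniz_kernel" for x unfolding leibniz_kernel_def by (rule span_base) blast
  ultimately show ?thesis unfolding leibniz_kernel_def by (simp add: span_diff)
qed

lemma subspace_kernel: "subspace leibniz_kernel"
  by (simp add: leibniz_kernel_def)

lemma br_self_in_kernel: "br a a \<in> leibniz_kernel"
  unfolding leibniz_kernel_def by (auto intro: span_base)

section \<open>Subalgebras, ideals and solvability\<close>

definition subalg :: "'a set \<Rightarrow> bool" where
  "subalg Y \<longleftrightarrow> subspace Y \<and> (\<forall>a\<in>Y. \<forall>b\<in>Y. br a b \<in> Y)"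

definition ideal_of :: "'a set \<Rightarrow> 'a set \<Rightarrow> bool" where
  "ideal_of Y S \<longleftrightarrow> subspace S \<and> S \<subseteq> Y \<and> (\<forall>y\<in>Y. \<forall>s\<in>S. br y s \<in> S \<and> br s y \<in> S)"

primrec dser :: "'a set \<Rightarrow> nat \<Rightarrow> 'a set" where
  "dser P 0 = P"
| "dser P (Suc n) = span {br x y |x y. x \<in> dser P n \<and> y \<in> dser P n}"

text \<open>For an ideal \<open>R\<close> this is solvability of the image of \<open>P\<close> in
  the quotient by \<open>R\<close>; \<open>P\<close> may fail to contain \<open>R\<close>.\<close>

definition solv :: "'a set \<Rightarrow> 'a set \<Rightarrow> bool" where
  "solv R P \<longleftrightarrow> (\<exists>n. dser P n \<subseteq> R)"

lemma subalgD: "subalg Y \<Longrightarrow> subspace Y" "subalg Y \<Longrightarrow> a \<in> Y \<Longrightarrow> b \<in> Y \<Longrightarrow> br a b \<in> Y"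
  by (auto simp: subalg_def)

lemma ideal_ofD:
  assumes "ideal_of Y S"
  shows "subspace S" "S \<subseteq> Y" "y \<in> Y \<Longrightarrow> s \<in> S \<Longrightarrow> br y s \<in> S" "y \<in> Y \<Longrightarrow> s \<in> S \<Longrightarrow> br s y \<in> S"
  using assms by (auto simp: ideal_of_def)

lemma ideal_of_subalg: "ideal_of Y S \<Longrightarrow> subalg S"
  by (auto simp: ideal_of_def subalg_def)

lemma subalg_UNIV: "subalg UNIV"
  by (simp add: subalg_def)

text \<open>The products \<open>[s, y]\<close> and \<open>- [y, s]\<close> differ by a value of
  \<open>psi\<close>, which lies in the Leibniz kernel; once the kernel part of \<open>Y\<close> is
  in \<open>S\<close>, left stability gives right stability.\<close>

lemma ideal_of_left:
  assumes "subalg Y" "subspace S" "S \<subseteq> Y" "leibniz_kernel \<inter> Y \<subseteq> S"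
    and left: "\<And>y s. y \<in> Y \<Longrightarrow> s \<in> S \<Longrightarrow> br y s \<in> S"
  shows "ideal_of Y S"
proof -
  have "br s y \<in> S" if "y \<in> Y" "s \<in> S" for y s
  proof -
    have "psi s y \<in> Y" unfolding psi_def using that assms by (auto simp: subalg_def intro!: subspace_add)
    then have "psi s y \<in> S" using psi_in_kernel assms by blast
    then show ?thesis using that assms by (subst br_flip) (auto intro: subspace_diff)
  qed
  then show ?thesis using assms by (auto simp: ideal_of_def)
qed

lemma ideal_of_mono: "ideal_of Y S \<Longrightarrow> S \<subseteq> Z \<Longrightarrow> Z \<subseteq> Y \<Longrightarrow> ideal_of Z S"
  unfolding ideal_of_def by blast

lemma ideal_of_inter: "ideal_of Y S \<Longrightarrow> subalg Z \<Longrightarrow> Z \<subseteq> Y \<Longrightarrow> ideal_of Z (S \<inter> Z)"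
  unfolding ideal_of_def subalg_def by (auto intro: subspace_inter)

lemma ideal_of_plus:
  assumes "ideal_of Y S" "ideal_of Y T" "subspace Y"
  shows "ideal_of Y (sumset S T)"
  unfolding ideal_of_def
proof (intro conjI)
  show "subspace (sumset S T)" using assms by (intro subspace_sums) (auto simp: ideal_of_def)
  show "sumset S T \<subseteq> Y"
    using assms by (auto simp: ideal_of_def intro!: subspace_add)
  show "\<forall>y\<in>Y. \<forall>s\<in>sumset S T. br y s \<in> sumset S T
      \<and> br s y \<in> sumset S T"
  proof (intro ballI)
    fix y s assume y: "y \<in> Y" and "s \<in> sumset S T"
    then obtain a b where *: "a \<in> S" "b \<in> T" "s = a + b" by blast
    have "br y s = br y a + br y b" "br s y = br a y + br b y" by (simp_all add: * br_simps)
    moreover have "br y a \<in> S" "br a y \<in> S" "br y b \<in> T" "br b y \<in> T"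
      using * y by (simp_all add: ideal_ofD[OF assms(1)] ideal_ofD[OF assms(2)])
    ultimately show "br y s \<in> sumset S T \<and> br s y \<in> sumset S T"
      by blast
  qed
qed

lemma dser_mono: "P \<subseteq> Q \<Longrightarrow> dser P n \<subseteq> dser Q n"
proof (induction n)
  case (Suc n)
  then show ?case unfolding dser.simps by (intro span_mono) blast
qed simp

lemma dser_add: "dser P (n + m) = dser (dser P n) m"
  by (induction m) auto

lemma dser_Suc_subset: "subspace V \<Longrightarrow> (\<And>x y. x \<in> dser P n \<Longrightarrow> y \<in> dser P n \<Longrightarrow> br x y \<in> V) \<Longrightarrow> dser P (Suc n) \<subseteq> V"
  unfolding dser.simps by (rule span_minimal) auto

lemma subspace_dser: "subspace P \<Longrightarrow> subspace (dser P n)"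
  by (cases n) auto

lemma dser_subset: "subalg P \<Longrightarrow> dser P n \<subseteq> P"
proof (induction n)
  case (Suc n)
  then show ?case by (intro dser_Suc_subset) (auto simp: subalg_def)
qed simp

lemma solv_subset: "P \<subseteq> R \<Longrightarrow> solv R P"
  unfolding solv_def by (intro exI[of _ 0]) simp

lemma solv_step: "dser P n \<subseteq> I \<Longrightarrow> solv R I \<Longrightarrow> solv R P"
proof -
  assume n: "dser P n \<subseteq> I" and "solv R I"
  then obtain m where "dser I m \<subseteq> R" by (auto simp: solv_def)
  then have "dser P (n + m) \<subseteq> R" using dser_mono[OF n, of m] by (simp add: dser_add)
  then show ?thesis by (auto simp: solv_def)
qed

lemma dser_plus:
  assumes Z: "subalg Z" "Z \<subseteq> Y" and I: "ideal_of Y I"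
    and Y: "Y \<subseteq> sumset Z I"
  shows "dser Y n \<subseteq> sumset (dser Z n) I"
proof (induction n)
  case 0
  then show ?case using Y by simp
next
  case (Suc n)
  have sI: "subspace I" using I by (rule ideal_ofD)
  have "br x y \<in> sumset (dser Z (Suc n)) I" if "x \<in> dser Y n" "y \<in> dser Y n" for x y
  proof -
    obtain a b where *: "a \<in> dser Z n" "b \<in> I" "x = a + b"
      using subsetD[OF Suc \<open>x \<in> dser Y n\<close>] by blast
    obtain a' b' where *: "a \<in> dser Z n" "b \<in> I" "x = a + b" "a' \<in> dser Z n" "b' \<in> I" "y = a' + b'"
      using subsetD[OF Suc \<open>y \<in> dser Y n\<close>] * by blast
    have Y: "a \<in> Y" "a' \<in> Y" "b \<in> Y"
      using * dser_subset[OF Z(1), of n] Z(2) ideal_ofD(2)[OF I] by blast+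
    have "br a b' + (br b a' + br b b') \<in> I"
      by (intro subspace_add[OF sI]) (simp_all add: ideal_ofD[OF I] Y *)
    moreover have "br a a' \<in> dser Z (Suc n)" unfolding dser.simps by (rule span_base) (use * in blast)
    moreover have "br x y = br a a' + (br a b' + (br b a' + br b b'))" by (simp add: * br_simps)
    ultimately show ?thesis by blast
  qed
  then show ?case
    by (intro dser_Suc_subset subspace_sums sI subspace_dser subalgD(1)[OF Z(1)])
qed

text \<open>A late derived term of \<open>Y\<close> lies in one of \<open>Z\<close> plus
  \<open>I\<close>, and the former lies in \<open>R \<inter> Y\<close>, hence in \<open>I\<close>.
  From there the derived series of \<open>I\<close> takes over.\<close>

lemma solv_plus:
  assumes Z: "subalg Z" "Z \<subseteq> Y" "solv R Z" and I: "ideal_of Y I" "solv R I" "R \<inter> Y \<subseteq> I"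
    and Y: "Y \<subseteq> sumset Z I"
  shows "solv R Y"
proof -
  obtain n where n: "dser Z n \<subseteq> R" using Z(3) by (auto simp: solv_def)
  have "dser Z n \<subseteq> I" using n I(3) dser_subset[OF Z(1), of n] Z(2) by blast
  then have "sumset (dser Z n) I \<subseteq> I"
    using subspace_add[OF ideal_ofD(1)[OF I(1)]] by blast
  with dser_plus[OF Z(1,2) I(1) Y, of n] have "dser Y n \<subseteq> I" by (rule order_trans)
  then show ?thesis using I(2) by (rule solv_step)
qed

end

context left_leibniz_algebra begin

lemma br_br_self: "br (br a a) b = 0"
  using leibniz[of a a b] by (simp only: add_cancel_right_left)

lemma br_kernel_left:
  assumes "c \<in> leibniz_kernel" shows "br c b = 0"
proof -
  have "br c b \<in> {0}"
    by (rule lin_span_image[OF lin_br_left subspace_single_0 _ assms[unfolded leibniz_kernel_def]])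
       (auto simp: br_br_self)
  then show ?thesis by simp
qed

text \<open>Lie's theorem for the action on \<open>U / W\<close> by left multiplication. Solvability
  is asked only of the action: some derived term of \<open>P\<close> maps \<open>U\<close> into
  \<open>W\<close>.\<close>

lemma lie_theorem:
  assumes "subalg P" "subspace U" "subspace W" "W \<subset> U"
    and "\<And>p u. p \<in> P \<Longrightarrow> u \<in> U \<Longrightarrow> br p u \<in> U" "\<And>p u. p \<in> P \<Longrightarrow> u \<in> W \<Longrightarrow> br p u \<in> W"
    and "\<And>d u. d \<in> dser P n \<Longrightarrow> u \<in> U \<Longrightarrow> br d u \<in> W"
  shows "\<exists>v\<in>U - W. \<forall>p\<in>P. \<exists>c. br p v - scale c v \<in> W"
  using assms
proof (induction "dim P" arbitrary: P rule: less_induct)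
  case less
  note P = less.prems(1) and U = less.prems(2) and W = less.prems(3,4)
    and PU = less.prems(5) and PW = less.prems(6) and dP = less.prems(7)
  show ?case
  proof (cases "dser P 1 = P")
    case True
    \<comment> \<open>A perfect \<open>P\<close> coincides with all its derived terms, so it acts by
      zero and any vector outside \<open>W\<close> will do.\<close>
    have "dser P n = P" for n
    proof (induction n)
      case (Suc n) then show ?case using True dser_add[of P n 1] by simp
    qed simp
    then have "br p u - scale 0 u \<in> W" if "p \<in> P" "u \<in> U" for p u using dP that by simp
    then show ?thesis using W by blast
  next
    case False
    define D where "D = dser P 1"
    have DP: "D \<subset> P" using False dser_subset[OF P, of 1] by (auto simp: D_def)
    have brD: "br a b \<in> D" if "a \<in> P" "b \<in> P" for a b
      using that unfolding D_def One_nat_def dser.simps by (blast intro: span_base)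
    have sD: "subspace D" unfolding D_def by (intro subspace_dser subalgD P)
    obtain P' x where P': "subspace P'" "D \<subseteq> P'" "P' \<subset> P" "x \<in> P" "x \<notin> P'" "P = span (insert x P')"
      using maximal_proper_subspace[OF sD subalgD(1)[OF P] DP] .
    have alg: "subalg P'" unfolding subalg_def using P' brD by blast
    have "\<exists>v\<in>U - W. \<forall>p\<in>P'. \<exists>c. br p v - scale c v \<in> W"
    proof (rule less.hyps[OF _ alg U W])
      show "dim P' < dim P" using dim_strict[OF P'(1) subalgD(1)[OF P] P'(3)] .
      show "br d u \<in> W" if "d \<in> dser P' n" "u \<in> U" for d u
        using dP that dser_mono[of P' P n] P' by blast
    qed (use P' PU PW in blast)+
    then obtain v0 l where v0: "v0 \<in> U" "v0 \<notin> W" and l: "\<And>p. p \<in> P' \<Longrightarrow> br p v0 - scale (l p) v0 \<in> W"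
      by (metis DiffE)
    \<comment> \<open>The crux of Lie's theorem. Instead of the usual trace argument on the cyclic
      space of \<open>v0\<close> under \<open>x\<close>, the second coefficient of the triangular
      action is computed and compared at the first dependence.\<close>
    have key: "l (br p x) = 0" if p: "p \<in> P'" for p
    proof -
      define w where "w i = (br x ^^ i) v0" for i
      have wS: "w (Suc i) = br x (w i)" and w0: "w 0 = v0" for i by (simp_all add: w_def)
      define X where "X i = span (W \<union> w ` {..<i})" for i
      have sX: "subspace (X i)" and XS: "X i \<subseteq> X (Suc i)" for i
        unfolding X_def by (auto intro!: span_mono)
      have Xmono: "i \<le> j \<Longrightarrow> X i \<subseteq> X j" for i j by (rule lift_Suc_mono_le[of X, OF XS])
      have wX: "j < i \<Longrightarrow> w j \<in> X i" and WX: "W \<subseteq> X i" for i j unfolding X_def by (auto intro: span_base)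
      have xX: "y \<in> X i \<Longrightarrow> br x y \<in> X (Suc i)" for y i
        unfolding X_def[of i]
      proof (rule lin_span_image[OF lin_br sX])
        fix z assume "z \<in> W \<union> w ` {..<i}"
        then show "br x z \<in> X (Suc i)" using PW P'(4) WX wX[of "Suc _" "Suc i"] by (auto simp: wS[symmetric])
      qed
      have px: "br q x \<in> P'" if "q \<in> P'" for q using brD that P' by blast
      \<comment> \<open>Modulo the vectors below \<open>w i\<close>, moving \<open>q\<close> past
        \<open>i + 1\<close> factors \<open>x\<close> produces the commutator \<open>[q, x]\<close>
        once per factor; hence the coefficient \<open>i + 1\<close> of \<open>w i\<close>.\<close>
      have C2: "\<forall>q\<in>P'. br q (w (Suc i)) - (scale (l q) (w (Suc i)) + scale (of_nat (Suc i) * l (br q x)) (w i)) \<in> X i"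
        and C1: "\<forall>q\<in>P'. br q (w i) - scale (l q) (w i) \<in> X i" for i
      proof (induction i)
        case 0
        {
          case 2
          show ?case using l WX[of 0] by (auto simp: w0)
        next
          case 1
          show ?case
          proof
            fix q assume q: "q \<in> P'"
            have "br q (w 1) - (scale (l q) (w 1) + scale (l (br q x)) (w 0))
               = (br (br q x) v0 - scale (l (br q x)) v0) + br x (br q v0 - scale (l q) v0)"
              using leibniz[of q x v0] by (simp add: wS w0 br_simps algebra_simps)
            also have "\<dots> \<in> W" using l[OF q] l[OF px[OF q]] PW P'(4) W(1) by (intro subspace_add) auto
            finally show "br q (w (Suc 0)) - (scale (l q) (w (Suc 0)) + scale (of_nat (Suc 0) * l (br q x)) (w 0)) \<in> X 0"
              using WX[of 0] by auto
          qed
        }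
      next
        case (Suc i)
        {
          case 2
          show ?case
          proof
            fix q assume q: "q \<in> P'"
            have "br q (w (Suc i)) - scale (l q) (w (Suc i)) =
              (br q (w (Suc i)) - (scale (l q) (w (Suc i)) + scale (of_nat (Suc i) * l (br q x)) (w i)))
                + scale (of_nat (Suc i) * l (br q x)) (w i)" by simp
            also have "\<dots> \<in> X (Suc i)" using Suc(1) q XS[of i] wX[of i "Suc i"] sX[of "Suc i"]
              by (intro subspace_add subspace_scale) blast+
            finally show "br q (w (Suc i)) - scale (l q) (w (Suc i)) \<in> X (Suc i)" .
          qed
        next
          case 1
          show ?case
          proof
            fix q assume q: "q \<in> P'"
            define r where "r = br q (w (Suc i)) - (scale (l q) (w (Suc i)) + scale (of_nat (Suc i) * l (br q x)) (w i))"
            define t where "t = br (br q x) (w (Suc i)) - scale (l (br q x)) (w (Suc i))"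
            have "r \<in> X i" using Suc(1) q by (simp add: r_def)
            have "t = (br (br q x) (w (Suc i)) - (scale (l (br q x)) (w (Suc i)) + scale (of_nat (Suc i) * l (br (br q x) x)) (w i)))
                + scale (of_nat (Suc i) * l (br (br q x) x)) (w i)" by (simp add: t_def)
            also have "\<dots> \<in> X (Suc i)" using Suc(1) px[OF q] XS[of i] wX[of i "Suc i"] sX[of "Suc i"]
              by (intro subspace_add subspace_scale) blast+
            finally have "t \<in> X (Suc i)" .
            moreover have "br x r \<in> X (Suc i)" using \<open>r \<in> X i\<close> by (rule xX)
            ultimately have "t + br x r \<in> X (Suc i)" using sX subspace_add by blast
            moreover have "br q (w (Suc (Suc i))) - (scale (l q) (w (Suc (Suc i))) + scale (of_nat (Suc (Suc i)) * l (br q x)) (w (Suc i)))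
               = t + br x r"
            proof -
              have e1: "br q (w (Suc i)) = r + (scale (l q) (w (Suc i)) + scale (of_nat (Suc i) * l (br q x)) (w i))"
                and e2: "br (br q x) (w (Suc i)) = t + scale (l (br q x)) (w (Suc i))"
                by (simp_all add: r_def t_def)
              have c: "of_nat (Suc (Suc i)) * l (br q x) = l (br q x) + of_nat (Suc i) * l (br q x)"
                by (simp add: algebra_simps)
              have "br q (w (Suc (Suc i))) = br (br q x) (w (Suc i)) + br x (br q (w (Suc i)))"
                unfolding wS[of "Suc i"] by (rule leibniz)
              also have "\<dots> = (t + scale (l (br q x)) (w (Suc i))) +
                  (br x r + (scale (l q) (w (Suc (Suc i))) + scale (of_nat (Suc i) * l (br q x)) (w (Suc i))))"
                unfolding e1 e2 by (simp only: br_simps wS)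
              finally show ?thesis unfolding c scale_left_distrib by simp
            qed
            ultimately show "br q (w (Suc (Suc i))) - (scale (l q) (w (Suc (Suc i))) + scale (of_nat (Suc (Suc i)) * l (br q x)) (w (Suc i))) \<in> X (Suc i)"
              by simp
          qed
        }
      qed
      obtain m where "X (Suc m) = X m" using ascending_chain_stabilizes[of X, OF sX XS] by metis
      then have "w m \<in> X m" using wX[of m "Suc m"] by simp
      then have ex: "\<exists>m. w m \<in> X m" by blast
      define n where "n = (LEAST m. w m \<in> X m)"
      have n: "w n \<in> X n" "\<And>j. j < n \<Longrightarrow> w j \<notin> X j"
        unfolding n_def using LeastI_ex[OF ex] not_less_Least by blast+
      have "X 0 = W" unfolding X_def using W by (simp add: span_eq_iff)
      then have "n \<noteq> 0" using n(1) v0 by (metis w0)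
      then obtain k where k: "n = Suc k" using not0_implies_Suc by blast
      \<comment> \<open>\<open>S\<close> lowers the filtration by one. As \<open>w n\<close> lies in
        \<open>X n\<close>, its image lies in \<open>X k\<close>, while \<open>C2\<close> computes
        this image as \<open>n * l [p, x]\<close> times \<open>w k\<close>, which is outside
        \<open>X k\<close>.\<close>
      define S where "S y = br p y - scale (l p) y" for y
      have linS: "lin S" by (simp add: S_def lin_def br_simps scale_right_distrib scale_right_diff_distrib mult.commute algebra_simps)
      have "S (w n) \<in> X k"
      proof (rule lin_span_image[OF linS sX _ n(1)[unfolded X_def]])
        fix y assume "y \<in> W \<union> w ` {..<n}"
        then show "S y \<in> X k"
        proof
          assume "y \<in> W"
          then have "S y \<in> W" unfolding S_def using W PW p P' by (intro subspace_diff subspace_scale) auto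
          then show ?thesis using WX by blast
        next
          assume "y \<in> w ` {..<n}"
          then obtain j where j: "j \<le> k" "y = w j" using k by (auto simp: less_Suc_eq_le)
          have "S y \<in> X j" using C1[of j] p by (simp add: S_def j)
          then show ?thesis using Xmono[OF j(1)] by blast
        qed
      qed
      then have "S (w n) - (br p (w n) - (scale (l p) (w n) + scale (of_nat n * l (br p x)) (w k))) \<in> X k"
        unfolding k by (rule subspace_diff[OF sX]) (rule C2[rule_format, OF p])
      then have "scale (of_nat n * l (br p x)) (w k) \<in> X k" by (simp add: S_def)
      then have "of_nat n * l (br p x) = 0"
        using subspace_scale_iff[OF sX] n(2)[of k] k by blast
      then show ?thesis using k by (simp del: of_nat_Suc)
    qed
    \<comment> \<open>The weight space of \<open>l\<close> for \<open>P'\<close>. The vanishing of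
      \<open>l\<close> on \<open>[p, x]\<close> makes it stable under \<open>x\<close>, so an
      eigenvector of \<open>x\<close> in it serves for all of \<open>P\<close>.\<close>
    define U' where "U' = {u \<in> U. \<forall>p\<in>P'. br p u - scale (l p) u \<in> W}"
    have sU': "subspace U'"
    proof -
      have "lin (\<lambda>u. br p u - scale (l p) u)" for p
        by (simp add: lin_def br_simps scale_right_distrib scale_right_diff_distrib mult.commute algebra_simps)
      then have "subspace (U \<inter> (\<Inter>p\<in>P'. {u. br p u - scale (l p) u \<in> W}))"
        by (intro subspace_inter subspace_Int lin_subspace_vimage U W(1))
      also have "U \<inter> (\<Inter>p\<in>P'. {u. br p u - scale (l p) u \<in> W}) = U'" by (auto simp: U'_def)
      finally show ?thesis .
    qed
    have "br p u - scale (l p) u \<in> W" if "u \<in> W" "p \<in> P'" for u p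
      using that PW P'(3) W(1) by (intro subspace_diff subspace_scale) auto
    then have "W \<subseteq> U'" unfolding U'_def using W(2) by auto
    moreover have "v0 \<in> U'" using v0 l by (simp add: U'_def)
    ultimately have WU': "W \<subset> U'" using v0 by blast
    have xU': "br x u \<in> U'" if u: "u \<in> U'" for u
    proof -
      have "br p (br x u) - scale (l p) (br x u) \<in> W" if p: "p \<in> P'" for p
      proof -
        have px: "br p x \<in> P'" using brD p P' by blast
        have "br p (br x u) - scale (l p) (br x u)
          = (br (br p x) u - scale (l (br p x)) u) + br x (br p u - scale (l p) u)"
          using leibniz[of p x u] key[OF p] by (simp add: br_simps)
        also have "\<dots> \<in> W" using u p px PW P'(4) W by (intro subspace_add) (auto simp: U'_def)
        finally show ?thesis .
      qed
      then show ?thesis using u PU P'(4) by (auto simp: U'_def)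
    qed
    obtain v c where v: "v \<in> U'" "v \<notin> W" "br x v - scale c v \<in> W"
      using eigenvector_mod[OF lin_br W(1) sU' WU' xU' PW[OF P'(4)]] by metis
    have "\<exists>d. br p v - scale d v \<in> W" if "p \<in> P" for p
    proof -
      obtain a q where q: "p = q + scale a x" "q \<in> P'"
        using span_insert_mem[OF P'(1)] \<open>p \<in> P\<close> P'(6) by metis
      have "br p v - scale (l q + a * c) v = (br q v - scale (l q) v) + scale a (br x v - scale c v)"
        by (simp add: q br_simps vs_simps)
      also have "\<dots> \<in> W" using v q W by (intro subspace_add subspace_scale) (auto simp: U'_def)
      finally show ?thesis by blast
    qed
    then show ?thesis using v by (auto simp: U'_def)
  qed
qed

text \<open>Nilpotency is assumed on \<open>U\<close> and on \<open>S\<close> itself: the latter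
  feeds the induction, where a maximal proper subalgebra \<open>Q\<close> acts on
  \<open>S / Q\<close>.\<close>

lemma engel_theorem:
  assumes "subalg S" "subspace U" "subspace W" "W \<subset> U"
    and "\<And>p u. p \<in> S \<Longrightarrow> u \<in> U \<Longrightarrow> br p u \<in> U" "\<And>p u. p \<in> S \<Longrightarrow> u \<in> W \<Longrightarrow> br p u \<in> W"
    and "\<And>p u. p \<in> S \<Longrightarrow> u \<in> U \<union> S \<Longrightarrow> \<exists>n. (br p ^^ n) u = 0"
  shows "\<exists>v\<in>U - W. \<forall>p\<in>S. br p v \<in> W"
  using assms
proof (induction "dim S" arbitrary: S U W rule: less_induct)
  case less
  note S = less.prems(1) and U = less.prems(2) and W = less.prems(3,4)
    and SU = less.prems(5) and SW = less.prems(6) and nil = less.prems(7)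
  show ?case
  proof (cases "S \<subseteq> leibniz_kernel")
    case True
    have "br p v \<in> W" if "p \<in> S" for p v using True that br_kernel_left subspace_0[OF W(1)] by auto
    then show ?thesis using W(2) by blast
  next
    case False
    \<comment> \<open>Keeping the kernel part of \<open>S\<close> inside \<open>Q\<close>
      compensates for the missing antisymmetry: \<open>[x, q]\<close> and \<open>- [q, x]\<close>
      then agree modulo \<open>Q\<close>, and \<open>[x, x]\<close> lies in
      \<open>Q\<close>.\<close>
    define D where "D = S \<inter> leibniz_kernel"
    have D: "subalg D" "D \<subset> S"
      using False S subspace_inter[OF subalgD(1)[OF S] subspace_kernel] subspace_0[OF subspace_kernel]
      by (auto simp: D_def subalg_def br_kernel_left subspace_0)
    obtain Q where Q: "subalg Q \<and> D \<subseteq> Q \<and> Q \<subset> S"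
      and max: "\<And>V. (subalg V \<and> D \<subseteq> V \<and> V \<subset> S) \<and> Q \<subseteq> V \<Longrightarrow> V = Q"
      using maximal_subspace_exists[of "\<lambda>Q. subalg Q \<and> D \<subseteq> Q \<and> Q \<subset> S" D] D subalgD(1) by blast
    have sQ: "subspace Q" and sS: "subspace S" using Q S subalgD(1) by blast+
    have dQ: "dim Q < dim S" using dim_strict sQ sS Q by blast
    \<comment> \<open>A vector of \<open>S / Q\<close> killed by \<open>Q\<close> is an element
      \<open>x\<close> normalizing \<open>Q\<close>; by maximality \<open>x\<close> and
      \<open>Q\<close> span \<open>S\<close>.\<close>
    have "\<exists>x\<in>S - Q. \<forall>q\<in>Q. br q x \<in> Q"
    proof (rule less.hyps[OF dQ _ sS sQ])
      show "\<exists>n. (br p ^^ n) u = 0" if "p \<in> Q" "u \<in> S \<union> Q" for p u using nil[of p u] that Q by blast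
    qed (use Q S in \<open>auto simp: subalg_def\<close>)
    then obtain x where x: "x \<in> S" "x \<notin> Q" "\<And>q. q \<in> Q \<Longrightarrow> br q x \<in> Q" by blast
    have psiQ: "psi a b \<in> Q" if "a \<in> S" "b \<in> S" for a b
    proof -
      have "psi a b \<in> S" unfolding psi_def using that S by (intro subspace_add sS subalgD(2)) 
      then show ?thesis using psi_in_kernel Q by (auto simp: D_def)
    qed
    have xQ: "br x q \<in> Q" if "q \<in> Q" for q
      unfolding br_flip[of x q] using x that Q by (intro subspace_diff sQ psiQ) auto
    have xx: "br x x \<in> Q"
    proof -
      have "br x x \<in> D" using x S br_self_in_kernel by (auto simp: D_def subalg_def)
      then show ?thesis using Q by blast
    qed
    have "span (insert x Q) = S"
    proof (rule ccontr)
      assume ne: "span (insert x Q) \<noteq> S"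
      have sub: "span (insert x Q) \<subseteq> S" using x Q by (intro span_minimal sS) auto
      have "br a b \<in> Q" if ab: "a \<in> span (insert x Q)" "b \<in> span (insert x Q)" for a b
      proof -
        obtain c q where a: "a = q + scale c x" "q \<in> Q" using span_insert_mem[OF sQ ab(1)] .
        obtain c' q' where b: "b = q' + scale c' x" "q' \<in> Q" using span_insert_mem[OF sQ ab(2)] .
        have "br q q' \<in> Q" using a b Q subalgD(2) by blast
        moreover have "br a b = (br q q' + scale c' (br q x)) + (scale c (br x q') + scale (c * c') (br x x))"
          by (simp add: a b br_simps scale_right_distrib mult.commute)
        ultimately show ?thesis using a b x xQ xx by (auto intro!: subspace_add subspace_scale sQ)
      qed
      then have "subalg (span (insert x Q))" unfolding subalg_def using span_superset by blast
      then have "span (insert x Q) = Q"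
        using max[of "span (insert x Q)"] sub ne Q span_superset[of "insert x Q"] by blast
      then show False using x span_superset[of "insert x Q"] by blast
    qed
    note S_eq = this
    have "\<exists>v\<in>U - W. \<forall>q\<in>Q. br q v \<in> W"
    proof (rule less.hyps[OF dQ _ U W])
      show "\<exists>n. (br p ^^ n) u = 0" if "p \<in> Q" "u \<in> U \<union> Q" for p u using nil[of p u] that Q by blast
    qed (use Q SU SW in blast)+
    then obtain v0 where v0: "v0 \<in> U" "v0 \<notin> W" "\<And>q. q \<in> Q \<Longrightarrow> br q v0 \<in> W" by blast
    define U' where "U' = {u \<in> U. \<forall>q\<in>Q. br q u \<in> W}"
    have xU': "br x u \<in> U'" if u: "u \<in> U'" for u
    proof -
      have "br q (br x u) \<in> W" if q: "q \<in> Q" for q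
      proof -
        have "br (br q x) u \<in> W" "br x (br q u) \<in> W" using u x q SW by (auto simp: U'_def)
        then show ?thesis unfolding leibniz[of q x u] by (rule subspace_add[OF W(1)])
      qed
      then show ?thesis using u SU x(1) by (auto simp: U'_def)
    qed
    have ex: "\<exists>n. (br x ^^ n) v0 \<in> W" using nil[of x v0] x(1) v0(1) subspace_0[OF W(1)] by (metis UnI1)
    define n where "n = (LEAST n. (br x ^^ n) v0 \<in> W)"
    have n: "(br x ^^ n) v0 \<in> W" "\<And>j. j < n \<Longrightarrow> (br x ^^ j) v0 \<notin> W"
      unfolding n_def using LeastI_ex[OF ex] not_less_Least by blast+
    then obtain k where k: "n = Suc k" using v0 by (cases n) auto
    define v where "v = (br x ^^ k) v0"
    have v: "v \<notin> W" "br x v \<in> W" using n(1) n(2)[of k] by (simp_all add: v_def k)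
    have "v0 \<in> U'" using v0 by (simp add: U'_def)
    then have "v \<in> U'" unfolding v_def using xU' by (rule funpow_invariant[rotated])
    have "br p v \<in> W" if "p \<in> S" for p
    proof -
      obtain c q where q: "p = q + scale c x" "q \<in> Q"
        using span_insert_mem[OF sQ, of p x] \<open>p \<in> S\<close> S_eq by metis
      have "br q v \<in> W" using \<open>v \<in> U'\<close> q by (simp add: U'_def)
      then show ?thesis unfolding q br_simps using v by (intro subspace_add subspace_scale W(1))
    qed
    then show ?thesis using v \<open>v \<in> U'\<close> by (auto simp: U'_def)
  qed
qed

text \<open>Left multiplication is a derivation. Induction on \<open>i + j\<close> replaces the
  binomial expansion, since each application lowers one of the two exponents.\<close>

lemma funpow_derivation:
  "(br x ^^ i) a = 0 \<Longrightarrow> (br x ^^ j) b = 0 \<Longrightarrow> (br x ^^ (i + j)) (br a b) = 0"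
proof (induction "i + j" arbitrary: i j a b)
  case 0
  then show ?case by (simp add: br_simps)
next
  case (Suc n)
  note lin = lin_funpow[OF lin_br]
  show ?case
  proof (cases "i = 0 \<or> j = 0")
    case True
    then have "a = 0 \<or> b = 0" using Suc.prems by auto
    then show ?thesis using lin_0[OF lin] by (auto simp: br_simps)
  next
    case False
    then obtain i' j' where ij: "i = Suc i'" "j = Suc j'" by (metis not0_implies_Suc)
    have 1: "(br x ^^ (i' + j)) (br (br x a) b) = 0"
      using Suc.hyps(1)[of i' j "br x a" b] Suc.hyps(2) Suc.prems ij by (simp add: funpow_swap1)
    have 2: "(br x ^^ (i + j')) (br a (br x b)) = 0"
      using Suc.hyps(1)[of i j' a "br x b"] Suc.hyps(2) Suc.prems ij by (simp add: funpow_swap1)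
    have "(br x ^^ (i + j)) (br a b) = (br x ^^ (i' + j)) (br x (br a b))"
      by (simp add: ij funpow_swap1)
    also have "\<dots> = 0" unfolding leibniz[of x a b] lin_add[OF lin] using 1 2 ij by simp
    finally show ?thesis .
  qed
qed

text \<open>The null component \<open>Z\<close> is a subalgebra by \<open>funpow_derivation\<close>.
  Once the images of the powers stabilize, every \<open>y\<close> differs from an element of such an
  image by one of \<open>Z\<close>.\<close>

lemma fitting_decomposition:
  assumes Y: "subalg Y" and x: "x \<in> Y" and S: "\<And>y. y \<in> Y \<Longrightarrow> br x y \<in> S"
  defines "Z \<equiv> {y \<in> Y. \<exists>n. (br x ^^ n) y = 0}"
  shows "subalg Z" "Y \<subseteq> sumset Z S"
proof -
  note lin = lin_funpow[OF lin_br]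
  have up: "(br x ^^ (n + m)) y = 0" if "(br x ^^ n) y = 0" for n m y
    using that by (subst add.commute) (simp add: funpow_add lin_0[OF lin])
  show "subalg Z" unfolding subalg_def
  proof (intro conjI ballI subspaceI)
    show "0 \<in> Z" using subspace_0[OF subalgD(1)[OF Y]] by (auto simp: Z_def intro: exI[of _ 0])
  next
    fix a b assume "a \<in> Z" "b \<in> Z"
    then obtain n m where *: "a \<in> Y" "b \<in> Y" "(br x ^^ n) a = 0" "(br x ^^ m) b = 0" by (auto simp: Z_def)
    have "(br x ^^ (n + m)) (a + b) = 0"
      using up[OF *(3), of m] up[OF *(4), of n] by (simp add: lin_add[OF lin] add.commute)
    then show "a + b \<in> Z" using * subspace_add[OF subalgD(1)[OF Y]] by (auto simp: Z_def)
    show "br a b \<in> Z" using * funpow_derivation[OF *(3,4)] subalgD(2)[OF Y] by (auto simp: Z_def)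
  next
    fix c a assume "a \<in> Z"
    then show "scale c a \<in> Z" using subspace_scale[OF subalgD(1)[OF Y]]
      by (auto simp: Z_def lin_scale[OF lin])
  qed
  define X where "X n = (br x ^^ n) ` Y" for n
  have sX: "subspace (X n)" for n unfolding X_def by (intro lin_subspace_image lin subalgD Y)
  have dec: "X (Suc n) \<subseteq> X n" for n
    unfolding X_def using subalgD(2)[OF Y x] by (auto simp: funpow_swap1)
  obtain n where n: "X (Suc n) = X n" using descending_chain_stabilizes[of X, OF sX dec] by metis
  have Xn: "X (n + m) = X n" for m
  proof (induction m)
    case (Suc m)
    have "X (Suc (n + m)) = br x ` X (n + m)" by (auto simp: X_def)
    also have "\<dots> = X (Suc n)" unfolding Suc by (auto simp: X_def)
    finally show ?case using n by simp
  qed simp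
  \<comment> \<open>The exponent must be positive, so that an element of the image of the power is a
    product \<open>[x, y]\<close> and lies in \<open>S\<close>.\<close>
  define k where "k = Suc n"
  show "Y \<subseteq> sumset Z S"
  proof
    fix y assume y: "y \<in> Y"
    have "(br x ^^ k) y \<in> X (k + k)" using Xn[of 1] Xn[of "k + 1"] y by (auto simp: k_def X_def add_ac)
    then obtain t where t: "t \<in> Y" "(br x ^^ k) y = (br x ^^ k) ((br x ^^ k) t)"
      by (auto simp: X_def funpow_add)
    have tY: "(br x ^^ m) t \<in> Y" for m using subalgD(2)[OF Y x] t(1) by (rule funpow_invariant)
    have "(br x ^^ k) (y - (br x ^^ k) t) = 0" using t by (simp only: lin_diff[OF lin] diff_self)
    then have "y - (br x ^^ k) t \<in> Z" using y tY subspace_diff[OF subalgD(1)[OF Y]] by (auto simp: Z_def)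
    moreover have "(br x ^^ k) t \<in> S" using S[OF tY[of n]] by (simp add: k_def)
    ultimately show "y \<in> sumset Z S" by force
  qed
qed

end

section \<open>Minimal nonsolvable subalgebras\<close>

context left_central_leibniz_algebra begin

notation scale (infixr "*s" 75)

lemma br_kernel_right: assumes "c \<in> leibniz_kernel" shows "br a c = 0"
proof -
  have "br a c \<in> {0}"
    by (rule lin_span_image[OF lin_br subspace_single_0 _ assms[unfolded leibniz_kernel_def]])
       (auto simp: left_central)
  then show ?thesis by simp
qed

lemma br_psi: "br a (psi b c) = 0" "br (psi b c) a = 0"
  by (simp_all add: br_kernel_left br_kernel_right psi_in_kernel)

text \<open>Left centrality enters here: \<open>[m, psi a b] = 0\<close>, and left multiplication by
  \<open>m\<close> differentiates both arguments of \<open>psi\<close>.\<close>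

lemma psi_invariant: "psi (br m a) b = - psi a (br m b)"
proof -
  have "0 = br m (psi a b)" by (simp add: br_psi)
  also have "\<dots> = psi (br m a) b + psi a (br m b)"
    by (simp only: psi_def br_simps leibniz[of m a b] leibniz[of m b a]) (simp add: algebra_simps)
  finally show ?thesis by (simp add: eq_neg_iff_add_eq_0)
qed

lemma subspace_radical: "subspace radical"
  by (intro subspaceI) (auto simp: radical_def psi_simps)

lemma kernel_subset_radical: "leibniz_kernel \<subseteq> radical"
  by (auto simp: radical_def psi_def br_kernel_left br_kernel_right)

lemma ideal_radical: "ideal_of UNIV radical"
proof (rule ideal_of_left[OF subalg_UNIV subspace_radical])
  show "br y s \<in> radical" if "s \<in> radical" for y s
    using that by (auto simp: radical_def psi_invariant)
qed (use kernel_subset_radical in auto)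

lemma eqm_br:
  assumes S: "ideal_of Y S" and Y: "subalg Y" and "a \<in> Y" "b \<in> Y" "a' \<in> Y" "b' \<in> Y"
    and "a \<approx>[S] a'" "b \<approx>[S] b'"
  shows "br a b \<approx>[S] br a' b'"
proof -
  note sS = ideal_ofD(1)[OF S]
  have "br (a - a') b + br a' (b - b') \<in> S"
    using assms by (intro subspace_add sS ideal_ofD[OF S]) (simp_all add: eqm_iff[OF sS])
  moreover have "br a b - br a' b' = br (a - a') b + br a' (b - b')" by (simp add: br_simps)
  ultimately show ?thesis by (simp add: eqm_iff[OF sS])
qed

end

text \<open>\<open>S\<close> takes the part of the solvable radical of \<open>Y\<close>. Modulo
  \<open>S\<close> the algebra \<open>Y\<close> is simple, and its proper subalgebras are solvable
  modulo \<open>R\<close>.\<close>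

locale minimal_nonsolvable = left_central_leibniz_algebra +
  fixes R Y S :: "'a set"
  assumes ideal_R: "ideal_of UNIV R" and kernel_R: "leibniz_kernel \<subseteq> R"
    and subalg_Y: "subalg Y" and nonsolv: "\<not> solv R Y"
    and minimal: "subalg Z \<Longrightarrow> Z \<subset> Y \<Longrightarrow> solv R Z"
    and ideal_S: "ideal_of Y S" and RS: "R \<inter> Y \<subseteq> S" and solv_S: "solv R S"
    and max_S: "ideal_of Y S' \<Longrightarrow> solv R S' \<Longrightarrow> S \<subseteq> S' \<Longrightarrow> S' = S"
begin

lemmas sY = subalgD(1)[OF subalg_Y] and Ybr = subalgD(2)[OF subalg_Y]
  and sS = ideal_ofD(1)[OF ideal_S] and SY = ideal_ofD(2)[OF ideal_S]
  and Sl = ideal_ofD(3)[OF ideal_S] and Sr = ideal_ofD(4)[OF ideal_S]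

lemmas eqbr = eqm_br[OF ideal_S subalg_Y]

lemma S_neq_Y: "S \<noteq> Y"
  using solv_S nonsolv by blast

lemma kernel_S: "leibniz_kernel \<inter> Y \<subseteq> S"
  using kernel_R RS by blast

lemma psi_S: "a \<in> Y \<Longrightarrow> b \<in> Y \<Longrightarrow> psi a b \<in> S"
  using kernel_S psi_in_kernel[of a b] Ybr[of a b] Ybr[of b a] subspace_add[OF sY]
  unfolding psi_def by blast

lemma br_self_S: "a \<in> Y \<Longrightarrow> br a a \<in> S"
  using kernel_S br_self_in_kernel Ybr by blast

lemma flip_S: "a \<in> Y \<Longrightarrow> b \<in> Y \<Longrightarrow> br a b \<approx>[S] - br b a"
  using psi_S by (simp add: eqm_iff[OF sS] psi_def)

text \<open>A proper ideal is a proper subalgebra, hence solvable modulo \<open>R\<close>, so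
  maximality of \<open>S\<close> leaves no room above \<open>S\<close>.\<close>

lemma larger_ideal: "ideal_of Y T \<Longrightarrow> S \<subseteq> T \<Longrightarrow> T \<noteq> S \<Longrightarrow> T = Y"
  using max_S minimal ideal_of_subalg ideal_ofD(2) by blast

text \<open>A proper supplement \<open>Z\<close> of \<open>S\<close> would be solvable modulo
  \<open>R\<close>, and then so would \<open>Y\<close>.\<close>

lemma frattini:
  assumes "subalg Z" "Z \<subseteq> Y" "Y \<subseteq> sumset Z S" shows "Z = Y"
  using solv_plus[OF assms(1,2) _ ideal_S solv_S RS assms(3)] minimal[OF assms(1)] assms(2) nonsolv
  by blast

text \<open>
  A maximal subalgebra \<open>P\<close> is solvable, so Lie's theorem provides an eigenvector in \<open>Y / P\<close>;
  by maximality of \<open>P\<close> it spans this quotient.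
\<close>

lemma maximal_subalgebra:
  obtains P v where "subalg P" "S \<subset> P" "P \<subset> Y" "v \<in> Y" "v \<notin> P" "Y = span (insert v P)"
    "\<And>p. p \<in> P \<Longrightarrow> \<exists>c. br p v - c *s v \<in> P" "solv R P"
proof -
  obtain P where P: "subalg P \<and> S \<subseteq> P \<and> P \<subset> Y"
    and max: "\<And>V. (subalg V \<and> S \<subseteq> V \<and> V \<subset> Y) \<and> P \<subseteq> V \<Longrightarrow> V = P"
    using maximal_subspace_exists[of "\<lambda>Q. subalg Q \<and> S \<subseteq> Q \<and> Q \<subset> Y" S]
      ideal_of_subalg[OF ideal_S] S_neq_Y SY subalgD(1) by blast
  have sP: "subspace P" and PY: "P \<subseteq> Y" and SP: "S \<subseteq> P" and aP: "subalg P" using P subalgD(1) by auto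
  have solvP: "solv R P" using minimal P by blast
  then obtain n where n: "dser P n \<subseteq> R" by (auto simp: solv_def)
  have "\<exists>v\<in>Y - P. \<forall>p\<in>P. \<exists>c. br p v - c *s v \<in> P"
  proof (rule lie_theorem[OF aP sY sP])
    show "br d u \<in> P" if "d \<in> dser P n" "u \<in> Y" for d u
    proof -
      have "d \<in> R" "d \<in> Y" using that n dser_subset[OF aP, of n] PY by blast+
      then have "br d u \<in> R \<inter> Y" using ideal_ofD(4)[OF ideal_R] Ybr that(2) by blast
      then show ?thesis using RS SP by blast
    qed
  qed (use P Ybr subalgD(2) in blast)+
  then obtain v where v: "v \<in> Y" "v \<notin> P" "\<And>p. p \<in> P \<Longrightarrow> \<exists>c. br p v - c *s v \<in> P" by blast
  define T where "T = span (insert v P)"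
  have TY: "T \<subseteq> Y" unfolding T_def using v PY by (intro span_minimal sY) auto
  have PT: "P \<subseteq> T" "v \<in> T" unfolding T_def by (auto intro: span_base)
  have sT: "subspace T" by (simp add: T_def)
  have pv: "br p v \<in> T" if p: "p \<in> P" for p
  proof -
    obtain c where "br p v - c *s v \<in> P" using v p by blast
    then have "(br p v - c *s v) + c *s v \<in> T" using PT by (intro subspace_add subspace_scale sT) auto
    then show ?thesis by simp
  qed
  have vp: "br v p \<in> T" if p: "p \<in> P" for p
    unfolding br_flip[of v p] using pv[OF p] psi_S[of v p] v(1) p PY SP PT
    by (intro subspace_diff sT) auto
  have "br a b \<in> T" if ab: "a \<in> T" "b \<in> T" for a b
  proof -
    obtain c q where a: "a = q + c *s v" "q \<in> P" using span_insert_mem[OF sP ab(1)[unfolded T_def]] .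
    obtain c' q' where b: "b = q' + c' *s v" "q' \<in> P" using span_insert_mem[OF sP ab(2)[unfolded T_def]] .
    have "br q q' \<in> T" using a b aP subalgD(2) PT by blast
    moreover have "br v v \<in> T" using br_self_S v(1) SP PT by blast
    moreover have "br a b = (br q q' + c' *s br q v) + (c *s br v q' + (c * c') *s br v v)"
      by (simp add: a b br_simps scale_right_distrib mult.commute)
    ultimately show ?thesis using a b pv vp by (simp add: subspace_add subspace_scale sT)
  qed
  then have "subalg T" using sT by (simp add: subalg_def)
  then have TY: "T = Y" using max[of T] TY PT SP v by blast
  \<comment> \<open>Otherwise \<open>Y / S\<close> is spanned by \<open>v\<close> alone; since
    \<open>[v, v]\<close> lies in \<open>S\<close>, it is abelian, and \<open>Y\<close> would be
    solvable modulo \<open>R\<close>.\<close>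
  have "S \<noteq> P"
  proof
    assume SP: "S = P"
    have "br a b \<in> S" if ab: "a \<in> Y" "b \<in> Y" for a b
    proof -
      obtain c q where a: "a = q + c *s v" "q \<in> S"
        using span_insert_mem[OF sP ab(1)[folded TY, unfolded T_def]] SP by metis
      obtain c' q' where b: "b = q' + c' *s v" "q' \<in> S"
        using span_insert_mem[OF sP ab(2)[folded TY, unfolded T_def]] SP by metis
      have "br a b = br q b + (c *s br v q' + (c * c') *s br v v)"
        by (simp add: a b br_simps scale_right_distrib mult.commute)
      also have "\<dots> \<in> S" using a b ab v(1) Sl Sr br_self_S by (intro subspace_add subspace_scale sS) auto
      finally show ?thesis .
    qed
    then have "dser Y 1 \<subseteq> S" unfolding One_nat_def by (intro dser_Suc_subset sS) simp
    then show False using solv_step solv_S nonsolv by blast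
  qed
  then have "S \<subset> P" using SP by blast
  moreover have "P \<subset> Y" using P by blast
  ultimately show thesis by (rule that[OF aP _ _ v(1,2) TY[symmetric, unfolded T_def] v(3) solvP])
qed

end

section \<open>Weights of a maximal subalgebra\<close>

locale minimal_nonsolvable_borel = minimal_nonsolvable +
  fixes P :: "'a set" and v :: 'a
  assumes subalg_P: "subalg P" and SP: "S \<subset> P" and PY: "P \<subset> Y" and v_Y: "v \<in> Y" and v_P: "v \<notin> P"
    and Y_eq: "Y = span (insert v P)" and weight_v: "p \<in> P \<Longrightarrow> \<exists>c. br p v - c *s v \<in> P"
    and solv_P: "solv R P"
begin

lemmas sP = subalgD(1)[OF subalg_P] and Pbr = subalgD(2)[OF subalg_P]

lemma PY': "p \<in> P \<Longrightarrow> p \<in> Y" and SP': "s \<in> S \<Longrightarrow> s \<in> P"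
  using PY SP by auto

lemma Y_cases: assumes "y \<in> Y" obtains c p where "y = p + c *s v" "p \<in> P"
  using span_insert_mem[OF sP assms[unfolded Y_eq]] .

text \<open>The character by which \<open>P\<close> acts on the line \<open>Y / P\<close>.\<close>

definition chi :: "'a \<Rightarrow> complex" where
  "chi p = (SOME c. br p v - c *s v \<in> P)"

lemma chi: "p \<in> P \<Longrightarrow> br p v - chi p *s v \<in> P"
  unfolding chi_def using weight_v by (rule someI_ex)

lemma multiple_v: "c *s v \<in> P \<Longrightarrow> c = 0"
  using subspace_scale_iff[OF sP, of c v] v_P by blast

lemma chi_unique: assumes "p \<in> P" "br p v - c *s v \<in> P" shows "chi p = c"
proof -
  have "(br p v - c *s v) - (br p v - chi p *s v) \<in> P"
    using subspace_diff[OF sP assms(2) chi[OF assms(1)]] .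
  then have "(chi p - c) *s v \<in> P" by (simp add: vs_simps)
  then show ?thesis using multiple_v by fastforce
qed

lemma chi_add: assumes "a \<in> P" "b \<in> P" shows "chi (a + b) = chi a + chi b"
proof (rule chi_unique)
  show "a + b \<in> P" using assms sP subspace_add by blast
  have "(br a v - chi a *s v) + (br b v - chi b *s v) \<in> P" using assms chi by (intro subspace_add sP)
  then show "br (a + b) v - (chi a + chi b) *s v \<in> P" by (simp add: br_simps vs_simps)
qed

lemma chi_scale: assumes "a \<in> P" shows "chi (c *s a) = c * chi a"
proof (rule chi_unique)
  show "c *s a \<in> P" using assms sP subspace_scale by blast
  have "c *s (br a v - chi a *s v) \<in> P" using assms chi by (intro subspace_scale sP)
  then show "br (c *s a) v - (c * chi a) *s v \<in> P" by (simp add: br_simps vs_simps)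
qed

lemma chi_S: assumes "s \<in> S" shows "chi s = 0"
  using assms Sr[OF v_Y assms] SP' by (intro chi_unique) auto

lemma chi_br: assumes "a \<in> P" "b \<in> P" shows "chi (br a b) = 0"
proof (rule chi_unique)
  show "br a b \<in> P" using assms Pbr by blast
  define a' b' where "a' = br a v - chi a *s v" and "b' = br b v - chi b *s v"
  have P: "a' \<in> P" "b' \<in> P" using assms chi by (simp_all add: a'_def b'_def)
  have "br (br a b) v = br a (br b v) - br b (br a v)" using leibniz[of a b v] by simp
  also have "\<dots> = br a (b' + chi b *s v) - br b (a' + chi a *s v)" by (simp add: a'_def b'_def)
  also have "\<dots> = (br a b' - br b a') + (chi b *s a' - chi a *s b')"
    unfolding br_simps by (simp add: a'_def b'_def vs_simps mult.commute)
  also have "\<dots> \<in> P" using assms P Pbr by (intro subspace_add subspace_diff subspace_scale sP)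
  finally show "br (br a b) v - 0 *s v \<in> P" by simp
qed

text \<open>Any \<open>v'\<close> congruent to \<open>v\<close> modulo \<open>P\<close> spans
  \<open>Y\<close> together with \<open>P\<close>. This freedom allows a representative adapted to
  the candidate ideal.\<close>

lemma ideal_insert:
  assumes S: "U \<subseteq> Y" "S \<subseteq> U" "subspace U"
    and p: "\<And>p u. p \<in> P \<Longrightarrow> u \<in> U \<Longrightarrow> br p u \<in> U" and v: "\<And>u. u \<in> U \<Longrightarrow> br v' u \<in> U"
    and v': "v - v' \<in> P"
  shows "ideal_of Y U"
proof (rule ideal_of_left[OF subalg_Y assms(3,1)])
  show "leibniz_kernel \<inter> Y \<subseteq> U" using kernel_S S by blast
  fix y s assume y: "y \<in> Y" and s: "s \<in> U"
  obtain c q where q: "y = q + c *s v" "q \<in> P" using Y_cases[OF y] .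
  define q' where "q' = q + c *s (v - v')"
  have y: "y = q' + c *s v'" by (simp add: q q'_def vs_simps)
  have "q' \<in> P" unfolding q'_def using q v' by (intro subspace_add subspace_scale sP)
  then have "br q' s + c *s br v' s \<in> U" using p v s by (intro subspace_add subspace_scale assms(3))
  then show "br y s \<in> U" by (simp add: y br_simps)
qed

lemma eigenvector_e:
  obtains e mu where "e \<in> P" "e \<notin> S" "\<And>p. p \<in> P \<Longrightarrow> br p e \<approx>[S] mu p *s e"
proof -
  obtain n where n: "dser P n \<subseteq> R" using solv_P by (auto simp: solv_def)
  have "\<exists>e\<in>P - S. \<forall>p\<in>P. \<exists>c. br p e - c *s e \<in> S"
  proof (rule lie_theorem[OF subalg_P sP sS])
    show "br d u \<in> S" if "d \<in> dser P n" "u \<in> P" for d u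
    proof -
      have "d \<in> R" "d \<in> P" using that n dser_subset[OF subalg_P, of n] by blast+
      then have "br d u \<in> R" "br d u \<in> Y" using ideal_ofD(4)[OF ideal_R] Ybr that(2) PY' by blast+
      then show ?thesis using RS by blast
    qed
  qed (use SP Pbr PY' Sl in blast)+
  then obtain e where e: "e \<in> P" "e \<notin> S" "\<forall>p\<in>P. \<exists>c. br p e - c *s e \<in> S" by blast
  then obtain mu where "\<forall>p\<in>P. br p e - mu p *s e \<in> S" by metis
  then show thesis using that[of e mu] e by (simp add: eqm_iff[OF sS])
qed

end

section \<open>The string of \<open>v\<close> through an eigenvector of \<open>P\<close>\<close>

locale minimal_nonsolvable_weight = minimal_nonsolvable_borel +
  fixes e :: 'a and mu :: "'a \<Rightarrow> complex"
  assumes e_P: "e \<in> P" and e_S: "e \<notin> S" and mu: "p \<in> P \<Longrightarrow> br p e \<approx>[S] mu p *s e"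
begin

lemma e_Y: "e \<in> Y" using PY' e_P .

lemma multiple_e: "c *s e \<in> S \<Longrightarrow> c = 0"
  using subspace_scale_iff[OF sS, of c e] e_S by blast

text \<open>The character \<open>chi\<close> vanishes on products, but \<open>[p, e]\<close> is
  \<open>mu p\<close> times \<open>e\<close> modulo \<open>S\<close>.\<close>

lemma mu_chi_e: assumes p: "p \<in> P" shows "mu p * chi e = 0"
proof -
  define s where "s = br p e - mu p *s e"
  have s: "s \<in> S" using mu[OF p] by (simp add: s_def eqm_iff[OF sS])
  have "0 = chi (br p e)" using chi_br p e_P by simp
  also have "\<dots> = chi (s + mu p *s e)" by (simp add: s_def)
  also have "\<dots> = chi s + mu p * chi e"
    using chi_add[of s "mu p *s e"] chi_scale[OF e_P] subspace_scale[OF sP e_P] SP'[OF s] by simp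
  finally show ?thesis using chi_S[OF s] by simp
qed

text \<open>If \<open>chi e\<close> were nonzero, \<open>mu\<close> would vanish and
  \<open>e\<close> would commute with \<open>P\<close> modulo \<open>S\<close>. The eigenvector
  \<open>v'\<close> of \<open>e\<close> would then be a common eigenvector of \<open>P\<close>, and
  \<open>v'\<close> with \<open>S\<close> would span an ideal strictly above \<open>S\<close> that
  misses \<open>e\<close>.\<close>

lemma chi_e: "chi e = 0"
proof (rule ccontr)
  define k where "k = chi e"
  assume "chi e \<noteq> 0"
  then have k: "k \<noteq> 0" by (simp add: k_def)
  have pe: "br p e \<in> S" if "p \<in> P" for p
    using mu[OF that] mu_chi_e[OF that] \<open>chi e \<noteq> 0\<close> by (simp add: eqm_iff[OF sS])
  have ep: "br e p \<in> S" if "p \<in> P" for p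
    unfolding br_flip[of e p] using psi_S[OF e_Y PY'[OF that]] pe[OF that] by (intro subspace_diff sS)
  define p0 where "p0 = br e v - k *s v"
  have p0: "p0 \<in> P" using chi[OF e_P] by (simp add: p0_def k_def)
  \<comment> \<open>The correction absorbs the component \<open>p0\<close> of \<open>[e, v]\<close>
    in \<open>P\<close>: as \<open>[e, p0]\<close> lies in \<open>S\<close>, the result is an
    eigenvector of \<open>e\<close> for \<open>k\<close> modulo \<open>S\<close>.\<close>
  define v' where "v' = v + inverse k *s p0"
  have v'_Y: "v' \<in> Y" unfolding v'_def using p0 PY' v_Y by (intro subspace_add subspace_scale sY)
  have v'_P: "v' \<notin> P"
  proof
    assume "v' \<in> P"
    then have "v' - inverse k *s p0 \<in> P" using p0 by (intro subspace_diff subspace_scale sP)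
    then show False using v_P by (simp add: v'_def)
  qed
  have ev': "br e v' \<approx>[S] k *s v'"
  proof -
    have "br e v' - k *s v' = inverse k *s br e p0" using k by (simp add: v'_def p0_def br_simps vs_simps)
    then show ?thesis using ep[OF p0] by (simp add: eqm_iff[OF sS] subspace_scale[OF sS])
  qed
  have pv': "br p v' \<approx>[S] chi p *s v'" if p: "p \<in> P" for p
  proof -
    define q where "q = br p v' - chi p *s v'"
    have "q = (br p v - chi p *s v) + inverse k *s (br p p0 - chi p *s p0)"
      by (simp add: q_def v'_def br_simps vs_simps mult.commute)
    also have "\<dots> \<in> P"
      by (intro subspace_add[OF sP chi[OF p]] subspace_scale[OF sP] subspace_diff[OF sP Pbr[OF p p0]] p0)
    finally have q: "q \<in> P" .
    have "br e (br p v') = br (br e p) v' + br p (br e v')" by (rule leibniz)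
    also have "\<dots> \<approx>[S] 0 + br p (k *s v')"
      using ep[OF p] v'_Y p PY' Ybr e_Y
      by (intro eqm_add eqbr ev' eqm_refl) (auto simp: eqm_0[OF sS] Sr intro: subspace_scale[OF sY])
    finally have 1: "br e (br p v') \<approx>[S] k *s br p v'" by (simp add: br_simps)
    have "br e (br p v') = chi p *s br e v' + br e q" by (simp add: q_def br_simps)
    also have "\<dots> \<approx>[S] chi p *s (k *s v') + 0"
      by (intro eqm_add eqm_scale ev') (simp add: eqm_0[OF sS] ep[OF q])
    finally have "k *s br p v' \<approx>[S] k *s (chi p *s v')"
      using eqm_trans[OF eqm_sym[OF 1]] by (simp add: mult.commute)
    then have "k *s (br p v' - chi p *s v') \<in> S" by (simp add: eqm_iff[OF sS] vs_simps)
    then show ?thesis using subspace_scale_iff[OF sS k] by (simp add: eqm_iff[OF sS])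
  qed
  define T where "T = span (insert v' S)"
  have ST: "S \<subseteq> T" "v' \<in> T" and sT: "subspace T" by (auto simp: T_def intro: span_base)
  have TY: "T \<subseteq> Y" unfolding T_def using v'_Y SY by (intro span_minimal sY) auto
  have left: "br y t \<in> T" if y: "y \<in> Y" and t: "t \<in> T" and yv: "br y v' \<in> T" for y t
  proof -
    obtain c s where "t = s + c *s v'" "s \<in> S" using span_insert_mem[OF sS t[unfolded T_def]] .
    then show ?thesis using yv Sl[OF y] ST by (auto simp: br_simps intro!: subspace_add subspace_scale sT)
  qed
  have "ideal_of Y T"
  proof (rule ideal_insert[OF TY ST(1) sT])
    show "v - v' \<in> P" using p0 subspace_scale[OF sP] subspace_neg[OF sP] by (simp add: v'_def)
    show "br v' u \<in> T" if "u \<in> T" for u using left[OF v'_Y that] br_self_S[OF v'_Y] ST by blast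
    show "br p u \<in> T" if "p \<in> P" "u \<in> T" for p u
    proof (rule left[OF PY'[OF that(1)] that(2)])
      have "(br p v' - chi p *s v') + chi p *s v' \<in> T"
        using pv'[OF that(1)] ST by (intro subspace_add subspace_scale sT) (auto simp: eqm_iff[OF sS])
      then show "br p v' \<in> T" by simp
    qed
  qed
  then have "T = Y" using larger_ideal ST v'_P SP' by blast
  then obtain c s where "e = s + c *s v'" "s \<in> S" using span_insert_mem[OF sS, of e v'] e_Y by (metis T_def)
  then have s: "e - s = c *s v'" "s \<in> P" using SP' by auto
  then have "c *s v' \<in> P" using e_P subspace_diff[OF sP] by metis
  then have "c = 0" using v'_P subspace_scale_iff[OF sP] by blast
  then show False using e_S \<open>e = s + c *s v'\<close> \<open>s \<in> S\<close> by simp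
qed

text \<open>In the model \<open>sl\<^sub>2\<close> with \<open>P\<close> spanned by \<open>e\<close>
  and \<open>h\<close>, the vector \<open>v\<close> is a lowering element and this is the string
  \<open>e\<close>, \<open>h\<close>, \<open>f\<close> up to scalars.\<close>

definition E :: "nat \<Rightarrow> 'a" where "E j = (br v ^^ j) e"

definition U :: "nat \<Rightarrow> 'a set" where "U j = span (S \<union> E ` {..<j})"

lemma E_0: "E 0 = e" and E_Suc: "E (Suc j) = br v (E j)"
  by (simp_all add: E_def)

lemma E_Y: "E j \<in> Y"
  by (induction j) (auto simp: E_0 E_Suc e_Y v_Y Ybr)

lemma sU: "subspace (U j)" by (simp add: U_def)

lemma U_0: "U 0 = S" using sS by (simp add: U_def span_eq_iff)

lemma U_Suc: "U j \<subseteq> U (Suc j)" unfolding U_def by (auto intro!: span_mono)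

lemma U_mono: "i \<le> j \<Longrightarrow> U i \<subseteq> U j" by (rule lift_Suc_mono_le[of U, OF U_Suc])

lemma E_U: "j < i \<Longrightarrow> E j \<in> U i" and S_U: "S \<subseteq> U i" unfolding U_def by (auto intro: span_base)

lemma U_Y: "U j \<subseteq> Y" unfolding U_def using E_Y SY by (intro span_minimal sY) auto

lemma U_v: assumes "y \<in> U j" shows "br v y \<in> U (Suc j)"
proof (rule lin_span_image[OF lin_br sU _ assms[unfolded U_def]])
  fix z assume "z \<in> S \<union> E ` {..<j}"
  then consider "z \<in> S" | i where "i < j" "z = E i" by auto
  then show "br v z \<in> U (Suc j)"
  proof cases
    case 1
    then show ?thesis using Sl[OF v_Y] S_U by blast
  next
    case 2
    then show ?thesis using E_U[of "Suc i" "Suc j"] by (simp add: E_Suc)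
  qed
qed

lemma S_br_U: "y \<in> Y \<Longrightarrow> s \<in> S \<Longrightarrow> br y s \<in> U j" "y \<in> Y \<Longrightarrow> s \<in> S \<Longrightarrow> br s y \<in> U j"
  using Sl Sr S_U by blast+

text \<open>Moving \<open>p\<close> past one factor \<open>v\<close> produces \<open>chi p\<close>
  times \<open>v\<close> and an element of \<open>P\<close>; the latter does not lead out of the
  part of the string already reached.\<close>

lemma E_weight: "p \<in> P \<Longrightarrow> br p (E j) \<approx>[U j] (mu p + of_nat j * chi p) *s E j"
proof (induction j arbitrary: p)
  case 0
  then show ?case using mu by (simp add: E_0 U_0)
next
  case (Suc j)
  define q where "q = br p v - chi p *s v"
  have q: "q \<in> P" using chi Suc.prems by (simp add: q_def)
  have qE: "br q (E j) \<in> U (Suc j)"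
  proof -
    have "br q (E j) - (mu q + of_nat j * chi q) *s E j \<in> U (Suc j)"
      using Suc.IH[OF q] U_Suc by (auto simp: eqm_iff[OF sU])
    then have "(br q (E j) - (mu q + of_nat j * chi q) *s E j) + (mu q + of_nat j * chi q) *s E j \<in> U (Suc j)"
      using E_U[of j "Suc j"] by (intro subspace_add subspace_scale sU) auto
    then show ?thesis by simp
  qed
  define m where "m = mu p + of_nat j * chi p"
  have "br v (br p (E j) - m *s E j) \<in> U (Suc j)"
    using Suc.IH[OF Suc.prems] U_v by (simp add: eqm_iff[OF sU] m_def)
  then have "br q (E j) + br v (br p (E j) - m *s E j) \<in> U (Suc j)" using qE by (intro subspace_add sU)
  also have "br q (E j) + br v (br p (E j) - m *s E j) = br p (E (Suc j)) - (chi p + m) *s E (Suc j)"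
    unfolding E_Suc leibniz[of p v "E j"] by (simp add: q_def br_simps vs_simps)
  finally show ?case by (simp add: eqm_iff[OF sU] m_def algebra_simps)
qed

lemma P_U: assumes p: "p \<in> P" and y: "y \<in> U j" shows "br p y \<in> U j"
proof (rule lin_span_image[OF lin_br sU _ y[unfolded U_def]])
  fix z assume "z \<in> S \<union> E ` {..<j}"
  then consider "z \<in> S" | i where "i < j" "z = E i" by auto
  then show "br p z \<in> U j"
  proof cases
    case 1
    then show ?thesis using S_br_U PY'[OF p] by blast
  next
    case 2
    then have "br p z - (mu p + of_nat i * chi p) *s E i \<in> U j"
      using E_weight[OF p, of i] U_mono[of i j] by (auto simp: eqm_iff[OF sU])
    then have "(br p z - (mu p + of_nat i * chi p) *s E i) + (mu p + of_nat i * chi p) *s E i \<in> U j"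
      using E_U[OF 2(1)] by (intro subspace_add subspace_scale sU)
    then show ?thesis by simp
  qed
qed

lemma U_ideal: assumes "E j \<in> U j" shows "ideal_of Y (U j)"
proof (rule ideal_insert[OF U_Y S_U sU P_U])
  show "v - v \<in> P" using subspace_0[OF sP] by simp
  show "br v u \<in> U j" if "u \<in> U j" for u
  proof (rule lin_span_image[OF lin_br sU _ that[unfolded U_def]])
    fix z assume "z \<in> S \<union> E ` {..<j}"
    then consider "z \<in> S" | i where "i < j" "z = E i" by auto
    then show "br v z \<in> U j"
    proof cases
      case 1
      then show ?thesis using S_br_U v_Y by blast
    next
      case 2
      then have "E (Suc i) \<in> U j" using E_U[of "Suc i" j] assms by (cases "Suc i = j") auto
      then show ?thesis by (simp add: E_Suc 2)
    qed
  qed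
qed

lemma U_whole: assumes "E j \<in> U j" shows "U j = Y"
proof -
  have "j \<noteq> 0" using assms e_S by (auto simp: E_0 U_0 intro: ccontr)
  then have "e \<in> U j" using E_U[of 0 j] by (simp add: E_0)
  then show ?thesis using larger_ideal[OF U_ideal[OF assms] S_U] e_S by blast
qed

text \<open>Where the spans \<open>U j\<close> stabilize they form an ideal above \<open>S\<close>,
  hence all of \<open>Y\<close>, which is not contained in \<open>P\<close>.\<close>

lemma exists_E_notin_P: "\<exists>i. E i \<notin> P"
proof (rule ccontr)
  assume "\<not> ?thesis"
  then have "U j \<subseteq> P" for j unfolding U_def using SP' by (intro span_minimal sP) auto
  moreover obtain m where "U (Suc m) = U m" using ascending_chain_stabilizes[of U, OF sU U_Suc] by metis
  then have "U m = Y" using U_whole[of m] E_U[of m "Suc m"] by simp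
  ultimately show False using PY by blast
qed

text \<open>Here \<open>k\<close> is the last index before the string leaves \<open>P\<close>. The
  next vector has weight \<open>mu + (k + 1) chi\<close> along the string, but is a nonzero multiple
  of \<open>v\<close> modulo \<open>P\<close> and so has weight \<open>chi\<close>; hence
  \<open>mu = - k chi\<close>. The bound \<open>1 \<le> k\<close> comes from
  \<open>chi e = 0\<close>.\<close>

lemma chain_end:
  obtains k p0 c where "1 \<le> k" "\<And>j. j \<le> k \<Longrightarrow> E j \<in> P" "\<And>j. j \<le> Suc k \<Longrightarrow> E j \<notin> U j"
    "E (Suc k) = p0 + c *s v" "p0 \<in> P" "c \<noteq> 0" "chi (E k) = - c"
    "\<And>p. p \<in> P \<Longrightarrow> mu p = - of_nat k * chi p" "U (Suc k) \<subseteq> P"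
proof -
  define i where "i = (LEAST i. E i \<notin> P)"
  have i: "E i \<notin> P" "\<And>j. j < i \<Longrightarrow> E j \<in> P"
    unfolding i_def using LeastI_ex[OF exists_E_notin_P] not_less_Least by blast+
  have vP: "br v y \<in> P" if "y \<in> P" "br y v \<in> P" for y
    unfolding br_flip[of v y] using psi_S[OF v_Y PY'[OF that(1)]] SP' that by (intro subspace_diff sP) auto
  have "br e v \<in> P" using chi[OF e_P] by (simp add: chi_e)
  then have "E 1 \<in> P" using vP[OF e_P] by (simp add: E_Suc E_0)
  then have "i \<noteq> 0" "i \<noteq> 1" using i(1) e_P E_0 by metis+
  then obtain k where k: "i = Suc k" "1 \<le> k" by (cases i) auto
  have EP: "E j \<in> P" if "j \<le> k" for j using i(2) k that by simp
  have UP: "U j \<subseteq> P" if "j \<le> Suc k" for j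
    unfolding U_def using EP SP' that by (intro span_minimal sP) auto
  have EU: "E j \<notin> U j" if "j \<le> Suc k" for j using U_whole[of j] UP[OF that] PY by blast
  obtain c p0 where c: "E (Suc k) = p0 + c *s v" "p0 \<in> P" using Y_cases[OF E_Y] .
  have c0: "c \<noteq> 0" using i(1) c k by auto
  have "chi (E k) = - c"
  proof (rule chi_unique[OF EP])
    have "psi (E k) v - p0 \<in> P" using c psi_S[OF E_Y v_Y] SP' by (intro subspace_diff sP) auto
    then show "br (E k) v - (- c) *s v \<in> P"
      unfolding br_flip[of "E k" v] E_Suc[symmetric] c(1) by (simp add: algebra_simps)
  qed simp
  moreover have "mu p = - of_nat k * chi p" if p: "p \<in> P" for p
  proof -
    define m where "m = mu p + of_nat (Suc k) * chi p"
    define x y where "x = br p (E (Suc k)) - m *s E (Suc k)" and "y = br p v - chi p *s v"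
    have "x \<in> P" using E_weight[OF p, of "Suc k"] UP[of "Suc k"] by (auto simp: eqm_iff[OF sU] x_def m_def)
    moreover have "y \<in> P" using chi p by (simp add: y_def)
    ultimately have "(x - br p p0) + (m *s p0 - c *s y) \<in> P"
      using c Pbr[OF p] by (intro subspace_add subspace_diff subspace_scale sP) auto
    also have "(x - br p p0) + (m *s p0 - c *s y) = (c * (chi p - m)) *s v"
      unfolding x_def y_def c(1) by (simp add: br_simps vs_simps)
    finally have "c * (chi p - m) = 0" by (rule multiple_v)
    then have "chi p = m" using c0 by simp
    then have "mu p + (1 + of_nat k) * chi p = chi p" by (simp add: m_def)
    then show ?thesis by (simp add: algebra_simps eq_neg_iff_add_eq_0)
  qed
  ultimately show thesis using that[OF k(2) EP EU c c0] UP[of "Suc k"] by blast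
qed

text \<open>
  With \<open>x\<close> the element of degree \<open>1\<close> in the chain (\<open>e\<close> having degree \<open>k\<close>), the products \<open>[x, E (j + 1)]\<close>
  are nonzero multiples of \<open>E j\<close> for \<open>j < k\<close>; for \<open>j = k - 2\<close> this contradicts \<open>[x, x] \<in> S\<close>.
\<close>

lemma chain_length_one:
  obtains p0 c where "E 1 \<in> P" "E 1 \<notin> U 1" "E 2 = p0 + c *s v" "p0 \<in> P" "c \<noteq> 0" "chi (E 1) = - c"
    "\<And>p. p \<in> P \<Longrightarrow> mu p = - chi p" "U 2 \<subseteq> P"
proof -
  obtain k p0 c where k: "1 \<le> k" "\<And>j. j \<le> k \<Longrightarrow> E j \<in> P" "\<And>j. j \<le> Suc k \<Longrightarrow> E j \<notin> U j"
    "E (Suc k) = p0 + c *s v" "p0 \<in> P" "c \<noteq> 0" "chi (E k) = - c"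
    "\<And>p. p \<in> P \<Longrightarrow> mu p = - of_nat k * chi p" "U (Suc k) \<subseteq> P"
    by (rule chain_end, rule that)
  have "k = 1"
  proof (rule ccontr)
    assume "k \<noteq> 1"
    then obtain l where l: "k = Suc (Suc l)" using k(1) by (cases k; cases "k - 1") auto
    define x where "x = E (Suc l)"
    have x: "x \<in> P" using k(2) l by (simp add: x_def)
    have Ek: "E k = br v x" by (simp add: x_def l E_Suc)
    have xv: "br x v = psi x v - E k" unfolding Ek by (rule br_flip)
    have "chi x = 0"
    proof (rule chi_unique[OF x])
      show "br x v - 0 *s v \<in> P"
        using k(2)[of k] psi_S[OF PY'[OF x] v_Y] SP' by (auto simp: xv intro: subspace_diff sP)
    qed
    then have mux: "mu x = 0" using k(8)[OF x] by simp
    \<comment> \<open>The value of \<open>step\<close> below: each passage from \<open>j\<close> to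
      \<open>j + 1\<close> subtracts the eigenvalue \<open>(k - j) c\<close> of \<open>E k\<close>
      on \<open>E j\<close>, with index raised accordingly, and the eigenvalues accumulate.\<close>
    define b where "b j = of_nat (\<Sum>t\<le>j. k - t) * (- c)" for j
    have main: "j \<le> l \<Longrightarrow> br x (E (Suc j)) \<approx>[U j] b j *s E j" for j
    proof (induction j)
      have step: "br x (E (Suc j)) = br v (br x (E j)) - br (E k) (E j)" for j
      proof -
        have "br x (E (Suc j)) = br (br x v) (E j) + br v (br x (E j))"
          unfolding E_Suc by (rule leibniz)
        then show ?thesis unfolding xv by (simp add: br_simps br_psi)
      qed
      have EkE: "br (E k) (E j) \<approx>[U j] ((of_nat k - of_nat j) * c) *s E j" for j
        using E_weight[OF k(2)[of k], of j] k(7) k(8)[OF k(2)[of k]] by (simp add: algebra_simps)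
      {
        case 0
        have "br x (E 0) \<in> S" using mu[OF x] mux by (simp add: E_0 eqm_iff[OF sS])
        then have "br v (br x (E 0)) \<approx>[U 0] 0" using Sl[OF v_Y] by (simp add: U_0 eqm_0[OF sS])
        then have "br x (E (Suc 0)) \<approx>[U 0] 0 - ((of_nat k - of_nat 0) * c) *s E 0"
          unfolding step by (intro eqm_diff EkE)
        then show ?case by (simp add: b_def)
      next
        case (Suc j)
        have "br x (E (Suc j)) - b j *s E j \<in> U j" using Suc by (simp add: eqm_iff[OF sU])
        then have "br v (br x (E (Suc j)) - b j *s E j) \<in> U (Suc j)" by (rule U_v)
        then have "br v (br x (E (Suc j))) \<approx>[U (Suc j)] b j *s E (Suc j)"
          by (simp add: eqm_iff[OF sU] br_simps E_Suc)
        then have "br x (E (Suc (Suc j))) \<approx>[U (Suc j)]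
            b j *s E (Suc j) - ((of_nat k - of_nat (Suc j)) * c) *s E (Suc j)"
          unfolding step[of "Suc j"] by (intro eqm_diff EkE)
        also have "\<dots> = (b j - (of_nat k - of_nat (Suc j)) * c) *s E (Suc j)" by (simp only: scale_left_diff_distrib)
        also have "b j - (of_nat k - of_nat (Suc j)) * c = b (Suc j)"
        proof -
          have "Suc j \<le> k" using Suc.prems l by simp
          then have "of_nat k - of_nat (Suc j) = (of_nat (k - Suc j) :: complex)" by (simp add: of_nat_diff)
          then show ?thesis by (simp add: b_def algebra_simps)
        qed
        finally show ?case .
      }
    qed
    have "br x x \<in> U l" using br_self_S[OF PY'[OF x]] S_U by blast
    then have "b l *s E l \<in> U l"
      using eqm_mem[OF sU main[of l]] by (simp add: x_def)
    moreover have "b l \<noteq> 0"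
    proof -
      have "k \<le> (\<Sum>t\<le>l. k - t)" using member_le_sum[of 0 "{..l}" "\<lambda>t. k - t"] by simp
      then have "(\<Sum>t\<le>l. k - t) \<noteq> 0" using k(1) by linarith
      then have "(of_nat (\<Sum>t\<le>l. k - t) :: complex) \<noteq> 0" by (simp only: of_nat_eq_0_iff) simp
      then show ?thesis using k(6) unfolding b_def by simp
    qed
    ultimately have "E l \<in> U l" using subspace_scale_iff[OF sU] by blast
    then show False using k(3)[of l] l by simp
  qed
  then show thesis using that[of p0 c] k(2)[of 1] k(3)[of 1] k(4-9) by (simp add: numeral_2_eq_2)
qed

lemma sl2_mod_S:
  "\<exists>e\<in>Y. \<exists>f\<in>Y. \<exists>h\<in>Y. Y = span (S \<union> {e, f, h}) \<and> br h e \<approx>[S] 2 *s e \<and>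
     br h f \<approx>[S] (- 2) *s f \<and> br e f \<approx>[S] h"
proof -
  obtain p0 c where k: "E 1 \<in> P" "E 1 \<notin> U 1" "E 2 = p0 + c *s v" "p0 \<in> P" "c \<noteq> 0" "chi (E 1) = - c"
    "\<And>p. p \<in> P \<Longrightarrow> mu p = - chi p" "U 2 \<subseteq> P"
    by (rule chain_length_one, rule that)
  have U2: "U 2 = span (S \<union> {e, E 1})" unfolding U_def by (simp add: numeral_2_eq_2 lessThan_Suc insert_commute E_0)
  have U3: "U 3 = span (S \<union> {e, E 1, E 2})"
    unfolding U_def by (simp add: numeral_3_eq_3 numeral_2_eq_2 lessThan_Suc insert_commute E_0)
  have eE: "br e (E 1) \<in> U 2" "br e (E 2) \<in> U 2" and EE: "br (E 1) (E 2) \<approx>[U 2] (- c) *s E 2"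
    using E_weight[OF e_P, of 1] E_weight[OF e_P, of 2] E_weight[OF k(1), of 2] k(6) k(7)[OF k(1)] k(7)[OF e_P] chi_e
      U_mono[of 1 2] by (auto simp: eqm_iff[OF sU])
  have psiU: "psi a b \<in> U j" if "a \<in> Y" "b \<in> Y" for a b j using psi_S[OF that] S_U by blast
  \<comment> \<open>Modulo \<open>P\<close> the vector \<open>E 2 / c\<close> is \<open>v\<close>,
    so it may replace \<open>v\<close> in the ideal test. Its products stay in \<open>U 3\<close>,
    because those of \<open>e\<close> and \<open>E 1\<close> with \<open>E 2\<close> are known from
    the weights.\<close>
  have "ideal_of Y (U 3)"
  proof (rule ideal_insert[OF U_Y S_U sU P_U])
    show "v - inverse c *s E 2 \<in> P"
      using k(5) subspace_neg[OF sP subspace_scale[OF sP k(4), of "inverse c"]]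
      by (simp add: k(3) scale_right_distrib)
    have E2: "br (E 2) z \<in> U 3" if z: "z \<in> S \<union> {e, E 1, E 2}" for z
    proof -
      have "br z (E 2) \<in> U 3"
      proof -
        have "br (E 1) (E 2) \<in> U 3"
        proof -
          have "br (E 1) (E 2) \<approx>[U 3] (- c) *s E 2" using EE U_mono[of 2 3] by (auto simp: eqm_iff[OF sU])
          moreover have "(- c) *s E 2 \<in> U 3" using subspace_scale[OF sU E_U[of 2 3], of "- c"] by simp
          ultimately show ?thesis using eqm_mem[OF sU] by blast
        qed
        moreover have "br e (E 2) \<in> U 3" using eE U_mono[of 2 3] by auto
        moreover have "br (E 2) (E 2) \<in> U 3" using br_self_S[OF E_Y] S_U by blast
        moreover have "br z (E 2) \<in> U 3" if "z \<in> S" using S_br_U(2)[OF E_Y that] .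
        ultimately show ?thesis using z by blast
      qed
      moreover have "z \<in> Y" using z SY E_Y e_Y by blast
      ultimately show ?thesis unfolding br_flip[of "E 2" z] using psiU[OF E_Y] by (intro subspace_diff sU)
    qed
    show "br (inverse c *s E 2) u \<in> U 3" if "u \<in> U 3" for u
    proof -
      have "br (E 2) u \<in> U 3" using lin_span_image[OF lin_br sU E2 that[unfolded U3]] .
      then show ?thesis using subspace_scale[OF sU] by (simp add: br_simps)
    qed
  qed
  moreover have "e \<in> U 3" using E_U[of 0 3] by (simp add: E_0)
  ultimately have Y3: "U 3 = Y" using larger_ideal[OF _ S_U] e_S by blast
  \<comment> \<open>Normalization: \<open>mu (E 1) = c\<close>, so \<open>2 / c\<close> gives
    \<open>h0\<close> the eigenvalue \<open>2\<close> on \<open>e\<close>; then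
    \<open>[e, E 2]\<close> equals \<open>- c\<close> times \<open>E 1\<close> up to a multiple of
    \<open>e\<close>, which fixes the factor of \<open>f0\<close>.\<close>
  define f0 h0 where "f0 = (- 2 / c\<^sup>2) *s E 2" and "h0 = (2 / c) *s E 1"
  have Y0: "f0 \<in> Y" "h0 \<in> Y" unfolding f0_def h0_def using E_Y subspace_scale[OF sY] by blast+
  have h0e: "br h0 e \<approx>[S] 2 *s e"
    using eqm_scale[OF mu[OF k(1)], of "2 / c"] k(5,6) k(7)[OF k(1)] by (simp add: h0_def br_simps)
  define \<nu> where "\<nu> = (- 2 / c\<^sup>2) * - mu p0"
  have ef0: "br e f0 \<approx>[S] h0 + \<nu> *s e"
  proof -
    have "br e (E 2) = br e p0 + c *s br e v" unfolding k(3) by (simp add: br_simps)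
    also have "\<dots> \<approx>[S] - br p0 e + c *s (- br v e)"
      using k(4) PY' e_Y v_Y by (intro eqm_add eqm_scale flip_S) auto
    also have "\<dots> \<approx>[S] - (mu p0 *s e) + c *s (- E 1)"
      using mu[OF k(4)] E_Suc[of 0] by (intro eqm_add eqm_minus) (simp_all add: E_0)
    finally have "(- 2 / c\<^sup>2) *s br e (E 2) \<approx>[S] (- 2 / c\<^sup>2) *s (- (mu p0 *s e) + c *s (- E 1))"
      by (rule eqm_scale)
    also have "\<dots> = h0 + \<nu> *s e" using k(5)
      by (simp add: h0_def \<nu>_def scale_right_distrib scale_right_diff_distrib power2_eq_square)
    finally show ?thesis by (simp add: f0_def br_simps)
  qed
  \<comment> \<open>The multiple of \<open>e\<close> left over in \<open>[e, f0]\<close> is absorbed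
    into \<open>h\<close>. The relation with \<open>e\<close> survives, as \<open>[e, e]\<close>
    lies in \<open>S\<close>.\<close>
  define h where "h = h0 + \<nu> *s e"
  have hY: "h \<in> Y" unfolding h_def using Y0 e_Y by (intro subspace_add subspace_scale sY)
  have he: "br h e \<approx>[S] 2 *s e"
    using eqm_add[OF h0e eqm_scale[of "br e e" S 0 \<nu>]] br_self_S[OF e_Y]
    by (simp add: h_def br_simps eqm_0[OF sS])
  have hh: "br h h \<approx>[S] 0" using br_self_S[OF hY] by (simp add: eqm_0[OF sS])
  obtain b g where hf0: "br h f0 \<approx>[S] (- 2) *s f0 + (b *s e + g *s h)"
  proof -
    have "br h0 f0 \<approx>[U 2] (- 2) *s f0"
      using eqm_scale[OF EE, of "(2 / c) * (- 2 / c\<^sup>2)"] k(5)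
      by (simp add: h0_def f0_def br_simps field_simps)
    then have "br h0 f0 - (- 2) *s f0 \<in> U 2" by (simp only: eqm_iff[OF sU])
    then have "br h0 f0 - (- 2) *s f0 \<in> span (insert (E 1) (span (insert e S)))"
      unfolding U2 by (simp add: insert_commute Un_insert_right) (smt (verit) insert_commute span_breakdown_eq span_span)
    then obtain r w where r: "br h0 f0 - (- 2) *s f0 = w + r *s E 1" "w \<in> span (insert e S)"
      using span_insert_mem[OF subspace_span] by blast
    then obtain s t where s: "w = s + t *s e" "s \<in> S" using span_insert_mem[OF sS] by blast
    have E1: "E 1 = (c / 2) *s (h - \<nu> *s e)" using k(5) by (simp add: h_def h0_def)
    have "br h f0 = br h0 f0 + \<nu> *s br e f0" by (simp add: h_def br_simps)
    also have "\<dots> \<approx>[S] ((- 2) *s f0 + (t *s e + r *s E 1)) + \<nu> *s h"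
    proof (intro eqm_add eqm_scale)
      show "br e f0 \<approx>[S] h" using ef0 by (simp add: h_def)
      show "br h0 f0 \<approx>[S] (- 2) *s f0 + (t *s e + r *s E 1)"
        using r(1) s by (simp add: eqm_iff[OF sS] algebra_simps)
    qed
    also have "\<dots> = (- 2) *s f0 + ((t - r * (c / 2) * \<nu>) *s e + (r * (c / 2) + \<nu>) *s h)"
      unfolding E1 by (simp add: vs_simps)
    finally show thesis by (rule that)
  qed
  \<comment> \<open>Expanding \<open>[h, h]\<close> as \<open>[h, [e, f0]]\<close> leaves
    \<open>-2 g e\<close> modulo \<open>S\<close>, while \<open>[h, h]\<close> itself lies in
    \<open>S\<close>.\<close>
  have g: "g = 0"
  proof -
    have ef: "br e f0 \<approx>[S] h" using ef0 by (simp add: h_def)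
    have "0 \<approx>[S] br h h" using hh by (rule eqm_sym)
    also have "br h h \<approx>[S] br h (br e f0)"
      using hY e_Y Y0 Ybr by (intro eqbr eqm_sym[OF ef] eqm_refl) auto
    also have "\<dots> = br (br h e) f0 + br e (br h f0)" by (rule leibniz)
    also have "\<dots> \<approx>[S] br (2 *s e) f0 + br e ((- 2) *s f0 + (b *s e + g *s h))"
    proof -
      have m: "2 *s e \<in> Y" "(- 2) *s f0 + (b *s e + g *s h) \<in> Y"
        by (intro subspace_add subspace_scale sY Y0 e_Y hY)+
      show ?thesis by (intro eqm_add eqbr he hf0 eqm_refl hY e_Y Y0 Ybr m)
    qed
    also have "\<dots> = b *s br e e + g *s br e h" by (simp add: br_simps)
    also have "\<dots> \<approx>[S] b *s 0 + g *s (- (2 *s e))"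
    proof (intro eqm_add eqm_scale)
      show "br e e \<approx>[S] 0" using br_self_S[OF e_Y] by (simp add: eqm_0[OF sS])
      show "br e h \<approx>[S] - (2 *s e)" using eqm_trans[OF flip_S[OF e_Y hY] eqm_minus[OF he]] .
    qed
    finally have "g *s (2 *s e) \<in> S" using eqm_iff[OF sS] by (simp add: scale_minus_right)
    then show ?thesis using multiple_e[of "g * 2"] by simp
  qed
  \<comment> \<open>The eigenvalues of \<open>h\<close> on \<open>e\<close> and on the desired
    \<open>f\<close> differ by \<open>4\<close>, so subtracting \<open>b / 4\<close> times
    \<open>e\<close> removes the error \<open>b e\<close>.\<close>
  define f where "f = f0 + (- b / 4) *s e"
  have fY: "f \<in> Y" unfolding f_def using Y0 e_Y by (intro subspace_add subspace_scale sY)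
  have hf: "br h f \<approx>[S] (- 2) *s f"
  proof -
    have "br h f = br h f0 + (- b / 4) *s br h e" by (simp add: f_def br_simps)
    also have "\<dots> \<approx>[S] ((- 2) *s f0 + (b *s e + g *s h)) + (- b / 4) *s (2 *s e)"
      by (intro eqm_add eqm_scale hf0 he)
    also have "\<dots> = (- 2) *s f0 + (b + (- b / 4) * 2) *s e" by (simp only: g scale_left_distrib scale_scale) simp
    also have "\<dots> = (- 2) *s f" by (simp add: f_def scale_right_distrib scale_right_diff_distrib)
    finally show ?thesis .
  qed
  have ef: "br e f \<approx>[S] h"
    using eqm_add[OF ef0 eqm_scale[of "br e e" S 0 "- b / 4"]] br_self_S[OF e_Y]
    by (simp add: h_def f_def br_simps eqm_0[OF sS])
  have "Y = span (S \<union> {e, f, h})"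
  proof
    show "span (S \<union> {e, f, h}) \<subseteq> Y" using SY e_Y fY hY by (intro span_minimal sY) auto
    have h0: "h0 = h - \<nu> *s e" "f0 = f - (- b / 4) *s e" by (simp_all add: h_def f_def)
    have "E 1 = (c / 2) *s (h - \<nu> *s e)" "E 2 = (- c\<^sup>2 / 2) *s (f - (- b / 4) *s e)"
      using k(5) unfolding h0[symmetric] by (simp_all add: h0_def f0_def)
    moreover have "e \<in> span (S \<union> {e, f, h})" "f \<in> span (S \<union> {e, f, h})" "h \<in> span (S \<union> {e, f, h})"
      by (auto intro: span_base)
    ultimately have "E 1 \<in> span (S \<union> {e, f, h})" "E 2 \<in> span (S \<union> {e, f, h})"
      by (auto intro!: span_scale span_diff simp del: scale_minus_left)
    then show "Y \<subseteq> span (S \<union> {e, f, h})" unfolding Y3[symmetric] U3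
      by (intro span_minimal) (auto intro: span_base)
  qed
  then show ?thesis using e_Y fY hY he hf ef by blast
qed

end

section \<open>Lifting the triple through the solvable ideal\<close>

lemma (in complex_fd_space) span_insert3_mem:
  assumes W: "subspace W" and x: "x \<in> span (W \<union> {u, v, w})"
  shows "\<exists>a b c t. x = ((t + scale c w) + scale b v) + scale a u \<and> t \<in> W"
proof -
  have "W \<union> {u, v, w} = insert u (insert v (insert w W))" by blast
  then obtain a where "x - scale a u \<in> span (insert v (insert w W))"
    using x span_breakdown_eq[of x u] by auto
  then obtain b where "x - scale a u - scale b v \<in> span (insert w W)"
    using span_breakdown_eq[of _ v] by blast
  then obtain c where "x - scale a u - scale b v - scale c w \<in> span W"
    using span_breakdown_eq[of _ w] by blast
  moreover define t where "t = x - scale a u - scale b v - scale c w"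
  ultimately have "t \<in> W" using W span_eq_iff[of W] by metis
  moreover have "x = ((t + scale c w) + scale b v) + scale a u" by (simp add: t_def)
  ultimately show ?thesis by blast
qed

context left_central_leibniz_algebra begin

lemma subalg_sl2_extension:
  assumes A: "ideal_of Y A" and Y: "subalg Y" "e \<in> Y" "f \<in> Y" "h \<in> Y" and C: "leibniz_kernel \<inter> Y \<subseteq> A"
    and he: "br h e \<approx>[A] 2 *s e" and hf: "br h f \<approx>[A] (- 2) *s f" and ef: "br e f \<approx>[A] h"
  shows "subalg (span (A \<union> {e, f, h}))"
proof -
  note sA = ideal_ofD(1)[OF A]
  define G where "G = A \<union> {e, f, h}"
  have G: "A \<subseteq> span G" "e \<in> span G" "f \<in> span G" "h \<in> span G" by (auto simp: G_def intro: span_base)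
  have GY: "G \<subseteq> Y" using A Y by (auto simp: G_def ideal_of_def)
  have up: "x \<in> span G" if "x \<approx>[A] y" "y \<in> span G" for x y
    using eqm_mem'[OF subspace_span G(1) that(1)] that(2) by blast
  have flip: "br b a \<in> span G" if "br a b \<in> span G" "a \<in> Y" "b \<in> Y" for a b
  proof -
    have "psi b a \<in> Y" unfolding psi_def using that subalgD[OF Y(1)] by (intro subspace_add) auto
    then have "psi b a \<in> A" using C psi_in_kernel by blast
    then show ?thesis unfolding br_flip[of b a] using that G by (intro span_diff) auto
  qed
  have self: "br a a \<in> span G" if "a \<in> Y" for a
  proof -
    have "br a a \<in> A" using C br_self_in_kernel subalgD(2)[OF Y(1) that that] by blast
    then show ?thesis using G by blast
  qed
  have 1: "br h e \<in> span G" "br h f \<in> span G" "br e f \<in> span G"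
    using up[OF he] up[OF hf] up[OF ef] G span_scale by blast+
  have gen: "br a b \<in> span G" if ab: "a \<in> G" "b \<in> G" for a b
  proof (cases "a \<in> A \<or> b \<in> A")
    case True
    then have "br a b \<in> A" using ideal_ofD(3,4)[OF A] ab GY by blast
    then show ?thesis using G by blast
  next
    case False
    then have "a \<in> {e, f, h}" "b \<in> {e, f, h}" using ab by (auto simp: G_def)
    then show ?thesis
      using 1 flip[OF 1(1)] flip[OF 1(2)] flip[OF 1(3)] self Y by blast
  qed
  have "br a b \<in> span G" if "a \<in> span G" "b \<in> span G" for a b
  proof -
    have "br a g \<in> span G" if "g \<in> G" for g
      by (rule lin_span_image[OF lin_br_left subspace_span gen \<open>a \<in> span G\<close>]) (use that in simp_all)
    then show ?thesis by (rule lin_span_image[OF lin_br subspace_span _ \<open>b \<in> span G\<close>])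
  qed
  then show ?thesis unfolding subalg_def G_def[symmetric] by simp
qed

end

context minimal_nonsolvable begin

lemma sl2_quotient:
  obtains e f h where "e \<in> Y" "f \<in> Y" "h \<in> Y" "Y = span (S \<union> {e, f, h})" "br h e \<approx>[S] 2 *s e"
    "br h f \<approx>[S] (- 2) *s f" "br e f \<approx>[S] h"
proof -
  obtain P v where Pv: "subalg P" "S \<subset> P" "P \<subset> Y" "v \<in> Y" "v \<notin> P" "Y = span (insert v P)"
    "\<And>p. p \<in> P \<Longrightarrow> \<exists>c. br p v - c *s v \<in> P" "solv R P"
    by (rule maximal_subalgebra, rule that)
  interpret minimal_nonsolvable_borel scale br R Y S P v
    by unfold_locales (use Pv in blast)+
  obtain e mu where e: "e \<in> P" "e \<notin> S" "\<And>p. p \<in> P \<Longrightarrow> br p e \<approx>[S] mu p *s e"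
    by (rule eigenvector_e, rule that)
  interpret minimal_nonsolvable_weight scale br R Y S P v e mu
    by unfold_locales (use e in blast)+
  show thesis using sl2_mod_S that by blast
qed

text \<open>
  By the Fitting decomposition the null component of an element of \<open>S\<close> is a subalgebra that
  together with \<open>S\<close> spans \<open>Y\<close>.
\<close>

lemma S_nilpotent: assumes x: "x \<in> S" and y: "y \<in> Y" shows "\<exists>n. (br x ^^ n) y = 0"
proof -
  have xY: "x \<in> Y" using x SY by blast
  have "br x z \<in> S" if "z \<in> Y" for z using Sr[OF that x] .
  note fit = fitting_decomposition[OF subalg_Y xY this]
  have "{y \<in> Y. \<exists>n. (br x ^^ n) y = 0} = Y" by (rule frattini[OF fit(1) _ fit(2)]) auto
  then show ?thesis using y by blast
qed

text \<open>The elements of \<open>S\<close> sent into \<open>A\<close> by \<open>S\<close> form an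
  ideal of \<open>Y\<close>. Engel's theorem makes it larger than \<open>A\<close>, so maximality of
  \<open>A\<close> makes it all of \<open>S\<close>.\<close>

lemma S_acts_trivially:
  assumes A: "ideal_of Y A" "A \<subset> S"
    and max: "\<And>T. ideal_of Y T \<Longrightarrow> A \<subseteq> T \<Longrightarrow> T \<subset> S \<Longrightarrow> T = A" and C: "leibniz_kernel \<inter> Y \<subseteq> A"
    and st: "s \<in> S" "t \<in> S"
  shows "br s t \<in> A"
proof -
  note sA = ideal_ofD(1)[OF A(1)]
  define Z where "Z = S \<inter> (\<Inter>s\<in>S. {u. br s u \<in> A})"
  have sZ: "subspace Z" unfolding Z_def by (intro subspace_inter subspace_Int sS lin_subspace_vimage lin_br sA)
  have AZ: "A \<subseteq> Z" using A ideal_ofD(3)[OF A(1)] SY by (auto simp: Z_def)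
  have "\<exists>v\<in>S - A. \<forall>p\<in>S. br p v \<in> A"
  proof (rule engel_theorem[OF ideal_of_subalg[OF ideal_S] sS sA A(2)])
    show "br p u \<in> S" if "p \<in> S" "u \<in> S" for p u using Sl SY that by blast
    show "br p u \<in> A" if "p \<in> S" "u \<in> A" for p u using ideal_ofD(3)[OF A(1)] SY that by blast
    show "\<exists>n. (br p ^^ n) u = 0" if "p \<in> S" "u \<in> S \<union> S" for p u using S_nilpotent SY that by blast
  qed
  then have ne: "Z \<noteq> A" by (auto simp: Z_def)
  have "ideal_of Y Z"
  proof (rule ideal_of_left[OF subalg_Y sZ])
    show "Z \<subseteq> Y" using SY by (auto simp: Z_def)
    show "leibniz_kernel \<inter> Y \<subseteq> Z" using C AZ by blast
    fix y u assume y: "y \<in> Y" and u: "u \<in> Z"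
    have uS: "u \<in> S" and uA: "\<And>s. s \<in> S \<Longrightarrow> br s u \<in> A" using u by (auto simp: Z_def)
    have "br s (br y u) \<in> A" if s: "s \<in> S" for s
      unfolding leibniz[of s y u] using uA[OF Sr[OF y s]] ideal_ofD(3)[OF A(1) y uA[OF s]]
      by (rule subspace_add[OF sA])
    then show "br y u \<in> Z" using Sl[OF y uS] by (auto simp: Z_def)
  qed
  then have "Z = S" using max[of Z] AZ ne by (auto simp: Z_def)
  then show ?thesis using st by (auto simp: Z_def)
qed

text \<open>A Levi splitting by hand. Otherwise there is a layer \<open>S / A\<close>, an
  irreducible \<open>sl\<^sub>2\<close>-module on which \<open>S\<close> acts by zero. Correcting
  the lifts by elements of \<open>S\<close> until the relations hold modulo \<open>A\<close> gives a
  subalgebra supplementing \<open>S\<close>; it is \<open>Y\<close> by \<open>frattini\<close>,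
  which forces \<open>S \<subseteq> A\<close>.\<close>

lemma S_minimal: "S \<subseteq> leibniz_kernel"
proof (rule ccontr)
  assume nS: "\<not> S \<subseteq> leibniz_kernel"
  define D where "D = leibniz_kernel \<inter> Y"
  have "ideal_of Y D"
    unfolding D_def
  proof (rule ideal_of_left[OF subalg_Y subspace_inter[OF subspace_kernel sY]])
    show "br y s \<in> leibniz_kernel \<inter> Y" if "s \<in> leibniz_kernel \<inter> Y" for y s
      using that subspace_0[OF subspace_kernel] subspace_0[OF sY] by (simp add: br_kernel_right)
  qed auto
  then have ex: "ideal_of Y D \<and> D \<subseteq> D \<and> D \<subset> S" using kernel_S nS by (auto simp: D_def)
  obtain A where A': "ideal_of Y A \<and> D \<subseteq> A \<and> A \<subset> S"
    and max': "\<And>T. (ideal_of Y T \<and> D \<subseteq> T \<and> T \<subset> S) \<and> A \<subseteq> T \<Longrightarrow> T = A"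
    using maximal_subspace_exists[of "\<lambda>A. ideal_of Y A \<and> D \<subseteq> A \<and> A \<subset> S" D] ex ideal_ofD(1) by blast
  have A: "ideal_of Y A" "A \<subset> S" and C: "leibniz_kernel \<inter> Y \<subseteq> A" using A' by (auto simp: D_def)
  have max: "T = A" if "ideal_of Y T" "A \<subseteq> T" "T \<subset> S" for T using max'[of T] that A' by blast
  note sA = ideal_ofD(1)[OF A(1)] and Al = ideal_ofD(3)[OF A(1)] and Ar = ideal_ofD(4)[OF A(1)]
    and AY = ideal_ofD(2)[OF A(1)]
  note eqA = eqm_br[OF A(1) subalg_Y]
  have AS: "A \<subseteq> S" using A by blast
  have SS: "br s t \<approx>[A] 0" if "s \<in> S" "t \<in> S" for s t
    using S_acts_trivially[OF A max C that] by (simp add: eqm_0[OF sA])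
  have SinY: "s \<in> S \<Longrightarrow> s \<in> Y" for s using SY by blast
  have flipA: "br a b \<approx>[A] - br b a" if "a \<in> Y" "b \<in> Y" for a b
  proof -
    have "psi a b \<in> Y" unfolding psi_def using that Ybr by (intro subspace_add sY) auto
    then have "psi a b \<in> A" using C psi_in_kernel by blast
    then show ?thesis by (simp add: eqm_iff[OF sA] psi_def)
  qed
  have selfA: "br a a \<approx>[A] 0" if "a \<in> Y" for a
  proof -
    have "br a a \<in> A" using C br_self_in_kernel Ybr[OF that that] by blast
    then show ?thesis by (simp add: eqm_0[OF sA])
  qed
  have act: "br a s \<approx>[A] br b s" if "a \<approx>[S] b" "s \<in> S" for a b s
  proof -
    have "br (a - b) s \<approx>[A] 0" using that by (intro SS) (simp_all add: eqm_iff[OF sS])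
    then show ?thesis by (simp add: br_simps eqm_iff[OF sA] eqm_0[OF sA])
  qed
  obtain e f h where efh: "e \<in> Y" "f \<in> Y" "h \<in> Y" "Y = span (S \<union> {e, f, h})" "br h e \<approx>[S] 2 *s e"
    "br h f \<approx>[S] (- 2) *s f" "br e f \<approx>[S] h"
    by (rule sl2_quotient)
  interpret sl2: sl2_irreducible scale S A "br e" "br f" "br h"
  proof unfold_locales
    show "br h (br e x) \<approx>[A] br e (br h x) + 2 *s br e x" if "x \<in> S" for x
      unfolding leibniz[of h e x] using act[OF efh(5) that] eqm_add[OF _ eqm_refl[of "br e (br h x)" A]]
      by (fastforce simp: br_simps add.commute)
    show "br h (br f x) \<approx>[A] br f (br h x) - 2 *s br f x" if "x \<in> S" for x
      unfolding leibniz[of h f x] using eqm_add[OF act[OF efh(6) that] eqm_refl[of "br f (br h x)" A]]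
      by (simp add: br_simps)
    show "br e (br f x) \<approx>[A] br f (br e x) + br h x" if "x \<in> S" for x
      unfolding leibniz[of e f x] using eqm_add[OF act[OF efh(7) that] eqm_refl[of "br f (br e x)" A]]
      by (simp add: add.commute)
    show "U = A \<or> U = S" if U: "subspace U" "A \<subseteq> U" "U \<subseteq> S" "\<And>x. x \<in> U \<Longrightarrow> br e x \<in> U"
      "\<And>x. x \<in> U \<Longrightarrow> br f x \<in> U" "\<And>x. x \<in> U \<Longrightarrow> br h x \<in> U" for U
    proof -
      have "ideal_of Y U"
      proof (rule ideal_of_left[OF subalg_Y U(1)])
        show "U \<subseteq> Y" using U(3) SY by blast
        show "leibniz_kernel \<inter> Y \<subseteq> U" using C U(2) by blast
        show "br y u \<in> U" if "y \<in> Y" "u \<in> U" for y u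
        proof (rule lin_span_image[OF lin_br_left U(1)])
          show "y \<in> span (S \<union> {e, f, h})" using that efh(4) by blast
          fix z assume z: "z \<in> S \<union> {e, f, h}"
          have "br z u \<in> A" if "z \<in> S" using SS[OF that, of u] \<open>u \<in> U\<close> U(3) by (auto simp: eqm_0[OF sA])
          then show "br z u \<in> U" using z U(2,4-6) \<open>u \<in> U\<close> by blast
        qed
      qed
      then show ?thesis using max U(2,3) by blast
    qed
  qed (use lin_br sS sA AS A efh Sl Al in blast)+
  \<comment> \<open>The errors of the relations for \<open>[h, e]\<close> and \<open>[h, f]\<close>
    are split. The parts in the image of \<open>h - 2\<close> and \<open>h + 2\<close> vanish on
    passing to \<open>e - x\<close> and \<open>f - x'\<close>; the errors left have weight
    \<open>2\<close> and \<open>-2\<close>.\<close>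
  obtain e' x where 1: "e' \<in> S" "x \<in> S" "br h e' \<approx>[A] 2 *s e'" "br h e - 2 *s e \<approx>[A] e' + (br h x - 2 *s x)"
    using sl2.eigenspace_decomposition[of "br h e - 2 *s e" 2] efh(5) by (auto simp: eqm_iff[OF sS])
  obtain f' x' where 2: "f' \<in> S" "x' \<in> S" "br h f' \<approx>[A] (- 2) *s f'"
      "br h f - (- 2) *s f \<approx>[A] f' + (br h x' - (- 2) *s x')"
    using sl2.eigenspace_decomposition[of "br h f - (- 2) *s f" "- 2"] efh(6) by (auto simp: eqm_iff[OF sS])
  define e1 f1 where "e1 = e - x" and "f1 = f - x'"
  have Y1: "e1 \<in> Y" "f1 \<in> Y" unfolding e1_def f1_def using efh 1 2 SinY by (auto intro: subspace_diff sY)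
  have e1: "e1 \<approx>[S] e" and f1: "f1 \<approx>[S] f" using 1 2 subspace_neg[OF sS] by (auto simp: e1_def f1_def eqm_iff[OF sS])
  have he1: "br h e1 \<approx>[A] 2 *s e1 + e'"
  proof -
    have "br h e1 = (br h e - 2 *s e) + (2 *s e - br h x)" by (simp add: e1_def br_simps)
    also have "\<dots> \<approx>[A] (e' + (br h x - 2 *s x)) + (2 *s e - br h x)" by (intro eqm_add 1 eqm_refl)
    also have "\<dots> = 2 *s e1 + e'" by (simp add: e1_def scale_right_diff_distrib)
    finally show ?thesis .
  qed
  have hf1: "br h f1 \<approx>[A] (- 2) *s f1 + f'"
  proof -
    have "br h f1 = (br h f - (- 2) *s f) + ((- 2) *s f - br h x')" by (simp add: f1_def br_simps)
    also have "\<dots> \<approx>[A] (f' + (br h x' - (- 2) *s x')) + ((- 2) *s f - br h x')" by (intro eqm_add 2 eqm_refl)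
    also have "\<dots> = (- 2) *s f1 + f'" by (simp add: f1_def scale_right_diff_distrib)
    finally show ?thesis .
  qed
  define h1 r where "h1 = br e1 f1" and "r = h1 - h"
  have h1Y: "h1 \<in> Y" unfolding h1_def using Y1 Ybr by blast
  have r: "r \<in> S"
  proof -
    have "h1 \<approx>[S] br e f" unfolding h1_def using Y1 efh e1 f1 by (intro eqbr)
    then have "h1 \<approx>[S] h" using efh(7) by (rule eqm_trans)
    then show ?thesis by (simp add: r_def eqm_iff[OF sS])
  qed
  have h1_eq: "h1 = h + r" by (simp add: r_def)
  have brS: "y \<in> Y \<Longrightarrow> s \<in> S \<Longrightarrow> br y s \<in> S" for y s using Sl .
  \<comment> \<open>The Leibniz identity turns \<open>[h, r]\<close> into
    \<open>- [f, e'] + [e, f']\<close>, which has weight \<open>0\<close>. So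
    \<open>[h, [h, r]]\<close> vanishes modulo \<open>A\<close>, and diagonalizability removes one
    factor \<open>h\<close>.\<close>
  have hr: "br h r \<approx>[A] 0"
  proof -
    have m: "2 *s e1 + e' \<in> Y" "(- 2) *s f1 + f' \<in> Y"
      using Y1 1 2 SinY by (auto intro!: subspace_add subspace_scale sY simp del: scale_minus_left)
    have "br h r = br h h1 - br h h" by (simp add: r_def br_simps)
    also have "\<dots> \<approx>[A] br h h1 - 0" by (intro eqm_diff selfA efh eqm_refl)
    also have "\<dots> = br (br h e1) f1 + br e1 (br h f1)" unfolding h1_def by (simp only: leibniz[of h e1 f1] diff_zero)
    also have "\<dots> \<approx>[A] br (2 *s e1 + e') f1 + br e1 ((- 2) *s f1 + f')"
      by (intro eqm_add eqA he1 hf1 eqm_refl Y1 m Ybr efh)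
    also have "\<dots> = br e' f1 + br e1 f'" by (simp add: br_simps)
    also have "\<dots> \<approx>[A] - br f1 e' + br e f'"
      by (intro eqm_add flipA Y1 SinY 1 2 act e1)
    also have "\<dots> \<approx>[A] - br f e' + br e f'"
      by (intro eqm_add eqm_minus eqm_refl act f1 1)
    finally have hr: "br h r \<approx>[A] - br f e' + br e f'" .
    have "br h (br h r) \<approx>[A] br h (- br f e' + br e f')" using sl2.eqH[OF hr] .
    also have "\<dots> = - br h (br f e') + br h (br e f')" by (simp add: br_simps)
    also have "\<dots> \<approx>[A] - ((2 - 2) *s br f e') + (- 2 + 2) *s br e f'"
      by (intro eqm_add eqm_minus sl2.F_weight sl2.E_weight 1 2)
    finally have "br h (br h r) \<in> A" by (simp add: eqm_0[OF sA])
    then show ?thesis using sl2.H_square_kernel[OF r] by (simp add: eqm_0[OF sA])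
  qed
  have h1e1: "br h1 e1 \<approx>[A] 2 *s e1 + (e' - br e r)"
  proof -
    have "br h1 e1 = br h e1 + br r e1" by (simp add: h1_eq br_simps)
    also have "\<dots> \<approx>[A] (2 *s e1 + e') + - br e1 r" by (intro eqm_add he1 flipA SinY r Y1)
    also have "\<dots> \<approx>[A] (2 *s e1 + e') + - br e r" by (intro eqm_add eqm_minus eqm_refl act e1 r)
    finally show ?thesis by (simp add: algebra_simps)
  qed
  have h1f1: "br h1 f1 \<approx>[A] (- 2) *s f1 + (f' - br f r)"
  proof -
    have "br h1 f1 = br h f1 + br r f1" by (simp add: h1_eq br_simps)
    also have "\<dots> \<approx>[A] ((- 2) *s f1 + f') + - br f1 r" by (intro eqm_add hf1 flipA SinY r Y1)
    also have "\<dots> \<approx>[A] ((- 2) *s f1 + f') + - br f r" by (intro eqm_add eqm_minus eqm_refl act f1 r)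
    finally show ?thesis by (simp add: algebra_simps)
  qed
  have hr0: "br h r \<approx>[A] 0 *s r" using hr by simp
  \<comment> \<open>With \<open>r\<close> of weight \<open>0\<close>, the new error
    \<open>e' - [e, r]\<close> still has weight \<open>2\<close>, so it is
    \<open>[e, [e, y]]\<close> for some \<open>y\<close> of weight \<open>-2\<close>.\<close>
  have u1: "br h (e' - br e r) \<approx>[A] 2 *s (e' - br e r)"
    using eqm_diff[OF 1(3) sl2.E_weight[OF r hr0]] by (simp add: br_simps scale_right_diff_distrib)
  have w1: "br h (f' - br f r) \<approx>[A] (- 2) *s (f' - br f r)"
    using eqm_diff[OF 2(3) sl2.F_weight[OF r hr0]] by (simp add: br_simps scale_right_diff_distrib)
  have "e' - br e r \<in> S" by (intro subspace_diff sS 1 brS efh r)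
  then obtain y where y: "y \<in> S" "br h y \<approx>[A] (- 2) *s y" "br e (br e y) \<approx>[A] e' - br e r"
    using sl2.E_E_surj[OF _ u1] by blast
  \<comment> \<open>Adding \<open>y\<close> to \<open>f1\<close> changes the middle element by
    \<open>[e1, y]\<close> and its product with \<open>e1\<close> by \<open>- [e, [e, y]]\<close>,
    which cancels the error.\<close>
  define f2 h2 where "f2 = f1 + y" and "h2 = br e1 f2"
  have Y2: "f2 \<in> Y" "h2 \<in> Y" unfolding f2_def h2_def by (intro Ybr subspace_add sY Y1 SinY y)+
  have h2_eq: "h2 = h1 + br e1 y" by (simp add: h2_def h1_def f2_def br_simps)
  have e1y: "br e1 y \<in> S" using brS Y1 y by blast
  have h2e1: "br h2 e1 \<approx>[A] 2 *s e1"
  proof -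
    have "br h2 e1 = br h1 e1 + br (br e1 y) e1" by (simp add: h2_eq br_simps)
    also have "\<dots> \<approx>[A] (2 *s e1 + (e' - br e r)) + - br e1 (br e1 y)"
      by (intro eqm_add h1e1 flipA SinY e1y Y1)
    also have "\<dots> \<approx>[A] (2 *s e1 + (e' - br e r)) + - br e (br e1 y)"
      by (intro eqm_add eqm_minus eqm_refl act e1 e1y)
    also have "\<dots> \<approx>[A] (2 *s e1 + (e' - br e r)) + - br e (br e y)"
      by (intro eqm_add eqm_minus eqm_refl sl2.eqE act e1 y)
    also have "\<dots> \<approx>[A] (2 *s e1 + (e' - br e r)) + - (e' - br e r)"
      by (intro eqm_add eqm_minus eqm_refl y)
    finally show ?thesis by simp
  qed
  define w2 where "w2 = br h2 f2 - (- 2) *s f2"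
  have w2_eq: "w2 \<approx>[A] (f' - br f r) - br f (br e y)"
  proof -
    have "w2 = (br h1 f1 + 2 *s f1) + ((br h y + 2 *s y) + br r y) + (br (br e1 y) f1 + br (br e1 y) y)"
      by (simp add: w2_def h2_eq f2_def h1_eq br_simps scale_right_distrib algebra_simps)
    also have "\<dots> \<approx>[A] (((- 2) *s f1 + (f' - br f r)) + 2 *s f1) + (((- 2) *s y + 2 *s y) + 0) + (- br f1 (br e1 y) + 0)"
      by (intro eqm_add h1f1 y eqm_refl SS r e1y flipA SinY Y1)
    also have "\<dots> = (f' - br f r) - br f1 (br e1 y)" by simp
    also have "\<dots> \<approx>[A] (f' - br f r) - br f (br e1 y)" by (intro eqm_diff eqm_refl act f1 e1y)
    also have "\<dots> \<approx>[A] (f' - br f r) - br f (br e y)" by (intro eqm_diff eqm_refl sl2.eqF act e1 y)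
    finally show ?thesis .
  qed
  have w2S: "w2 \<in> S"
  proof -
    have "(f' - br f r) - br f (br e y) \<in> S" by (intro subspace_diff sS 2 brS efh r y)
    then show ?thesis using eqm_mem'[OF sS AS w2_eq] by blast
  qed
  have hw2: "br h w2 \<approx>[A] (- 2) *s w2"
  proof -
    have "br h (br f (br e y)) \<approx>[A] ((- 2 + 2) - 2) *s br f (br e y)"
      by (intro sl2.F_weight sl2.E_weight y brS efh)
    then have fey: "br h (br f (br e y)) \<approx>[A] (- 2) *s br f (br e y)" by simp
    have "br h w2 \<approx>[A] br h ((f' - br f r) - br f (br e y))" using sl2.eqH[OF w2_eq] .
    also have "\<dots> = br h (f' - br f r) - br h (br f (br e y))" by (simp only: br_simps)
    also have "\<dots> \<approx>[A] (- 2) *s (f' - br f r) - (- 2) *s br f (br e y)" by (intro eqm_diff w1 fey)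
    also have "\<dots> = (- 2) *s ((f' - br f r) - br f (br e y))" by (simp only: scale_right_diff_distrib)
    also have "\<dots> \<approx>[A] (- 2) *s w2" by (intro eqm_scale eqm_sym[OF w2_eq])
    finally show ?thesis .
  qed
  \<comment> \<open>The last error \<open>w2\<close> is killed by \<open>e\<close>, because
    expanding \<open>[h2, h2]\<close>, an element of \<open>A\<close>, leaves
    \<open>[e, w2]\<close>. Having weight \<open>-2\<close>, it lies in \<open>A\<close> by
    \<open>E_E_inj\<close>.\<close>
  have ew2: "br e w2 \<approx>[A] 0"
  proof -
    have m: "2 *s e1 \<in> Y" using Y1 subspace_scale[OF sY] by blast
    have "br h2 f2 = (- 2) *s f2 + w2" by (simp add: w2_def)
    then have "br h2 h2 = br (br h2 e1) f2 + br e1 ((- 2) *s f2 + w2)"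
      using leibniz[of h2 e1 f2] by (simp only: h2_def[symmetric])
    also have "\<dots> \<approx>[A] br (2 *s e1) f2 + br e1 ((- 2) *s f2 + w2)"
      by (intro eqm_add eqA h2e1 eqm_refl Ybr Y1 Y2 m)
    also have "\<dots> = br e1 w2" by (simp add: br_simps)
    also have "\<dots> \<approx>[A] br e w2" by (intro act e1 w2S)
    finally have "br e w2 \<approx>[A] br h2 h2" by (rule eqm_sym)
    then show ?thesis using selfA[OF Y2(2)] by (rule eqm_trans)
  qed
  then have "br e (br e w2) \<in> A" using Al[OF efh(1)] by (simp add: eqm_0[OF sA])
  then have "w2 \<in> A" by (rule sl2.E_E_inj[OF w2S hw2])
  then have h2f2: "br h2 f2 \<approx>[A] (- 2) *s f2" by (simp only: w2_def eqm_iff[OF sA])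
  define Z where "Z = span (A \<union> {e1, f2, h2})"
  have aZ: "subalg Z" unfolding Z_def
    by (rule subalg_sl2_extension[OF A(1) subalg_Y Y1(1) Y2 C h2e1 h2f2]) (simp add: h2_def)
  have ZY: "Z \<subseteq> Y" unfolding Z_def using AY Y1 Y2 by (intro span_minimal sY) auto
  have in_plus: "g \<in> sumset Z S" if "g' \<in> Z" "g' \<approx>[S] g" for g g'
  proof -
    have "g - g' \<in> S" using eqm_sym[OF that(2)] by (simp add: eqm_iff[OF sS])
    moreover have "g = g' + (g - g')" by simp
    ultimately show ?thesis using that(1) by blast
  qed
  have sp: "subspace (sumset Z S)" by (rule subspace_sums[OF subalgD(1)[OF aZ] sS])
  have f2: "f2 \<approx>[S] f" using eqm_add[OF f1, of y 0] y(1) by (simp add: f2_def eqm_0[OF sS])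
  have h2: "h2 \<approx>[S] h" using subspace_add[OF sS r e1y] by (simp add: h2_eq h1_eq eqm_iff[OF sS])
  have gZ: "e1 \<in> Z" "f2 \<in> Z" "h2 \<in> Z" by (auto simp: Z_def intro: span_base)
  have "Y \<subseteq> sumset Z S"
  proof -
    have "s \<in> sumset Z S" if "s \<in> S" for s
      using in_plus[OF subspace_0[OF subalgD(1)[OF aZ]]] eqm_sym[of s S 0] that by (simp add: eqm_0[OF sS])
    then have "S \<union> {e, f, h} \<subseteq> sumset Z S"
      using in_plus[OF gZ(1) e1] in_plus[OF gZ(2) f2] in_plus[OF gZ(3) h2] by blast
    then show ?thesis unfolding efh(4) by (rule span_minimal[OF _ sp])
  qed
  then have ZY: "Z = Y" by (rule frattini[OF aZ ZY])
  have eS: "e \<notin> S"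
  proof
    assume e: "e \<in> S"
    then have "br e f \<in> S" using Sr efh by blast
    then have h: "h \<in> S" using eqm_mem[OF sS efh(7)] by blast
    then have "br h f \<in> S" using Sr efh by blast
    then have "(- 2) *s f \<in> S" using eqm_mem[OF sS efh(6)] by blast
    then have "f \<in> S" using subspace_scale_iff[OF sS, of "- 2" f] by fastforce
    then have "Y \<subseteq> S" unfolding efh(4) using e h by (intro span_minimal sS) auto
    then show False using S_neq_Y SY by blast
  qed
  have "S \<subseteq> A"
  proof
    fix s assume s: "s \<in> S"
    then obtain a b c t where t: "s = ((t + c *s h2) + b *s f2) + a *s e1" "t \<in> A"
      using span_insert3_mem[OF sA, of s e1 f2 h2] SinY ZY unfolding Z_def by blast
    \<comment> \<open>Independence of \<open>e\<close>, \<open>f\<close>, \<open>h\<close> modulo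
      \<open>S\<close>: multiplying by \<open>e\<close> once turns \<open>g\<close> into
      \<open>-2 c e + b h\<close>, twice into \<open>-2 b e\<close>, so the coefficients vanish one
      after the other.\<close>
    define g where "g = (c *s h + b *s f) + a *s e"
    have "g \<approx>[S] (c *s h2 + b *s f2) + a *s e1"
      unfolding g_def by (intro eqm_add eqm_scale eqm_sym[OF h2] eqm_sym[OF f2] eqm_sym[OF e1])
    also have "\<dots> = s - t" by (simp add: t(1))
    finally have "g \<approx>[S] s - t" .
    then have g: "g \<in> S" using eqm_mem[OF sS] subspace_diff[OF sS s subsetD[OF AS t(2)]] by blast
    have gY: "g \<in> Y" using SinY[OF g] .
    have ee: "br e e \<approx>[S] 0" using br_self_S[OF efh(1)] by (simp add: eqm_0[OF sS])
    have eh: "br e h \<approx>[S] - (2 *s e)" using eqm_trans[OF flip_S[OF efh(1,3)] eqm_minus[OF efh(5)]] .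
    have "br e g = (c *s br e h + b *s br e f) + a *s br e e" by (simp add: g_def br_simps)
    also have "\<dots> \<approx>[S] (c *s - (2 *s e) + b *s h) + a *s 0" by (intro eqm_add eqm_scale eh efh ee)
    finally have "(c *s - (2 *s e) + b *s h) + a *s 0 \<in> S" using Sl[OF efh(1) g] eqm_mem[OF sS] by blast
    then have g2: "c *s - (2 *s e) + b *s h \<in> S" by simp
    have "br e (c *s - (2 *s e) + b *s h) = (- (c * 2)) *s br e e + b *s br e h" by (simp add: br_simps)
    also have "\<dots> \<approx>[S] (- (c * 2)) *s 0 + b *s - (2 *s e)" by (intro eqm_add eqm_scale eh ee)
    finally have "(- (b * 2)) *s e \<in> S" using Sl[OF efh(1) g2] eqm_mem[OF sS] by fastforce
    then have b: "b = 0" using subspace_scale_iff[OF sS, of "- (b * 2)" e] eS by fastforce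
    then have "(- (c * 2)) *s e \<in> S" using g2 by simp
    then have c: "c = 0" using subspace_scale_iff[OF sS, of "- (c * 2)" e] eS by fastforce
    have "a *s e \<in> S" using g b c by (simp add: g_def)
    then have "a = 0" using subspace_scale_iff[OF sS, of a e] eS by fastforce
    then show "s \<in> A" using t b c by simp
  qed
  then show False using A by blast
qed

lemma sl2_triple:
  "\<exists>e\<in>Y. \<exists>f\<in>Y. \<exists>h\<in>Y. e \<notin> R \<and> br h e \<approx>[leibniz_kernel] 2 *s e \<and>
     br h f \<approx>[leibniz_kernel] (- 2) *s f \<and> br e f \<approx>[leibniz_kernel] h"
proof -
  obtain e f h where efh: "e \<in> Y" "f \<in> Y" "h \<in> Y" "Y = span (S \<union> {e, f, h})" "br h e \<approx>[S] 2 *s e"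
    "br h f \<approx>[S] (- 2) *s f" "br e f \<approx>[S] h"
    by (rule sl2_quotient)
  have "e \<notin> R"
  proof
    assume "e \<in> R"
    then have eR: "e \<in> R" "br e f \<in> R" using ideal_ofD(4)[OF ideal_R] by blast+
    have SR: "S \<subseteq> R" and sR: "subspace R" using S_minimal kernel_R ideal_ofD(1)[OF ideal_R] by auto
    have h: "h \<in> R" using eqm_mem'[OF sR SR efh(7)] eR by blast
    then have "br h f \<in> R" using ideal_ofD(4)[OF ideal_R] by blast
    then have "(- 2) *s f \<in> R" using eqm_mem'[OF sR SR efh(6)] by blast
    then have "f \<in> R" using subspace_scale_iff[OF sR, of "- 2" f] by fastforce
    then have "Y \<subseteq> R" unfolding efh(4) using eR h SR by (intro span_minimal sR) auto
    then show False using nonsolv solv_subset by blast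
  qed
  then show ?thesis using efh eqm_mono[OF _ S_minimal] by blast
qed

end

context left_central_leibniz_algebra begin

text \<open>Inside \<open>J\<close> a minimal subalgebra \<open>Y\<close> not solvable modulo
  \<open>R\<close> is chosen, and in it a maximal solvable ideal \<open>S\<close> above
  \<open>R \<inter> Y\<close>. Relations modulo the kernel rather than modulo \<open>R\<close> are
  the point of the statement.\<close>

theorem nonsolvable_sl2_triple:
  assumes R: "ideal_of UNIV R" "leibniz_kernel \<subseteq> R" and J: "subalg J" "\<not> solv R J"
  shows "\<exists>e\<in>J. \<exists>f\<in>J. \<exists>h\<in>J. e \<notin> R \<and> br h e \<approx>[leibniz_kernel] 2 *s e \<and>
     br h f \<approx>[leibniz_kernel] (- 2) *s f \<and> br e f \<approx>[leibniz_kernel] h"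
proof -
  obtain Y where Y: "subalg Y \<and> \<not> solv R Y \<and> Y \<subseteq> J"
    and min: "\<And>V. (subalg V \<and> \<not> solv R V \<and> V \<subseteq> J) \<and> V \<subseteq> Y \<Longrightarrow> V = Y"
    using minimal_subspace_exists[of "\<lambda>Y. subalg Y \<and> \<not> solv R Y \<and> Y \<subseteq> J" J] J subalgD(1) by blast
  have "ideal_of Y (R \<inter> Y)" using ideal_of_inter[OF R(1)] Y by blast
  then have *: "ideal_of Y (R \<inter> Y) \<and> solv R (R \<inter> Y) \<and> R \<inter> Y \<subseteq> R \<inter> Y" using solv_subset by blast
  obtain S where S: "ideal_of Y S \<and> solv R S \<and> R \<inter> Y \<subseteq> S"
    and max: "\<And>V. (ideal_of Y V \<and> solv R V \<and> R \<inter> Y \<subseteq> V) \<and> S \<subseteq> V \<Longrightarrow> V = S"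
  proof -
    have "\<exists>S. (ideal_of Y S \<and> solv R S \<and> R \<inter> Y \<subseteq> S) \<and>
        (\<forall>V. (ideal_of Y V \<and> solv R V \<and> R \<inter> Y \<subseteq> V) \<and> S \<subseteq> V \<longrightarrow> V = S)"
      by (rule maximal_subspace_exists[where Q = "\<lambda>S. ideal_of Y S \<and> solv R S \<and> R \<inter> Y \<subseteq> S", OF *]) (elim conjE, rule ideal_ofD(1))
    then show thesis using that by (elim exE conjE) blast
  qed
  interpret minimal_nonsolvable scale br R Y S
  proof unfold_locales
    show "solv R Z" if "subalg Z" "Z \<subset> Y" for Z using min[of Z] that Y by blast
    show "S' = S" if "ideal_of Y S'" "solv R S'" "S \<subseteq> S'" for S' using max[of S'] that S by blast
  qed (use R Y S in blast)+
  show ?thesis using sl2_triple Y by blast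
qed

section \<open>The invariant form in rank one\<close>

text \<open>The kernel multiplies to zero from both sides, so inside products the three congruences
  become equations and the identity for \<open>[h, [e, f]]\<close> cancels exactly.\<close>

lemma sl2_triple_square:
  assumes he: "br h e \<approx>[leibniz_kernel] 2 *s e" and hf: "br h f \<approx>[leibniz_kernel] (- 2) *s f"
    and ef: "br e f \<approx>[leibniz_kernel] h"
  shows "br h h = 0"
proof -
  have right: "br a x = br a y" if "x \<approx>[leibniz_kernel] y" for a x y
    using br_kernel_right[of "x - y" a] that by (simp add: eqm_iff[OF subspace_kernel] br_simps)
  have left: "br x a = br y a" if "x \<approx>[leibniz_kernel] y" for a x y
    using br_kernel_left[of "x - y" a] that by (simp add: eqm_iff[OF subspace_kernel] br_simps)
  have "br h h = br h (br e f)" using right[OF ef] by simp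
  also have "\<dots> = br (br h e) f + br e (br h f)" by (rule leibniz)
  also have "\<dots> = 0" unfolding left[OF he] right[OF hf] by (simp add: br_simps)
  finally show ?thesis .
qed

definition perp :: "'a set \<Rightarrow> 'a set" where
  "perp W = {x. \<forall>w\<in>W. psi x w = 0}"

lemma subspace_perp: "subspace (perp W)"
  by (intro subspaceI) (auto simp: perp_def psi_simps)

lemma radical_subset_perp: "radical \<subseteq> perp W"
  by (auto simp: perp_def radical_def)

lemma ideal_perp:
  assumes "ideal_of UNIV W" shows "ideal_of UNIV (perp W)"
proof (rule ideal_of_left[OF subalg_UNIV subspace_perp])
  show "br y s \<in> perp W" if "s \<in> perp W" for y s
    using that ideal_ofD(3)[OF assms, of y] by (simp add: perp_def psi_invariant)
qed (use kernel_subset_radical radical_subset_perp in blast)+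

text \<open>Invariance moves \<open>b\<close> onto an arbitrary \<open>y\<close>, and
  \<open>[b, y]\<close> lies in the ideal \<open>B\<close>, to which \<open>x\<close> is
  orthogonal.\<close>

lemma br_perp:
  assumes B: "ideal_of UNIV B" and b: "b \<in> B" and x: "x \<in> perp B"
  shows "br b x \<in> radical" "br x b \<in> radical"
proof -
  have "psi (br b x) y = 0" for y
    unfolding psi_invariant using x ideal_ofD(4)[OF B, of y] b by (simp add: perp_def)
  then show 1: "br b x \<in> radical" by (simp add: radical_def)
  have "psi x b \<in> radical" using psi_in_kernel kernel_subset_radical by blast
  then show "br x b \<in> radical" unfolding br_flip[of x b] by (intro subspace_diff subspace_radical 1)
qed

end

locale rank_one_leibniz = left_central_leibniz_algebra +
  fixes z :: 'a
  assumes kernel_eq: "leibniz_kernel = span {z}" and z_neq_0: "z \<noteq> 0"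
begin

definition phi :: "'a \<Rightarrow> 'a \<Rightarrow> complex" where
  "phi a b = (SOME c. psi a b = c *s z)"

lemma psi_phi: "psi a b = phi a b *s z"
proof -
  have "\<exists>c. psi a b = c *s z" using psi_in_kernel[of a b] by (auto simp: kernel_eq span_singleton)
  then show ?thesis unfolding phi_def by (rule someI_ex)
qed

lemma phi_unique: "psi a b = c *s z \<Longrightarrow> phi a b = c"
  unfolding psi_phi using z_neq_0 by simp

lemma phi_eq_0_iff: "phi a b = 0 \<longleftrightarrow> psi a b = 0"
  unfolding psi_phi using z_neq_0 by simp

lemma phi_add_left: "phi (a + b) c = phi a c + phi b c"
  and phi_add_right: "phi c (a + b) = phi c a + phi c b"
  and phi_diff_left: "phi (a - b) c = phi a c - phi b c"
  and phi_scale_left: "phi (k *s a) c = k * phi a c"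
  and phi_scale_right: "phi c (k *s a) = k * phi c a"
  by (rule phi_unique; simp add: psi_simps vs_simps psi_phi[symmetric] scale_scale[symmetric] del: scale_scale)+

lemma phi_commute: "phi a b = phi b a"
  by (rule phi_unique) (simp add: psi_phi[symmetric] psi_commute)

lemma phi_invariant: "phi (br m a) b = - phi a (br m b)"
  by (rule phi_unique) (simp add: psi_phi[symmetric] psi_invariant)

lemma functional_phi: "functional (phi a)"
  by (simp add: functional_def phi_add_right phi_scale_right)

lemma radical_iff: "x \<in> radical \<longleftrightarrow> (\<forall>a. phi x a = 0)"
  by (simp add: radical_def phi_eq_0_iff)

text \<open>Modulo the radical the form is nondegenerate, so the map sending \<open>x\<close> to its
  values on a dual system is injective there, hence surjective.\<close>

lemma riesz:
  assumes g: "functional g" and gR: "\<And>r. r \<in> radical \<Longrightarrow> g r = 0"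
  obtains t where "\<And>x. g x = phi t x"
proof -
  obtain n v c where D: "dual_system radical n v c" using dual_system_exists[OF subspace_radical] by blast
  have c: "functional (c i)" "r \<in> radical \<Longrightarrow> c i r = 0"
    "j < n \<Longrightarrow> c i (v j) = (if i = j then 1 else 0)" if "i < n" for i r j
    using D that by (auto simp: dual_system_def)
  have expand: "d x = (\<Sum>i<n. c i x * d (v i))" if "functional d" "\<And>r. r \<in> radical \<Longrightarrow> d r = 0" for d x
  proof -
    have "d (x - (\<Sum>i<n. c i x *s v i)) = 0" using D that by (simp add: dual_system_def)
    then show ?thesis using that by (simp add: functional_diff functional_sum functional_scale)
  qed
  have phi_r: "phi a r = 0" if "r \<in> radical" for a r
    using that radical_iff[of r] by (simp add: phi_commute[of a r])
  have coord: "c j (\<Sum>i<n. d i *s v i) = d j" if "j < n" for d j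
  proof -
    have "c j (\<Sum>i<n. d i *s v i) = (\<Sum>i<n. d i * c j (v i))"
      using c(1)[OF that] by (simp add: functional_sum functional_scale)
    also have "\<dots> = (\<Sum>i<n. if i = j then d j else 0)"
      by (intro sum.cong refl) (use c(3)[OF that] in auto)
    finally show ?thesis using that by simp
  qed
  define T where "T x = (\<Sum>i<n. phi x (v i) *s v i)" for x
  have linT: "lin T"
    by (simp add: lin_def T_def phi_add_left phi_scale_left scale_left_distrib sum.distrib scale_sum_right)
  have Tr: "T r \<in> radical" if "r \<in> radical" for r
    using that subspace_0[OF subspace_radical] by (simp add: T_def radical_iff)
  have inj: "x \<in> radical" if "T x \<in> radical" for x
  proof -
    have "phi x (v j) = 0" if "j < n" for j
      using c(2)[OF that \<open>T x \<in> radical\<close>] coord[OF that, of "\<lambda>i. phi x (v i)"] by (simp add: T_def)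
    then have "phi x y = 0" for y using expand[OF functional_phi phi_r, of x y] by simp
    then show ?thesis by (simp add: radical_iff)
  qed
  obtain t where t: "(\<Sum>i<n. g (v i) *s v i) - T t \<in> radical"
  proof (rule inj_imp_surj_mod[OF linT subspace_radical subspace_UNIV subset_UNIV UNIV_I])
    show "T w \<in> radical" if "w \<in> radical" for w using that by (rule Tr)
    show "x \<in> radical" if "T x \<in> radical" for x using that by (rule inj)
  qed auto
  have "g (v j) = phi t (v j)" if "j < n" for j
    using c(2)[OF that t] c(1)[OF that] coord[OF that, of "\<lambda>i. phi t (v i)"] coord[OF that, of "\<lambda>i. g (v i)"]
    by (simp add: T_def functional_diff)
  then have "g x = phi t x" for x
    using expand[OF g gR, of x] expand[OF functional_phi phi_r, of t x] by simp
  then show thesis by (rule that)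
qed

text \<open>A functional vanishing on \<open>W\<close> but not at \<open>x\<close> is represented by
  an element of \<open>perp W\<close>, to which \<open>x\<close> is then not orthogonal.\<close>

lemma double_perp:
  assumes W: "subspace W" "radical \<subseteq> W" shows "perp (perp W) \<subseteq> W"
proof (rule subsetI, rule ccontr)
  fix x assume x: "x \<in> perp (perp W)" and xW: "x \<notin> W"
  obtain g where g: "functional g" "\<And>w. w \<in> W \<Longrightarrow> g w = 0" "g x = 1"
    using functional_exists[OF W(1) xW] by metis
  obtain t where t: "\<And>x. g x = phi t x" using riesz[OF g(1)] g(2) W(2) by blast
  have "t \<in> perp W" unfolding perp_def using g(2) t by (simp add: phi_eq_0_iff[symmetric])
  then have "phi x t = 0" using x unfolding perp_def by (simp add: phi_eq_0_iff)
  then show False using g(3) t phi_commute by simp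
qed

end

section \<open>The largest solvable ideal and its orthogonal space\<close>

locale rank_one_solvable_radical = rank_one_leibniz +
  fixes B :: "'a set"
  assumes ideal_B: "ideal_of UNIV B" and radical_B: "radical \<subseteq> B" and solv_B: "solv radical B"
    and greatest_B: "ideal_of UNIV I \<Longrightarrow> radical \<subseteq> I \<Longrightarrow> solv radical I \<Longrightarrow> I \<subseteq> B"
begin

lemmas sR = subspace_radical and Rl = ideal_ofD(3)[OF ideal_radical UNIV_I]
  and Rr = ideal_ofD(4)[OF ideal_radical UNIV_I]

lemma perp_B_subset: "perp B \<subseteq> B"
proof (rule ccontr)
  assume nIB: "\<not> perp B \<subseteq> B"
  note ideal_I = ideal_perp[OF ideal_B]
  obtain n v c where D: "dual_system radical n v c" using dual_system_exists[OF sR] by blast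
  have c: "functional (c i)" "r \<in> radical \<Longrightarrow> c i r = 0" if "i < n" for i r
    using D that by (auto simp: dual_system_def)
  \<comment> \<open>The Killing form of \<open>M / R\<close>, as a trace in coordinates of a dual
    system.\<close>
  define kappa where "kappa x y = (\<Sum>i<n. c i (br x (br y (v i))))" for x y
  have lin2: "lin (\<lambda>u. br x (br y u))" for x y
    by (simp add: lin_def br_simps)
  have RR: "br x (br y r) \<in> radical" if "r \<in> radical" for x y r using Rl that by blast
  have kappa_trace: "kappa x y = (\<Sum>i<m. c' i (br y (br x (v' i))))"
    if "dual_system radical m v' c'" for x y m v' c'
    unfolding kappa_def by (rule dual_system_trace_commute[OF D that lin_br Rl lin_br Rl])
  have kappa_commute: "kappa x y = kappa y x" for x y
    using kappa_trace[OF D] by (simp add: kappa_def)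
  have functional_kappa: "functional (kappa x)" for x
    using c(1) by (simp add: functional_def kappa_def br_simps sum.distrib sum_distrib_left)
  have kappa_zero: "kappa x y = 0" if "\<And>u. br x (br y u) \<in> radical" for x y
    unfolding kappa_def using that c(2) by (simp add: sum.neutral)
  have kappa_radical: "kappa x r = 0" if "r \<in> radical" for x r
    using Rl[OF Rr[OF that]] by (intro kappa_zero)
  have kappa_invariant: "kappa (br m x) y = - kappa x (br m y)" for m x y
  proof -
    have com: "br (br m x) w = br m (br x w) - br x (br m w)" for m x w using leibniz[of m x w] by simp
    have "(\<Sum>i<n. c i (br m (br x (br y (v i))))) = (\<Sum>i<n. c i (br x (br y (br m (v i)))))"
      using dual_system_trace_commute[OF D D lin_br Rl lin2 RR] .
    then have "kappa (br m x) y + kappa x (br m y) = 0"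
      unfolding kappa_def com sum.distrib[symmetric]
      by (simp add: br_simps c(1) functional_diff sum_subtractf)
    then show ?thesis by (simp add: eq_neg_iff_add_eq_0)
  qed
  have "\<exists>t. \<forall>y. kappa (v i) y = phi t y" for i
    using riesz[OF functional_kappa kappa_radical] by metis
  then obtain t where t: "\<And>i y. kappa (v i) y = phi (t i) y" by metis
  \<comment> \<open>\<open>T\<close> represents the Killing form by \<open>phi\<close>. Since both
    forms are invariant, \<open>T\<close> commutes with left multiplications modulo the radical,
    which sets up Schur's lemma.\<close>
  define T where "T x = (\<Sum>i<n. c i x *s t i)" for x
  have linT: "lin T" unfolding lin_def T_def using c(1)
    by (simp add: functional_add functional_scale scale_left_distrib sum.distrib scale_sum_right)
  have T: "phi (T x) y = kappa x y" for x y
  proof -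
    have "kappa y (x - (\<Sum>i<n. c i x *s v i)) = 0" using D kappa_radical by (simp add: dual_system_def)
    then have "kappa y x = (\<Sum>i<n. c i x * kappa y (v i))"
      by (simp add: functional_diff[OF functional_kappa] functional_sum[OF functional_kappa] functional_scale[OF functional_kappa])
    moreover have "phi y (T x) = (\<Sum>i<n. c i x * phi y (t i))"
      unfolding T_def by (simp add: functional_sum[OF functional_phi] phi_scale_right)
    moreover have "kappa y (v i) = phi y (t i)" for i
      using t[of i y] kappa_commute[of y "v i"] phi_commute[of y "t i"] by simp
    ultimately show ?thesis using kappa_commute[of x y] phi_commute[of "T x" y] by simp
  qed
  have T_br: "T (br m x) - br m (T x) \<in> radical" for m x
    unfolding radical_iff by (simp add: phi_diff_left T phi_invariant kappa_invariant)
  have TR: "T r \<in> radical" if "r \<in> radical" for r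
    unfolding radical_iff using kappa_radical[OF that] by (simp add: T kappa_commute[of r])
  have TI: "T x \<in> perp B" if "x \<in> perp B" for x
  proof -
    have "kappa x b = 0" if "b \<in> B" for b
      using br_perp(2)[OF ideal_B ideal_ofD(4)[OF ideal_B UNIV_I that] \<open>x \<in> perp B\<close>] by (rule kappa_zero)
    then show ?thesis by (simp add: perp_def phi_eq_0_iff[symmetric] T)
  qed
  \<comment> \<open>Minimality is taken among the \<open>T\<close>-stable ideals not contained in
    \<open>B\<close>, not among all ideals; this keeps an eigenvector of \<open>T\<close>
    available.\<close>
  define Q where "Q J \<longleftrightarrow> ideal_of UNIV J \<and> radical \<subseteq> J \<and> J \<subseteq> perp B \<and> \<not> J \<subseteq> B \<and> (\<forall>x\<in>J. T x \<in> J)" for J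
  have "Q (perp B)" using ideal_I radical_subset_perp nIB TI by (simp add: Q_def)
  then have "\<exists>J. Q J \<and> (\<forall>V. Q V \<and> V \<subseteq> J \<longrightarrow> V = J)"
    by (rule minimal_subspace_exists) (simp add: Q_def ideal_of_def)
  then obtain J where J: "Q J" and min: "\<And>V. Q V \<Longrightarrow> V \<subseteq> J \<Longrightarrow> V = J" by blast
  have ideal_J: "ideal_of UNIV J" and RJ: "radical \<subseteq> J" and JI: "J \<subseteq> perp B" and nJB: "\<not> J \<subseteq> B"
    and TJ: "\<And>x. x \<in> J \<Longrightarrow> T x \<in> J" using J by (auto simp: Q_def)
  note sJ = ideal_ofD(1)[OF ideal_J] and Jl = ideal_ofD(3)[OF ideal_J UNIV_I]
  note sB = ideal_ofD(1)[OF ideal_B] and Bl = ideal_ofD(3)[OF ideal_B UNIV_I]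
  define K where "K = J \<inter> B"
  have sK: "subspace K" and RK: "radical \<subseteq> K" and Kl: "\<And>m k. k \<in> K \<Longrightarrow> br m k \<in> K"
    using subspace_inter[OF sJ sB] RJ radical_B Jl Bl by (auto simp: K_def)
  \<comment> \<open>Modulo the radical \<open>[T k, T l]\<close> is \<open>T [T k, l]\<close>, and
    \<open>[T k, l]\<close> lies in the radical because \<open>T k\<close> is orthogonal to
    \<open>B\<close>. So the image of \<open>K\<close> with the radical is a solvable ideal,
    contained in \<open>B\<close>.\<close>
  have TK: "T k \<in> K" if k: "k \<in> K" for k
  proof -
    define N where "N = sumset (T ` K) radical"
    have sN: "subspace N" unfolding N_def by (intro subspace_sums lin_subspace_image linT sK sR)
    have inN: "T k + r \<in> N" if "k \<in> K" "r \<in> radical" for k r using that by (auto simp: N_def)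
    have RN: "radical \<subseteq> N" using inN[OF subspace_0[OF sK]] by (auto simp: lin_0[OF linT])
    have "ideal_of UNIV N"
    proof (rule ideal_of_left[OF subalg_UNIV sN])
      show "leibniz_kernel \<inter> UNIV \<subseteq> N" using kernel_subset_radical RN by blast
      fix m s assume "s \<in> N"
      then obtain k r where s: "s = T k + r" "k \<in> K" "r \<in> radical" by (auto simp: N_def)
      have "br m r - (T (br m k) - br m (T k)) \<in> radical"
        by (rule subspace_diff[OF sR Rl[OF s(3)] T_br])
      then have "T (br m k) + (br m r - (T (br m k) - br m (T k))) \<in> N" using Kl s by (intro inN)
      then show "br m s \<in> N" by (simp add: s br_simps add.commute)
    qed auto
    moreover have "solv radical N"
    proof -
      have "br a b \<in> radical" if "a \<in> N" "b \<in> N" for a b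
      proof -
        obtain k r where a: "a = T k + r" "k \<in> K" "r \<in> radical" using \<open>a \<in> N\<close> by (auto simp: N_def)
        obtain l s where b: "b = T l + s" "l \<in> K" "s \<in> radical" using \<open>b \<in> N\<close> by (auto simp: N_def)
        have "T k \<in> perp B" using a TI JI by (auto simp: K_def)
        then have "br (T k) l \<in> radical" using br_perp(2)[OF ideal_B] b by (auto simp: K_def)
        then have "T (br (T k) l) - (T (br (T k) l) - br (T k) (T l)) \<in> radical"
          by (rule subspace_diff[OF sR TR T_br])
        then have "br (T k) (T l) \<in> radical" by simp
        then have "br (T k) (T l) + (br (T k) s + br r b) \<in> radical" using Rl Rr a b by (intro subspace_add sR)
        then show ?thesis by (simp add: a b br_simps add_ac)
      qed
      then have "dser N 1 \<subseteq> radical" unfolding One_nat_def by (intro dser_Suc_subset sR) simp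
      then show ?thesis unfolding solv_def by blast
    qed
    ultimately have "N \<subseteq> B" using RN by (intro greatest_B)
    moreover have "T k \<in> N" using inN[OF k subspace_0[OF sR]] by simp
    ultimately show ?thesis using TJ k by (auto simp: K_def)
  qed
  have KJ: "K \<subset> J" using nJB by (auto simp: K_def)
  \<comment> \<open>Schur's lemma on \<open>J / K\<close>: the elements of \<open>J\<close> sent
    into \<open>K\<close> by \<open>T - a\<close> again satisfy \<open>Q\<close>, so they exhaust
    \<open>J\<close>.\<close>
  obtain x a where x: "x \<in> J" "x \<notin> K" "T x - a *s x \<in> K"
    using eigenvector_mod[OF linT sK sJ KJ TJ TK] by blast
  define S where "S y = T y - a *s y" for y
  have linS: "lin S" by (auto simp: S_def lin_def lin_add[OF linT] lin_scale[OF linT] vs_simps)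
  define E where "E = J \<inter> {y. S y \<in> K}"
  have sE: "subspace E" unfolding E_def by (intro subspace_inter lin_subspace_vimage linS sK sJ)
  have "Q E"
    unfolding Q_def
  proof (intro conjI ballI)
    have RS: "S r \<in> K" if "r \<in> radical" for r
      unfolding S_def using TR[OF that] that RK by (intro subspace_diff subspace_scale sK) auto
    then show RE: "radical \<subseteq> E" using RJ by (auto simp: E_def)
    show "ideal_of UNIV E"
    proof (rule ideal_of_left[OF subalg_UNIV sE])
      show "leibniz_kernel \<inter> UNIV \<subseteq> E" using kernel_subset_radical RE by blast
      fix m y assume y: "y \<in> E"
      have "S (br m y) = br m (S y) + (T (br m y) - br m (T y))" by (simp add: S_def br_simps)
      also have "\<dots> \<in> K" using y Kl T_br RK by (intro subspace_add sK) (auto simp: E_def)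
      finally show "br m y \<in> E" using y Jl by (simp add: E_def)
    qed auto
    show "E \<subseteq> perp B" using JI by (auto simp: E_def)
    show "\<not> E \<subseteq> B" using x by (auto simp: E_def K_def S_def)
    show "T y \<in> E" if y: "y \<in> E" for y
    proof -
      have "S (T y) = T (S y)" by (simp add: S_def lin_diff[OF linT] lin_scale[OF linT])
      then show ?thesis using y TJ TK by (auto simp: E_def)
    qed
  qed
  then have EJ: "E = J" by (rule min) (auto simp: E_def)
  have "\<not> solv radical J" using greatest_B[OF ideal_J RJ] nJB by blast
  then obtain e f h where efh: "e \<in> J" "f \<in> J" "h \<in> J" "e \<notin> radical" "br h e \<approx>[leibniz_kernel] 2 *s e"
    "br h f \<approx>[leibniz_kernel] (- 2) *s f" "br e f \<approx>[leibniz_kernel] h"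
    using nonsolvable_sl2_triple[OF ideal_radical kernel_subset_radical ideal_of_subalg[OF ideal_J]] by blast
  have "psi h h = 0" using sl2_triple_square[OF efh(5-7)] by (simp add: psi_def)
  then have phh: "phi h h = 0" by (simp add: phi_eq_0_iff)
  \<comment> \<open>The element \<open>T h - a h\<close> lies in \<open>B\<close>, and
    \<open>h\<close> is orthogonal to \<open>B\<close>; so \<open>kappa h h = a * phi h h\<close>,
    which vanishes.\<close>
  have "kappa h h = 0"
  proof -
    have "S h \<in> B" using efh(3) EJ by (auto simp: E_def K_def)
    moreover have "h \<in> perp B" using efh JI by blast
    ultimately have "phi h (S h) = 0" by (simp add: perp_def phi_eq_0_iff)
    then have "phi (S h) h = 0" by (simp add: phi_commute)
    then have "phi (T h) h = a * phi h h" by (simp add: S_def phi_diff_left phi_scale_left)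
    then show ?thesis using phh by (simp add: T)
  qed
  have left: "br p u = br q u" if "p \<approx>[leibniz_kernel] q" for p q u
    using br_kernel_left[of "p - q" u] that by (simp add: eqm_iff[OF subspace_kernel] br_simps)
  interpret sl2: sl2_subquotient scale UNIV radical "br e" "br f" "br h"
  proof unfold_locales
    show "br h (br e x) \<approx>[radical] br e (br h x) + 2 *s br e x" for x
      unfolding leibniz[of h e x] left[OF efh(5)] by (simp add: br_simps add.commute)
    show "br h (br f x) \<approx>[radical] br f (br h x) - 2 *s br f x" for x
      unfolding leibniz[of h f x] left[OF efh(6)] by (simp add: br_simps)
    show "br e (br f x) \<approx>[radical] br f (br e x) + br h x" for x
      unfolding leibniz[of e f x] left[OF efh(7)] by (simp add: add.commute)
  qed (use lin_br sR Rl in auto)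
  have real: "y \<in> radical" if "d \<notin> \<real>" "br h y \<approx>[radical] d *s y" for d y
    using sl2.weight_is_real[OF UNIV_I _ that(2)] that(1) by blast
  have he: "br h e \<approx>[radical] 2 *s e" using eqm_mono[OF efh(5) kernel_subset_radical] .
  \<comment> \<open>Splitting off \<open>e\<close>, of eigenvalue \<open>2\<close> under
    \<open>h\<close>, isolates the contribution \<open>4\<close>; the rest of the trace is
    nonnegative as all weights are real.\<close>
  define W where "W = span (insert e radical)"
  have sW: "subspace W" and RW: "radical \<subseteq> W" by (auto simp: W_def intro: span_base)
  have hW: "br h w \<in> W" if "w \<in> W" for w
    using span_insert_eigenvector_invariant[OF lin_br sR Rl he] that by (simp add: W_def)
  have real': "y \<in> W" if "d \<notin> \<real>" "br h y \<approx>[W] d *s y" for d y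
    by (rule real_eigenvalues_mono[OF lin_br sR sW RW _ _ _ that]) (use Rl hW real in blast)+
  obtain m w d s where W: "dual_system W m w d" "0 \<le> s" "(\<Sum>i<m. d i (br h (br h (w i)))) = complex_of_real s"
  proof -
    have "\<exists>m w d s. dual_system W m w d \<and> 0 \<le> s \<and> (\<Sum>i<m. d i (br h (br h (w i)))) = complex_of_real s"
      by (rule dual_system_trace_square[OF lin_br sW]) (fact hW, fact real')
    then show thesis using that by (elim exE conjE)
  qed
  obtain m' w' d' where W': "dual_system radical m' w' d'"
    "(\<Sum>i<m'. d' i (br h (br h (w' i)))) = 2 * 2 + (\<Sum>i<m. d i (br h (br h (w i))))"
    using dual_system_trace_extend[OF lin_br sR Rl efh(4) he W(1)[unfolded W_def]] by blast
  have "kappa h h = complex_of_real (4 + s)"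
    using kappa_trace[OF W'(1), of h h] W'(2) W(3) by simp
  then have "4 + s = 0" using \<open>kappa h h = 0\<close> by (metis of_real_eq_0_iff)
  then show False using W(2) by simp
qed

lemma phi_square_sum:
  "phi (x + a *s y) (x + a *s y) = phi x x + 2 * a * phi x y + a\<^sup>2 * phi y y"
  by (simp add: phi_add_left phi_add_right phi_scale_left phi_scale_right phi_commute[of y x]
      power2_eq_square algebra_simps)

lemma maximal_isotropic_ideal:
  obtains L where "perp B \<subseteq> L" "L \<subseteq> B" "maximal_isotropic L" "\<And>b l. b \<in> B \<Longrightarrow> l \<in> L \<Longrightarrow> br b l \<in> L"
proof -
  note sB = ideal_ofD(1)[OF ideal_B]
  define Q where "Q L \<longleftrightarrow> isotropic L \<and> perp B \<subseteq> L \<and> L \<subseteq> B \<and> (\<forall>b\<in>B. \<forall>l\<in>L. br b l \<in> L)" for L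
  have "br b l \<in> perp B" if "l \<in> perp B" for b l
    using ideal_ofD(3)[OF ideal_perp[OF ideal_B] UNIV_I that] .
  then have "Q (perp B)"
    unfolding Q_def isotropic_def using subspace_perp perp_B_subset by (auto simp: perp_def)
  then have "\<exists>L. Q L \<and> (\<forall>V. Q V \<and> L \<subseteq> V \<longrightarrow> V = L)"
    by (rule maximal_subspace_exists) (simp add: Q_def isotropic_def)
  then obtain L where QL: "Q L" and max: "\<And>V. Q V \<Longrightarrow> L \<subseteq> V \<Longrightarrow> V = L" by blast
  have iso: "isotropic L" and sL: "subspace L" and IL: "perp B \<subseteq> L" and LB: "L \<subseteq> B"
    and BL: "\<And>b l. b \<in> B \<Longrightarrow> l \<in> L \<Longrightarrow> br b l \<in> L"
    and LL: "\<And>a b. a \<in> L \<Longrightarrow> b \<in> L \<Longrightarrow> psi a b = 0"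
    using QL by (auto simp: Q_def isotropic_def)
  have RL: "radical \<subseteq> L" using IL radical_subset_perp by blast
  \<comment> \<open>From \<open>perp B \<subseteq> L\<close> it follows that \<open>perp L\<close>
    lies in \<open>perp (perp B)\<close>. Thus extensions of \<open>L\<close> inside
    \<open>perp L\<close> stay in \<open>B\<close>.\<close>
  have pLB: "perp L \<subseteq> B"
    using double_perp[OF sB radical_B] IL by (auto simp: perp_def)
  have LpL: "L \<subseteq> perp L" using LL by (auto simp: perp_def)
  have BpL: "br b x \<in> perp L" if "b \<in> B" "x \<in> perp L" for b x
    using that BL by (auto simp: perp_def psi_invariant)
  have orth: "psi x l = 0" "phi x l = 0" "phi l x = 0" if "x \<in> perp L" "l \<in> L" for x l
    using that phi_commute[of l x] by (auto simp: perp_def phi_eq_0_iff)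
  have extend: "w \<in> L" if w: "w \<in> perp L" "phi w w = 0" and ev: "\<And>b. b \<in> B \<Longrightarrow> \<exists>c. br b w - c *s w \<in> L" for w
  proof -
    define V where "V = span (insert w L)"
    have sV: "subspace V" and LV: "L \<subseteq> V" "w \<in> V" by (auto simp: V_def intro: span_base)
    have "V \<subseteq> B" unfolding V_def using w(1) pLB LB by (intro span_minimal sB) auto
    moreover have "psi a b = 0" if ab: "a \<in> V" "b \<in> V" for a b
    proof -
      obtain k l where a: "a = l + k *s w" "l \<in> L" using span_insert_mem[OF sL ab(1)[unfolded V_def]] .
      obtain k' l' where b: "b = l' + k' *s w" "l' \<in> L" using span_insert_mem[OF sL ab(2)[unfolded V_def]] .
      have "phi l l' = 0" using LL a b by (simp add: phi_eq_0_iff)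
      then have "phi a b = 0" using orth(2,3)[OF w(1)] a b w(2)
        by (simp add: phi_add_left phi_add_right phi_scale_left phi_scale_right)
      then show ?thesis by (simp add: phi_eq_0_iff)
    qed
    moreover have "br b u \<in> V" if b: "b \<in> B" and u: "u \<in> V" for b u
    proof -
      obtain k l where u: "u = l + k *s w" "l \<in> L" using span_insert_mem[OF sL u[unfolded V_def]] .
      obtain c where "br b w - c *s w \<in> L" using ev[OF b] by blast
      then have "(br b w - c *s w) + c *s w \<in> V" using LV by (intro subspace_add subspace_scale sV) auto
      then have "br b w \<in> V" by simp
      moreover have "br b l \<in> V" using BL[OF b u(2)] LV by blast
      ultimately show ?thesis unfolding u(1) br_simps by (intro subspace_add subspace_scale sV)
    qed
    ultimately have "Q V" using sV IL LV by (auto simp: Q_def isotropic_def)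
    then show ?thesis using max LV by blast
  qed
  obtain n where n: "dser B n \<subseteq> radical" using solv_B by (auto simp: solv_def)
  \<comment> \<open>Lie's theorem gives a \<open>B\<close>-eigenvector outside \<open>L\<close>. By
    maximality it is anisotropic, and invariance makes \<open>[b, w]\<close> orthogonal to
    \<open>w\<close>, so its weight is zero.\<close>
  have anisotropic: "\<exists>w\<in>X - L. phi w w \<noteq> 0 \<and> (\<forall>b\<in>B. br b w \<in> L)"
    if X: "subspace X" "L \<subset> X" "X \<subseteq> perp L" and BX: "\<And>b x. b \<in> B \<Longrightarrow> x \<in> X \<Longrightarrow> br b x \<in> X" for X
  proof -
    have "\<exists>w\<in>X - L. \<forall>b\<in>B. \<exists>c. br b w - c *s w \<in> L"
    proof (rule lie_theorem[OF ideal_of_subalg[OF ideal_B] X(1) sL X(2)])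
      show "br d u \<in> L" if "d \<in> dser B n" for d u using that n Rr RL by blast
    qed (use BX BL in blast)+
    then obtain w where w: "w \<in> X" "w \<notin> L" and ev: "\<And>b. b \<in> B \<Longrightarrow> \<exists>c. br b w - c *s w \<in> L" by blast
    have wp: "w \<in> perp L" using w X(3) by blast
    have ww: "phi w w \<noteq> 0" using extend[OF wp _ ev] w(2) by blast
    have "br b w \<in> L" if b: "b \<in> B" for b
    proof -
      obtain c where c: "br b w - c *s w \<in> L" using ev[OF b] by blast
      have "phi (br b w) w = - phi (br b w) w" using phi_invariant[of b w w] phi_commute by simp
      then have "phi (br b w) w = 0" by simp
      moreover have "phi (br b w - c *s w) w = 0" using orth(3)[OF wp c] .
      ultimately have "c * phi w w = 0" by (simp add: phi_diff_left phi_scale_left)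
      then show ?thesis using c ww by simp
    qed
    then show ?thesis using w ww by blast
  qed
  have "V = L" if V: "isotropic V" "L \<subseteq> V" for V
  proof (rule ccontr)
    assume "V \<noteq> L"
    then obtain v where v: "v \<in> V" "v \<notin> L" using V(2) by blast
    have vv: "psi v v = 0" using V(1) v by (simp add: isotropic_def)
    have vp: "v \<in> perp L" using V v by (auto simp: perp_def isotropic_def)
    then have "L \<subset> perp L" using LpL v by blast
    then obtain w where w: "w \<in> perp L" "w \<notin> L" "phi w w \<noteq> 0" "\<And>b. b \<in> B \<Longrightarrow> br b w \<in> L"
      using anisotropic[OF subspace_perp _ order_refl] BpL by blast
    define X where "X = perp L \<inter> perp {w}"
    have sX: "subspace X" unfolding X_def by (intro subspace_inter subspace_perp)
    have LX: "L \<subseteq> X" using LpL orth(3)[OF w(1)] by (auto simp: X_def perp_def phi_eq_0_iff)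
    have BX: "br b x \<in> X" if "b \<in> B" "x \<in> X" for b x
      using that BpL w(4) by (auto simp: X_def perp_def psi_invariant)
    have "X = L"
    proof (rule ccontr)
      assume "X \<noteq> L"
      then have "L \<subset> X" using LX by blast
      moreover have "X \<subseteq> perp L" by (auto simp: X_def)
      ultimately obtain w' where w': "w' \<in> X" "phi w' w' \<noteq> 0" "\<And>b. b \<in> B \<Longrightarrow> br b w' \<in> L"
        using anisotropic[OF sX _ _ BX] by blast
      have w'p: "w' \<in> perp L" and ww': "phi w w' = 0"
        using w'(1) phi_commute[of w w'] by (auto simp: X_def perp_def phi_eq_0_iff)
      \<comment> \<open>Chosen so that \<open>phi (w + k *s w') (w + k *s w')\<close> vanishes for
        the orthogonal vectors \<open>w\<close> and \<open>w'\<close>.\<close>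
      define k where "k = csqrt (- phi w w / phi w' w')"
      define u where "u = w + k *s w'"
      have k2: "k\<^sup>2 * phi w' w' = - phi w w" using w'(2) by (simp add: k_def)
      have "phi u u = 0" unfolding u_def phi_square_sum using ww' k2 by simp
      moreover have up: "u \<in> perp L" unfolding u_def by (intro subspace_add subspace_scale subspace_perp w w'p)
      moreover have "br b u \<in> L" if "b \<in> B" for b
        unfolding u_def br_simps by (intro subspace_add subspace_scale sL w w' that)
      then have "\<exists>c. br b u - c *s u \<in> L" if "b \<in> B" for b using that by (intro exI[of _ 0]) simp
      ultimately have "u \<in> L" by (intro extend)
      then have "phi w' u = 0" using orth(2)[OF w'p] by blast
      then have "k * phi w' w' = 0" using ww' phi_commute[of w' w] by (simp add: u_def phi_add_right phi_scale_right)
      then show False using k2 w(3) w'(2) by simp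
    qed
    \<comment> \<open>Now \<open>perp L\<close> is \<open>L\<close> plus the line of
      \<open>w\<close>, so \<open>v\<close> lies in \<open>L\<close> up to \<open>a\<close> times
      \<open>w\<close>; isotropy of \<open>v\<close> forces \<open>a = 0\<close>.\<close>
    define a where "a = phi v w / phi w w"
    have "v - a *s w \<in> perp {w}"
      using w(3) by (simp add: perp_def phi_eq_0_iff[symmetric] phi_diff_left phi_scale_left a_def)
    then have "v - a *s w \<in> X" using vp w(1) unfolding X_def by (auto intro: subspace_diff subspace_scale subspace_perp)
    then have l: "v - a *s w \<in> L" using \<open>X = L\<close> by simp
    have "phi ((v - a *s w) + a *s w) ((v - a *s w) + a *s w) = a\<^sup>2 * phi w w"
      unfolding phi_square_sum using orth(3)[OF w(1) l] LL[OF l l] by (simp add: phi_eq_0_iff[symmetric])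
    then have "a = 0" using vv w(3) by (simp add: phi_eq_0_iff[symmetric])
    then show False using l v by simp
  qed
  then have "maximal_isotropic L" using iso by (auto simp: maximal_isotropic_def)
  then show thesis using that IL LB BL by blast
qed

end

section \<open>Isotropic subspaces as Lie subalgebras\<close>

context left_central_leibniz_algebra begin

lemma lie_subalgebra_of_isotropic:
  assumes L: "isotropic L" and br: "\<And>a b. a \<in> L \<Longrightarrow> b \<in> L \<Longrightarrow> br a b \<in> L"
  shows "lie_subalgebra L"
proof -
  have anti: "br a b = - br b a" if "a \<in> L" "b \<in> L" for a b
    using L that by (simp add: isotropic_def br_flip[of a b])
  have self: "br a a = 0" if "a \<in> L" for a
  proof -
    have "2 *s br a a = psi a a" using scale_left_distrib[of 1 1 "br a a"] by (simp add: psi_def)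
    then show ?thesis using L that by (simp add: isotropic_def)
  qed
  have "br a (br b c) + br b (br c a) + br c (br a b) = 0" if "a \<in> L" "b \<in> L" "c \<in> L" for a b c
    using leibniz[of a b c] anti[of c a] anti[of c "br a b"] br that by (simp add: br_simps)
  then show ?thesis using L br self by (auto simp: lie_subalgebra_def isotropic_def)
qed

lemma lie_subalgebra_isotropic: assumes "lie_subalgebra K" shows "isotropic K"
proof -
  have "psi a b = 0" if "a \<in> K" "b \<in> K" for a b
  proof -
    have "a + b \<in> K" using assms that by (auto simp: lie_subalgebra_def intro: subspace_add)
    then have "br (a + b) (a + b) = 0" "br a a = 0" "br b b = 0" using assms that by (auto simp: lie_subalgebra_def)
    then show ?thesis by (simp add: psi_def br_simps add.commute)
  qed
  then show ?thesis using assms by (simp add: isotropic_def lie_subalgebra_def)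
qed

text \<open>Every Lie subalgebra is isotropic, so maximality among isotropic subspaces is the
  stronger condition for a closed \<open>L\<close>.\<close>

lemma maximal_lie_of_maximal_isotropic:
  assumes "maximal_isotropic L" "\<And>a b. a \<in> L \<Longrightarrow> b \<in> L \<Longrightarrow> br a b \<in> L"
  shows "L \<in> maximal_lie_subalgebras"
proof -
  have iso: "isotropic L" and max: "\<And>V. isotropic V \<Longrightarrow> L \<subseteq> V \<Longrightarrow> V = L"
    using assms(1) by (simp_all add: maximal_isotropic_def)
  have "K = L" if "lie_subalgebra K" "L \<subseteq> K" for K
    using max[OF lie_subalgebra_isotropic[OF that(1)] that(2)] .
  then show ?thesis
    using lie_subalgebra_of_isotropic[OF iso assms(2)] by (simp add: maximal_lie_subalgebras_def)
qed

text \<open>A maximal solvable ideal is the greatest one, since the sum of two solvable ideals is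
  solvable by \<open>solv_plus\<close>.\<close>

lemma greatest_solvable_ideal:
  assumes R: "ideal_of UNIV R"
  obtains B where "ideal_of UNIV B" "R \<subseteq> B" "solv R B"
    "\<And>I. ideal_of UNIV I \<Longrightarrow> R \<subseteq> I \<Longrightarrow> solv R I \<Longrightarrow> I \<subseteq> B"
proof -
  define Q where "Q I \<longleftrightarrow> ideal_of UNIV I \<and> R \<subseteq> I \<and> solv R I" for I
  have "Q R" using R solv_subset by (simp add: Q_def)
  then have "\<exists>B. Q B \<and> (\<forall>V. Q V \<and> B \<subseteq> V \<longrightarrow> V = B)"
    by (rule maximal_subspace_exists) (simp add: Q_def ideal_of_def)
  then obtain B where B: "Q B" and max: "\<And>V. Q V \<Longrightarrow> B \<subseteq> V \<Longrightarrow> V = B" by blast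
  have "I \<subseteq> B" if "ideal_of UNIV I" "R \<subseteq> I" "solv R I" for I
  proof -
    define V where "V = sumset B I"
    have iB: "ideal_of UNIV B" using B by (simp add: Q_def)
    have iV: "ideal_of UNIV V" unfolding V_def using iB that(1) subspace_UNIV by (rule ideal_of_plus)
    have inV: "a \<in> B \<Longrightarrow> b \<in> I \<Longrightarrow> a + b \<in> V" for a b by (auto simp: V_def)
    have BV: "B \<subseteq> V" using inV[OF _ subspace_0[OF ideal_ofD(1)[OF that(1)]]] by auto
    have IV: "I \<subseteq> V" using inV[OF subspace_0[OF ideal_ofD(1)[OF iB]]] by auto
    have "solv R V"
    proof (rule solv_plus[OF ideal_of_subalg[OF iB] BV])
      show "ideal_of V I" using ideal_of_mono[OF that(1) IV] by simp
    qed (use B that in \<open>auto simp: Q_def V_def\<close>)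
    then have "Q V" using iV BV B by (auto simp: Q_def)
    then show ?thesis using max BV IV by blast
  qed
  then show thesis using B unfolding Q_def by (intro that) blast+
qed

end

section \<open>Quotients by ideals\<close>

locale leibniz_quotient = left_central_leibniz_algebra +
  fixes R :: "'a set"
  assumes ideal_R: "ideal_of UNIV R"
begin

lemmas sR = ideal_ofD(1)[OF ideal_R] and Rl = ideal_ofD(3)[OF ideal_R UNIV_I]
  and Rr = ideal_ofD(4)[OF ideal_R UNIV_I]

definition coset :: "'a \<Rightarrow> 'a set" where "coset x = x +o R"

lemma coset_mem: "y \<in> coset x \<longleftrightarrow> y - x \<in> R"
proof
  assume "y \<in> coset x"
  then show "y - x \<in> R" by (auto simp: coset_def elt_set_plus_def)
next
  assume "y - x \<in> R"
  moreover have "y = x + (y - x)" by simp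
  ultimately show "y \<in> coset x" unfolding coset_def elt_set_plus_def by blast
qed

lemma coset_eq_iff: "coset x = coset y \<longleftrightarrow> x - y \<in> R"
proof
  assume "coset x = coset y"
  moreover have "x \<in> coset x" using subspace_0[OF sR] by (simp add: coset_mem)
  ultimately show "x - y \<in> R" using coset_mem by blast
next
  assume xy: "x - y \<in> R"
  have "u - x \<in> R \<longleftrightarrow> u - y \<in> R" for u
    using subspace_add[OF sR _ xy, of "u - x"] subspace_diff[OF sR _ xy, of "u - y"] by auto
  then show "coset x = coset y" by (auto simp: coset_mem)
qed

lemma coset_0: "coset 0 = R"
  by (auto simp: coset_mem)

lemma coset_eq_R: "coset x = R \<longleftrightarrow> x \<in> R"
  using coset_eq_iff[of x 0] by (simp add: coset_0)

lemma coset_add: "coset x + coset y = coset (x + y)"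
proof -
  have "R + R = R"
  proof
    show "R + R \<subseteq> R" using subspace_add[OF sR] by (auto simp: set_plus_def)
    show "R \<subseteq> R + R" using subspace_0[OF sR] by (force simp: set_plus_def)
  qed
  then show ?thesis by (simp add: coset_def set_plus_rearrange)
qed

lemma quotient_simps:
  "lcarrier (quotient U R) = coset ` U" "lzero (quotient U R) = R"
  "ladd (quotient U R) (coset x) (coset y) = coset (x + y)"
  "lscale (quotient U R) c (coset x) = coset (c *s x)"
  "lbr (quotient U R) (coset x) (coset y) = coset (br x y)"
proof -
  show "lcarrier (quotient U R) = coset ` U" "lzero (quotient U R) = R"
    by (auto simp: quotient_def coset_def)
  show "ladd (quotient U R) (coset x) (coset y) = coset (x + y)"
    by (simp add: quotient_def coset_add)
  have self: "coset x \<noteq> {}" for x using subspace_0[OF sR] coset_mem[of x x] by auto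
  have 1: "coset (c *s x') = coset (c *s x)" if "x' \<in> coset x" for x'
    using subspace_scale[OF sR, of "x' - x" c] that by (simp add: coset_eq_iff coset_mem scale_right_diff_distrib)
  then have "(\<Union>x'\<in>coset x. coset (c *s x')) = coset (c *s x)" by (intro SUP_eq_const self)
  then show "lscale (quotient U R) c (coset x) = coset (c *s x)"
    by (simp add: quotient_def coset_def)
  have 2: "coset (br x' y') = coset (br x y)" if "x' \<in> coset x" "y' \<in> coset y" for x' y'
  proof -
    have "br (x' - x) y' + br x (y' - y) \<in> R" using that Rl Rr by (intro subspace_add sR) (simp_all add: coset_mem)
    then show ?thesis by (simp add: coset_eq_iff br_simps)
  qed
  then have "(\<Union>x'\<in>coset x. \<Union>y'\<in>coset y. coset (br x' y')) = coset (br x y)"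
    by (intro SUP_eq_const self)
  then show "lbr (quotient U R) (coset x) (coset y) = coset (br x y)"
    by (simp add: quotient_def coset_def)
qed

lemma quotient_restrict: "quotient V R\<lparr>lcarrier := coset ` U\<rparr> = quotient U R"
  by (simp add: quotient_def coset_def[abs_def])

lemma lie_subspace_image:
  assumes "subspace G" "G \<subseteq> U" shows "lie_subspace (quotient U R) (coset ` G)"
proof -
  have R: "R \<in> coset ` G" using subspace_0[OF assms(1)] coset_0 by (metis image_eqI)
  have add: "ladd (quotient U R) x y \<in> coset ` G" if "x \<in> coset ` G" "y \<in> coset ` G" for x y
    using that subspace_add[OF assms(1)] by (auto simp only: image_iff quotient_simps)
  have scale: "lscale (quotient U R) c x \<in> coset ` G" if "x \<in> coset ` G" for c x
    using that subspace_scale[OF assms(1)] by (auto simp only: image_iff quotient_simps)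
  show ?thesis unfolding lie_subspace_def quotient_simps(1,2)
    by (intro conjI ballI allI image_mono assms(2) R add scale)
qed

lemma subspace_preimage:
  assumes "lie_subspace (quotient U R) X" shows "subspace {x. coset x \<in> X}" "R \<subseteq> {x. coset x \<in> X}"
proof -
  have X: "R \<in> X" "\<And>A B. A \<in> X \<Longrightarrow> B \<in> X \<Longrightarrow> ladd (quotient U R) A B \<in> X"
    "\<And>c A. A \<in> X \<Longrightarrow> lscale (quotient U R) c A \<in> X"
    using assms by (auto simp: lie_subspace_def quotient_simps)
  show "subspace {x. coset x \<in> X}"
    using X(1) X(2)[of "coset _" "coset _"] X(3)[of "coset _"]
    by (intro subspaceI) (auto simp: quotient_simps coset_0)
  show "R \<subseteq> {x. coset x \<in> X}" using X(1) coset_eq_R by (metis mem_Collect_eq subsetI)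
qed

text \<open>With \<open>R\<close> included this is the full preimage of the product of two sets of
  cosets.\<close>

definition br_span :: "'a set \<Rightarrow> 'a set \<Rightarrow> 'a set" where
  "br_span S T = span (R \<union> {br x y |x y. x \<in> S \<and> y \<in> T})"

lemma lie_product_quotient:
  assumes U: "subspace U" "R \<subseteq> U" and ST: "\<And>x y. x \<in> S \<Longrightarrow> y \<in> T \<Longrightarrow> br x y \<in> U"
  shows "lie_product (quotient U R) (coset ` S) (coset ` T) = coset ` br_span S T"
proof -
  define G where "G = {lbr (quotient U R) x y |x y. x \<in> coset ` S \<and> y \<in> coset ` T}"
  have G: "G = coset ` {br x y |x y. x \<in> S \<and> y \<in> T}"
    unfolding G_def by (auto simp: quotient_simps) (metis (mono_tags, lifting) image_eqI mem_Collect_eq quotient_simps(5))+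
  have "br_span S T \<subseteq> U" unfolding br_span_def using U ST by (intro span_minimal) auto
  then have "lie_subspace (quotient U R) (coset ` br_span S T)"
    by (intro lie_subspace_image) (simp_all add: br_span_def)
  moreover have "G \<subseteq> coset ` br_span S T" unfolding G br_span_def by (intro image_mono) (auto intro: span_base)
  ultimately have "lie_subspace (quotient U R) hull G \<subseteq> coset ` br_span S T" by (intro hull_minimal)
  moreover have "coset ` br_span S T \<subseteq> lie_subspace (quotient U R) hull G"
    unfolding hull_def
  proof (rule Inter_greatest)
    fix X assume "X \<in> {X. lie_subspace (quotient U R) X \<and> G \<subseteq> X}"
    then have X: "lie_subspace (quotient U R) X" "G \<subseteq> X" by auto
    have "br_span S T \<subseteq> {x. coset x \<in> X}"
      unfolding br_span_def using subspace_preimage[OF X(1)] X(2)[unfolded G] by (intro span_minimal) blast+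
    then show "coset ` br_span S T \<subseteq> X" by blast
  qed
  ultimately show ?thesis unfolding lie_product_def G_def by blast
qed

text \<open>Preimages of derived terms contain \<open>R\<close>, which \<open>dser\<close> may not;
  the two-sided bound on the representatives \<open>G\<close> absorbs the difference.\<close>

lemma derived_series_quotient:
  assumes U: "subalg U" "R \<subseteq> U"
  shows "\<exists>G. derived_series (quotient U R) n = coset ` G \<and> dser U n \<subseteq> G \<and> G \<subseteq> U \<and>
    G \<subseteq> sumset (dser U n) R"
proof (induction n)
  case 0
  show ?case using subspace_0[OF sR] by (intro exI[of _ U]) (force simp: quotient_simps)
next
  case (Suc n)
  then obtain G where G: "derived_series (quotient U R) n = coset ` G" "dser U n \<subseteq> G" "G \<subseteq> U"
    "G \<subseteq> sumset (dser U n) R" by blast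
  have brU: "br x y \<in> U" if "x \<in> G" "y \<in> G" for x y using that G(3) subalgD(2)[OF U(1)] by blast
  have "derived_series (quotient U R) (Suc n) = coset ` br_span G G"
    using lie_product_quotient[OF subalgD(1)[OF U(1)] U(2) brU] G(1) by simp
  moreover have "dser U (Suc n) \<subseteq> br_span G G"
    unfolding br_span_def dser.simps using G(2) by (intro span_mono) blast
  moreover have "br_span G G \<subseteq> U" unfolding br_span_def using U brU subalgD(1) by (intro span_minimal) auto
  moreover have "br_span G G \<subseteq> sumset (dser U (Suc n)) R"
    unfolding br_span_def
  proof (rule span_minimal)
    have s: "subspace (dser U (Suc n))" by simp
    show "subspace (sumset (dser U (Suc n)) R)" by (rule subspace_sums[OF s sR])
    have "r \<in> sumset (dser U (Suc n)) R" if "r \<in> R" for r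
      using that subspace_0[OF s] by force
    moreover have "br x y \<in> sumset (dser U (Suc n)) R" if xy: "x \<in> G" "y \<in> G" for x y
    proof -
      obtain a b where a: "x = a + b" "a \<in> dser U n" "b \<in> R" using G(4) xy(1) by blast
      obtain c d where c: "y = c + d" "c \<in> dser U n" "d \<in> R" using G(4) xy(2) by blast
      have "br a c \<in> dser U (Suc n)" unfolding dser.simps by (rule span_base) (use a c in blast)
      moreover have "br a d + br b y \<in> R" using Rl Rr a c by (intro subspace_add sR)
      moreover have "br x y = br a c + (br a d + br b y)" by (simp add: a c br_simps)
      ultimately show ?thesis by blast
    qed
    ultimately show "R \<union> {br x y |x y. x \<in> G \<and> y \<in> G} \<subseteq> sumset (dser U (Suc n)) R" by blast
  qed
  ultimately show ?case by blast
qed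

lemma lie_solvable_quotient:
  assumes U: "subalg U" "R \<subseteq> U" shows "lie_solvable (quotient U R) \<longleftrightarrow> solv R U"
proof -
  have "derived_series (quotient U R) n = {R} \<longleftrightarrow> dser U n \<subseteq> R" for n
  proof -
    obtain G where G: "derived_series (quotient U R) n = coset ` G" "dser U n \<subseteq> G"
      "G \<subseteq> sumset (dser U n) R" using derived_series_quotient[OF U, of n] by blast
    have G0: "0 \<in> G" using G(2) subspace_0[OF subspace_dser[OF subalgD(1)[OF U(1)], of n]] by blast
    have "coset ` G = {R} \<longleftrightarrow> G \<subseteq> R"
    proof
      assume G1: "coset ` G = {R}"
      show "G \<subseteq> R"
      proof
        fix g assume "g \<in> G"
        then have "coset g \<in> {R}" unfolding G1[symmetric] by (rule imageI)
        then show "g \<in> R" by (simp add: coset_eq_R)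
      qed
    next
      assume "G \<subseteq> R"
      then have "\<forall>g\<in>G. coset g = R" by (auto simp: coset_eq_R)
      then show "coset ` G = {R}" using G0 by (auto simp: image_iff)
    qed
    moreover have "G \<subseteq> R \<longleftrightarrow> dser U n \<subseteq> R"
    proof
      assume d: "dser U n \<subseteq> R"
      show "G \<subseteq> R"
      proof
        fix g assume "g \<in> G"
        then obtain a b where "g = a + b" "a \<in> dser U n" "b \<in> R" using G(3) by blast
        then show "g \<in> R" using d subspace_add[OF sR] by blast
      qed
    qed (use G(2) in blast)
    ultimately show ?thesis using G(1) by simp
  qed
  then show ?thesis by (simp add: lie_solvable_def solv_def quotient_simps)
qed

lemma solvable_radical_quotient:
  assumes B: "ideal_of UNIV B" "R \<subseteq> B" "solv R B"
    and greatest: "\<And>I. ideal_of UNIV I \<Longrightarrow> R \<subseteq> I \<Longrightarrow> solv R I \<Longrightarrow> I \<subseteq> B"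
  shows "solvable_radical (quotient UNIV R) = coset ` B"
  unfolding solvable_radical_def
proof (rule Greatest_equality)
  show "lie_ideal (quotient UNIV R) (coset ` B) \<and> lie_solvable (quotient UNIV R\<lparr>lcarrier := coset ` B\<rparr>)"
    unfolding quotient_restrict lie_solvable_quotient[OF ideal_of_subalg[OF B(1)] B(2)]
    using lie_subspace_image[OF ideal_ofD(1)[OF B(1)] subset_UNIV] B(3) ideal_ofD(3,4)[OF B(1)]
    by (auto simp: lie_ideal_def quotient_simps)
next
  fix X assume X: "lie_ideal (quotient UNIV R) X \<and> lie_solvable (quotient UNIV R\<lparr>lcarrier := X\<rparr>)"
  define I where "I = {x. coset x \<in> X}"
  have sub: "lie_subspace (quotient UNIV R) X" using X by (simp add: lie_ideal_def)
  then have "X \<subseteq> range coset" by (auto simp: lie_subspace_def quotient_simps)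
  then have XI: "X = coset ` I" by (auto simp: I_def)
  have RI: "R \<subseteq> I" using subspace_preimage[OF sub] by (simp add: I_def)
  have "lbr (quotient UNIV R) (coset y) (coset s) \<in> X \<and> lbr (quotient UNIV R) (coset s) (coset y) \<in> X"
    if "coset s \<in> X" for y s
    using X that unfolding lie_ideal_def quotient_simps(1) by blast
  then have iI: "ideal_of UNIV I"
    unfolding ideal_of_def using subspace_preimage[OF sub] by (simp add: I_def quotient_simps)
  have "solv R I" using X lie_solvable_quotient[OF ideal_of_subalg[OF iI] RI] by (simp add: XI quotient_restrict)
  then show "X \<subseteq> coset ` B" using greatest[OF iI RI] XI by blast
qed

text \<open>The chain \<open>L\<close>, \<open>I\<close>, \<open>R\<close> bounds the nilpotency
  class by two: the lower central term with index \<open>2\<close> is already zero.\<close>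

lemma lie_nilpotent_quotient:
  assumes L: "subalg L" "R \<subseteq> L" and I: "subspace I" "R \<subseteq> I"
    and LL: "\<And>a b. a \<in> L \<Longrightarrow> b \<in> L \<Longrightarrow> br a b \<in> I" and LI: "\<And>a b. a \<in> L \<Longrightarrow> b \<in> I \<Longrightarrow> br a b \<in> R"
  shows "lie_nilpotent (quotient L R)"
proof -
  note sL = subalgD(1)[OF L(1)] and brL = subalgD(2)[OF L(1)]
  have 1: "lower_central (quotient L R) 1 = coset ` br_span L L"
    using lie_product_quotient[OF sL L(2) brL] by (simp add: quotient_simps)
  have LLI: "br_span L L \<subseteq> I" unfolding br_span_def using I LL by (intro span_minimal) auto
  have "lower_central (quotient L R) (Suc 1) = coset ` br_span L (br_span L L)"
    unfolding lower_central.simps 1 quotient_simps(1)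
    by (rule lie_product_quotient[OF sL L(2)]) (use LLI LI L(2) in blast)
  moreover have "br_span L (br_span L L) \<subseteq> R"
    unfolding br_span_def[of L "br_span L L"] using LLI LI by (intro span_minimal sR) blast
  moreover have "0 \<in> br_span L (br_span L L)" unfolding br_span_def by (rule span_zero)
  then have "R \<in> coset ` br_span L (br_span L L)" using coset_0 by (metis image_eqI)
  moreover have "coset g = R" if "g \<in> br_span L (br_span L L)" for g
    using that \<open>br_span L (br_span L L) \<subseteq> R\<close> by (auto simp: coset_eq_R)
  ultimately have "lower_central (quotient L R) (Suc 1) = {R}" by auto
  then show ?thesis unfolding lie_nilpotent_def quotient_simps(2) by blast
qed

end

theorem theorem3:
  fixes scale :: "complex \<Rightarrow> 'a::ab_group_add \<Rightarrow> 'a"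
    and br :: "'a \<Rightarrow> 'a \<Rightarrow> 'a"
    and R B :: "'a set"
  assumes "left_central_leibniz_algebra scale br"
    and "complex_algebra.rank scale br = 1"
    and "R = complex_algebra.radical br"
    and "module.subspace scale B" and "R \<subseteq> B"
    and "lcarrier (complex_algebra.quotient scale br B R) =
         solvable_radical (complex_algebra.quotient scale br UNIV R)"
  shows "\<exists>L \<in> complex_algebra.maximal_lie_subalgebras scale br.
           complex_algebra.maximal_isotropic scale br L \<and>
           lie_nilpotent (complex_algebra.quotient scale br L R) \<and>
           L \<subseteq> B"
proof -
  interpret left_central_leibniz_algebra scale br by fact
  interpret leibniz_quotient scale br R
    by unfold_locales (simp add: assms(3) ideal_radical)
  obtain B0 where B0: "ideal_of UNIV B0" "R \<subseteq> B0" "solv R B0"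
    "\<And>I. ideal_of UNIV I \<Longrightarrow> R \<subseteq> I \<Longrightarrow> solv R I \<Longrightarrow> I \<subseteq> B0"
    by (rule greatest_solvable_ideal[OF ideal_R], rule that)
  have cosets: "coset ` B = coset ` B0"
    using assms(6) solvable_radical_quotient[OF B0] by (simp add: quotient_simps)
  \<comment> \<open>A subspace containing \<open>R\<close> is determined by its cosets, so the
    equation of quotients identifies \<open>B\<close> itself.\<close>
  have subset_of_cosets: "U \<subseteq> V" if UV: "coset ` U \<subseteq> coset ` V" "subspace V" "R \<subseteq> V" for U V
  proof
    fix u assume "u \<in> U"
    then have "coset u \<in> coset ` V" using UV(1) by blast
    then obtain v where "v \<in> V" "coset u = coset v" by (elim imageE)
    moreover from this have "u - v \<in> R" by (simp add: coset_eq_iff)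
    ultimately have "v + (u - v) \<in> V" using \<open>R \<subseteq> V\<close> by (intro subspace_add[OF \<open>subspace V\<close>]) auto
    then show "u \<in> V" by simp
  qed
  have B: "B = B0"
  proof
    show "B \<subseteq> B0" using subset_of_cosets[OF _ ideal_ofD(1)[OF B0(1)] B0(2)] cosets by simp
    show "B0 \<subseteq> B" using subset_of_cosets[OF _ assms(4,5)] cosets by simp
  qed
  obtain Z where Z: "Z \<subseteq> leibniz_kernel" "independent Z" "leibniz_kernel \<subseteq> span Z" "card Z = 1"
    using basis_exists[of leibniz_kernel] assms(2) by (auto simp: rank_def)
  then obtain z where z: "Z = {z}" using card_1_singletonE by metis
  have "leibniz_kernel = span {z}"
    using Z z span_minimal[OF _ subspace_kernel, of "{z}"] by blast
  moreover have "z \<noteq> 0" using Z(2) z by simp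
  ultimately interpret rank_one_solvable_radical scale br z B
  proof unfold_locales
    show "ideal_of UNIV B" "radical \<subseteq> B" "solv radical B" unfolding B
      using B0(1-3) by (simp_all only: assms(3))
    show "I \<subseteq> B" if "ideal_of UNIV I" "radical \<subseteq> I" "solv radical I" for I
      unfolding B by (rule B0(4)) (use that in \<open>simp_all only: assms(3)\<close>)
  qed
  obtain L where L: "perp B \<subseteq> L" "L \<subseteq> B" "maximal_isotropic L" "\<And>b l. b \<in> B \<Longrightarrow> l \<in> L \<Longrightarrow> br b l \<in> L"
    by (rule maximal_isotropic_ideal, rule that)
  have brL: "br a b \<in> L" if "a \<in> L" "b \<in> L" for a b using L that by blast
  have iso: "isotropic L" using L(3) by (simp add: maximal_isotropic_def)
  then have sL: "subspace L" by (simp add: isotropic_def)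
  have RL: "R \<subseteq> perp B" using radical_subset_perp by (simp add: assms(3))
  \<comment> \<open>Invariance reduces this to \<open>psi b [a, y] = 0\<close>. The product
    \<open>[a, y]\<close> lies in \<open>L\<close> because \<open>[y, a]\<close> does and their sum
    is in \<open>R\<close>, so isotropy of \<open>L\<close> applies.\<close>
  have "br a b \<in> perp B" if ab: "a \<in> L" "b \<in> L" for a b
    unfolding perp_def
  proof (intro CollectI ballI)
    fix y assume "y \<in> B"
    have "br a y = psi a y - br y a" by (rule br_flip)
    moreover have "psi a y \<in> L" using psi_in_kernel kernel_subset_radical RL L(1) assms(3) by blast
    ultimately have "br a y \<in> L" using L(4)[OF \<open>y \<in> B\<close> ab(1)] subspace_diff[OF sL] by simp
    then have "psi b (br a y) = 0" using iso ab by (simp add: isotropic_def)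
    then show "psi (br a b) y = 0" by (simp add: psi_invariant)
  qed
  moreover have "br a b \<in> R" if "a \<in> L" "b \<in> perp B" for a b
    using br_perp(1)[OF ideal_B] that L(2) assms(3) by blast
  moreover have "subalg L" using sL brL by (simp add: subalg_def)
  ultimately have "lie_nilpotent (quotient L R)"
    using RL L(1) subspace_perp by (intro lie_nilpotent_quotient[of L "perp B"]) auto
  then show ?thesis using maximal_lie_of_maximal_isotropic[OF L(3) brL] L(2,3) by blast
qed

end
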